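(* Let $\alpha,\beta$ be constants with $0<\beta<\alpha<1$, and consider integers $n\to\infty$ with $k=\beta n$ and $m=\alpha n$ integers. Let $A$ be an $m\times n$ matrix with i.i.d. standard normal entries, let $\mathbf{x}\in\mathbb{R}^n$ be $k$-sparse with the location and the signs of its nonzero elements arbitrarily chosen but fixed, let $\mathbf{y}=A\mathbf{x}$, and let $P_{err}$ be the probability that the solution of $\min\|\mathbf{z}\|_1$ subject to $A\mathbf{z}=\mathbf{y}$ is not $\mathbf{x}$. Let $\alpha>\alpha_w$, where $\alpha_w\in(\beta,1)$ is such that $\xi_{\alpha_w}(\beta)=1$. Let $\beta_w\in[0,\alpha)$ satisfy $$\xi_\alpha(\beta_w)=(1-\beta_w)\frac{\sqrt{\frac2\pi}\,e^{-\left(\mathrm{erfinv}\left(\frac{1-\alpha}{1-\beta_w}\right)\right)^2}}{\alpha\sqrt2\,\mathrm{erfinv}\left(\frac{1-\alpha}{1-\beta_w}\right)}=1,$$ and let $\beta_0<\alpha$ satisfy $$\frac{\alpha-\beta}{\alpha-\beta_0}\,\xi_\alpha(\beta_0)=\frac{\alpha-\beta}{\alpha-\beta_0}(1-\beta_0)\frac{\sqrt{\frac2\pi}\,e^{-\left(\mathrm{erfinv}\left(\frac{1-\alpha}{1-\beta_0}\right)\right)^2}}{\alpha\sqrt2\,\mathrm{erfinv}\left(\frac{1-\alpha}{1-\beta_0}\right)}=1.$$ Then $$I_{err}(\alpha,\beta):=\lim_{n\to\infty}\frac{\log P_{err}}{n}\le I_{ldp}(\alpha,\beta):=\alpha\log\left(\frac{\mathrm{erfinv}\left(\frac{1-\alpha}{1-\beta_w}\right)}{\mathrm{erfinv}\left(\frac{1-\alpha}{1-\beta_0}\right)}\right)+(1-\beta)\log\left(\frac{1-\beta}{1-\beta_w}\right)+\beta\log\left(\frac{(\alpha-\beta)(1-\beta_0)}{(\alpha-\beta_0)(1-\beta_w)}\right).$$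 Moreover, with $F$ the objective function defined in the context, the choice $$\nu=\sqrt2\,\mathrm{erfinv}\left(\tfrac{1-\alpha}{1-\beta_w}\right),\qquad A_0=\frac{\mathrm{erfinv}\left(\frac{1-\alpha}{1-\beta_w}\right)}{\mathrm{erfinv}\left(\frac{1-\alpha}{1-\beta_0}\right)},\qquad c_3=\frac{(1-A_0^2)\sqrt\alpha}{A_0},\qquad \gamma=\frac{c_3}{2(1-A_0^2)}=\frac{\sqrt\alpha}{2A_0}$$ achieves $F(c_3,\nu,\gamma)=I_{ldp}(\alpha,\beta)$.
   Context: A vector is called $k$-sparse here if it has exactly $k$ nonzero entries. $\mathrm{erf}(x)=\frac{2}{\sqrt\pi}\int_0^x e^{-t^2}dt$, $\mathrm{erfc}=1-\mathrm{erf}$, and $\mathrm{erfinv}:(-1,1)\to\mathbb{R}$ is the inverse of $\mathrm{erf}$. Logarithms are natural. For $\alpha\in(0,1)$ and $b<\alpha$, $$\xi_\alpha(b)=(1-b)\frac{\sqrt{\frac2\pi}\,e^{-\left(\mathrm{erfinv}\left(\frac{1-\alpha}{1-b}\right)\right)^2}}{\alpha\sqrt2\,\mathrm{erfinv}\left(\frac{1-\alpha}{1-b}\right)}.$$ The numbers $\alpha_w$, $\beta_w$, $\beta_0$ exist and are unique in the indicated ranges. The objective function (of the optimization problem bounding $I_{err}$, over $c_3\ge0$, $\nu\ge 0$, $\gamma>c_3/2$) is $$F(c_3,\nu,\gamma)=-\frac{c_3^2}{2}+I_{sph}+(1-\beta)\log w_1+\beta\log w_2+c_3\gamma,$$ with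 $$I_{sph}=\widehat\gamma c_3-\frac{\alpha}{2}\log\left(1-\frac{c_3}{2\widehat\gamma}\right),\quad \widehat\gamma=\frac{c_3-\sqrt{c_3^2+4\alpha}}{4},$$ $$w_1=\frac{e^{\frac{c_3\nu^2/(4\gamma)}{1-c_3/(2\gamma)}}}{\sqrt{1-\frac{c_3}{2\gamma}}}\,\mathrm{erfc}\!\left(\frac{\nu}{\sqrt2\sqrt{1-\frac{c_3}{2\gamma}}}\right)+\mathrm{erf}\!\left(\frac{\nu}{\sqrt2}\right),\quad w_2=\frac{e^{\frac{c_3\nu^2/(4\gamma)}{1-c_3/(2\gamma)}}}{\sqrt{1-\frac{c_3}{2\gamma}}}.$$ *)

theory Defs
  imports "HOL-Probability.Probability" "Jordan_Normal_Form.Matrix"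
begin

(* The infix $ of HOL-Analysis is switched off so that it always means vec_index
   of Jordan_Normal_Form; likewise 'a vec is the type of Jordan_Normal_Form. *)
unbundle no vec_syntax

definition erf :: "real \<Rightarrow> real" where
  "erf x = 2 / sqrt pi * (LBINT t=ereal 0..ereal x. exp (- (t\<^sup>2)))"

definition erfc :: "real \<Rightarrow> real" where
  "erfc x = 1 - erf x"

(* Only meaningful on {-1<..<1}, the range of the injective function erf. *)
definition erfinv :: "real \<Rightarrow> real" where
  "erfinv y = the_inv erf y"

definition xi :: "real \<Rightarrow> real \<Rightarrow> real" where
  "xi \<alpha> b = (1 - b) *
     (sqrt (2 / pi) * exp (- ((erfinv ((1 - \<alpha>) / (1 - b)))\<^sup>2)) /
      (\<alpha> * sqrt 2 * erfinv ((1 - \<alpha>) / (1 - b))))"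

definition std_normal_matrix :: "'w measure \<Rightarrow> nat \<Rightarrow> nat \<Rightarrow> ('w \<Rightarrow> real mat) \<Rightarrow> bool" where
  "std_normal_matrix M m n A \<longleftrightarrow>
     prob_space M \<and>
     (\<forall>\<omega>\<in>space M. A \<omega> \<in> carrier_mat m n) \<and>
     prob_space.indep_vars M (\<lambda>_. borel) (\<lambda>ij \<omega>. A \<omega> $$ ij) ({..<m} \<times> {..<n}) \<and>
     (\<forall>ij \<in> {..<m} \<times> {..<n}. distributed M lborel (\<lambda>\<omega>. A \<omega> $$ ij) std_normal_density)"

definition k_sparse :: "nat \<Rightarrow> real vec \<Rightarrow> bool" where
  "k_sparse k x \<longleftrightarrow> card {i. i < dim_vec x \<and> x $ i \<noteq> 0} = k"

definition l1_norm :: "real vec \<Rightarrow> real" where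
  "l1_norm z = (\<Sum>i<dim_vec z. \<bar>z $ i\<bar>)"

definition l1_solutions :: "real mat \<Rightarrow> real vec \<Rightarrow> real vec set" where
  "l1_solutions A y =
     {z \<in> carrier_vec (dim_col A). A *\<^sub>v z = y \<and>
        (\<forall>z' \<in> carrier_vec (dim_col A). A *\<^sub>v z' = y \<longrightarrow> l1_norm z \<le> l1_norm z')}"

(* Recovery counts as failed also if x is a minimizer but not the only one.
   For Gaussian A the event is measurable: it says that some nonzero w with
   A w = 0 has l1_norm (x + w) \<le> l1_norm x, which is a countable union of
   closed conditions on the entries of A (one for each lower bound 1 / Suc j
   on l1_norm w). *)
definition P_err :: "'w measure \<Rightarrow> ('w \<Rightarrow> real mat) \<Rightarrow> real vec \<Rightarrow> real" where
  "P_err M A x = measure M {\<omega> \<in> space M. l1_solutions (A \<omega>) (A \<omega> *\<^sub>v x) \<noteq> {x}}"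

(* ln 0 = 0 on the reals, hence the logarithm of a probability is taken in ereal. *)
definition log_prob :: "real \<Rightarrow> ereal" where
  "log_prob p = (if p = 0 then - \<infinity> else ereal (ln p))"

(* n tends to infinity through those n for which \<beta> n and \<alpha> n are integers. *)
definition proportional :: "real \<Rightarrow> real \<Rightarrow> nat filter" where
  "proportional \<alpha> \<beta> = inf sequentially (principal {n. \<beta> * real n \<in> \<nat> \<and> \<alpha> * real n \<in> \<nat>})"

(* The upper limit: a bound on it bounds the limit, whenever the limit exists. *)
definition I_err :: "real \<Rightarrow> real \<Rightarrow> (nat \<Rightarrow> real) \<Rightarrow> ereal" where
  "I_err \<alpha> \<beta> P = Limsup (proportional \<alpha> \<beta>) (\<lambda>n. log_prob (P n) / ereal (real n))"

definition I_ldp :: "real \<Rightarrow> real \<Rightarrow> real \<Rightarrow> real \<Rightarrow> real" where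
  "I_ldp \<alpha> \<beta> \<beta>\<^sub>w \<beta>\<^sub>0 =
     \<alpha> * ln (erfinv ((1 - \<alpha>) / (1 - \<beta>\<^sub>w)) / erfinv ((1 - \<alpha>) / (1 - \<beta>\<^sub>0))) +
     (1 - \<beta>) * ln ((1 - \<beta>) / (1 - \<beta>\<^sub>w)) +
     \<beta> * ln (((\<alpha> - \<beta>) * (1 - \<beta>\<^sub>0)) / ((\<alpha> - \<beta>\<^sub>0) * (1 - \<beta>\<^sub>w)))"

definition gamma_hat :: "real \<Rightarrow> real \<Rightarrow> real" where
  "gamma_hat \<alpha> c\<^sub>3 = (c\<^sub>3 - sqrt (c\<^sub>3\<^sup>2 + 4 * \<alpha>)) / 4"

definition I_sph :: "real \<Rightarrow> real \<Rightarrow> real" where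
  "I_sph \<alpha> c\<^sub>3 = gamma_hat \<alpha> c\<^sub>3 * c\<^sub>3 - \<alpha> / 2 * ln (1 - c\<^sub>3 / (2 * gamma_hat \<alpha> c\<^sub>3))"

definition w2 :: "real \<Rightarrow> real \<Rightarrow> real \<Rightarrow> real" where
  "w2 c\<^sub>3 \<nu> \<gamma> =
     exp ((c\<^sub>3 * \<nu>\<^sup>2 / (4 * \<gamma>)) / (1 - c\<^sub>3 / (2 * \<gamma>))) / sqrt (1 - c\<^sub>3 / (2 * \<gamma>))"

definition w1 :: "real \<Rightarrow> real \<Rightarrow> real \<Rightarrow> real" where
  "w1 c\<^sub>3 \<nu> \<gamma> =
     exp ((c\<^sub>3 * \<nu>\<^sup>2 / (4 * \<gamma>)) / (1 - c\<^sub>3 / (2 * \<gamma>))) / sqrt (1 - c\<^sub>3 / (2 * \<gamma>)) *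
       erfc (\<nu> / (sqrt 2 * sqrt (1 - c\<^sub>3 / (2 * \<gamma>)))) +
     erf (\<nu> / sqrt 2)"

definition objective :: "real \<Rightarrow> real \<Rightarrow> real \<Rightarrow> real \<Rightarrow> real \<Rightarrow> real" where
  "objective \<alpha> \<beta> c\<^sub>3 \<nu> \<gamma> =
     - (c\<^sub>3\<^sup>2 / 2) + I_sph \<alpha> c\<^sub>3 +
     (1 - \<beta>) * ln (w1 c\<^sub>3 \<nu> \<gamma>) + \<beta> * ln (w2 c\<^sub>3 \<nu> \<gamma>) + c\<^sub>3 * \<gamma>"

end

theory Submission
  imports Defs
begin

text \<open>Recovery fails only if some unit vector \<open>w\<close> of the descent cone of the \<open>l1\<close>-norm at \<open>x\<close> satisfies \<open>A w = 0\<close>.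
  Gordon's comparison in exponential form bounds the expectation of \<open>max\<^sub>w exp (- c (|A w| + g\<^sub>0))\<close> by that of
  \<open>max\<^sub>w exp (- c (|g| + h \<cdot> w))\<close>, where \<open>g\<^sub>0\<close>, \<open>g\<close>, \<open>h\<close> are independent standard Gaussians; hence, up to a constant
  factor, the failure probability is at most \<open>exp (- c\<^sup>2 / 2)\<close> times the expectation of \<open>exp (- c |g|)\<close> times that of
  \<open>max\<^sub>w exp (- c h \<cdot> w)\<close>. Put \<open>c = c\<^sub>3 sqrt n\<close>. The \<open>g\<close>-factor has exponential rate \<open>I_sph\<close>. In the \<open>h\<close>-factor one adds \<open>\<nu>\<close> times the
  cone constraint and applies Cauchy--Schwarz, which bounds \<open>- h \<cdot> w\<close> by the norm \<open>X\<close> of a shifted and soft-thresholded \<open>h\<close>; then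
  \<open>c X \<le> c\<^sub>3 X\<^sup>2 / (4 \<gamma>) + c\<^sub>3 \<gamma> n\<close> decouples the coordinates and produces the Gaussian integrals \<open>w1\<close> and \<open>w2\<close>.
  For the prescribed parameters the equations for \<open>\<beta>\<^sub>w\<close> and \<open>\<beta>\<^sub>0\<close> give \<open>w1 = (1 - \<beta>) / (1 - \<beta>\<^sub>w)\<close> and
  \<open>w2 = (\<alpha> - \<beta>) (1 - \<beta>\<^sub>0) / ((\<alpha> - \<beta>\<^sub>0) (1 - \<beta>\<^sub>w))\<close>. That \<open>c\<^sub>3 > 0\<close> rests on \<open>\<beta> < \<beta>\<^sub>w\<close> and on the monotonicity of
  \<open>q exp (q\<^sup>2) erfc q\<close>.\<close>

subsection \<open>The error function and one-dimensional Gaussian integrals\<close>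

text \<open>Gaussian interpolation handles a smooth function of finitely many directions, whereas
  the descent sphere is infinite; the estimate therefore has to be uniform in the number N of
  directions, which tends to infinity at fixed dimension. The maximum of
  \<open>exp (- c * z)\<close> is replaced by the q-th power of a sum of terms
  \<open>exp (- M * z)\<close> with \<open>M * q = c\<close>; with q of order 1 / ln N the loss
  stays below one constant factor for all N. A second obstacle is that a prescribed direction lies
  in the kernel with probability 0. So \<open>A w = 0\<close> is weakened to a bound 1 / c on the
  norm of \<open>A w\<close>, which changes \<open>exp (- c |A w|)\<close> by a bounded factor only.
  The variable \<open>g\<^sub>0\<close> equalizes the variances of the two processes. Being
  independent of A, it factors out with expectation \<open>exp (c\<^sup>2 / 2)\<close>; this is the
  origin of the term \<open>- c\<^sub>3\<^sup>2 / 2\<close> of the objective. Bounded factors vanish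
  in the rate. No concentration inequality enters: each factor on the comparison side is dominated
  by explicit Gaussian integrals.\<close>

lemma DERIV_erf: "(erf has_real_derivative 2 / sqrt pi * exp (- x\<^sup>2)) (at x)"
proof -
  \<comment> \<open>The margin 1 keeps x in the interior, so the derivative within the interval is
    the full derivative; the base point 0 lies in the interval as well.\<close>
  define a where "a = min x 0 - 1"
  define b where "b = max x 0 + 1"
  have "((\<lambda>u. LBINT y=ereal 0..ereal u. exp (- y\<^sup>2)) has_vector_derivative exp (- x\<^sup>2)) (at x within {a..b})"
    by (rule interval_integral_FTC2) (auto simp: a_def b_def intro!: continuous_intros)
  moreover have "at x within {a..b} = at x"
    by (rule at_within_interior) (auto simp: a_def b_def)
  ultimately have "((\<lambda>u. LBINT y=ereal 0..ereal u. exp (- y\<^sup>2)) has_real_derivative exp (- x\<^sup>2)) (at x)"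
    by (simp add: has_real_derivative_iff_has_vector_derivative)
  from DERIV_cmult[OF this, of "2 / sqrt pi"] show ?thesis
    unfolding erf_def[abs_def] .
qed

lemma DERIV_erf' [derivative_intros]:
  "(f has_real_derivative D) (at x) \<Longrightarrow>
   ((\<lambda>x. erf (f x)) has_real_derivative 2 / sqrt pi * exp (- (f x)\<^sup>2) * D) (at x)"
  using DERIV_chain2[OF DERIV_erf, of f D x UNIV] by simp

lemma isCont_erf [continuous_intros]: "isCont erf x"
  using DERIV_erf DERIV_isCont by blast

lemma continuous_on_erf: "continuous_on A erf"
  by (simp add: continuous_at_imp_continuous_on isCont_erf)

lemma erf_0 [simp]: "erf 0 = 0"
  by (simp add: erf_def)

lemma strict_mono_erf: "strict_mono erf"
proof (rule strict_monoI)
  fix x y :: real assume "x < y"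
  show "erf x < erf y"
    by (rule DERIV_pos_imp_increasing[OF \<open>x < y\<close>])
       (use DERIV_erf in \<open>auto intro!: exI\<close>)
qed

lemma tendsto_erf_at_top: "(erf \<longlongrightarrow> 1) at_top"
proof -
  have "((\<lambda>y. \<integral> x. indicator {..y} x *\<^sub>R (indicator {0..} x *\<^sub>R exp (- x\<^sup>2 :: real)) \<partial>lborel)
      \<longlongrightarrow> (\<integral> x. indicator {0..} x *\<^sub>R exp (- x\<^sup>2) \<partial>lborel)) at_top"
    using gaussian_moment_0
    by (intro tendsto_integral_at_top) (auto intro: integrable.intros)
  also have "(\<integral> x. indicator {0..} x *\<^sub>R exp (- x\<^sup>2 :: real) \<partial>lborel) = sqrt pi / 2"
    using gaussian_moment_0 by (rule has_bochner_integral_integral_eq)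
  finally have "((\<lambda>y. 2 / sqrt pi * (\<integral> x. indicator {..y} x *\<^sub>R (indicator {0..} x *\<^sub>R exp (- x\<^sup>2 :: real)) \<partial>lborel))
      \<longlongrightarrow> 2 / sqrt pi * (sqrt pi / 2)) at_top"
    by (rule tendsto_mult_left)
  moreover have "eventually (\<lambda>y. 2 / sqrt pi * (\<integral> x. indicator {..y} x *\<^sub>R (indicator {0..} x *\<^sub>R exp (- x\<^sup>2 :: real)) \<partial>lborel) = erf y) at_top"
    using eventually_ge_at_top[of 0]
  proof eventually_elim
    case (elim y)
    have "(LBINT t=ereal 0..ereal y. exp (- (t\<^sup>2))) = (\<integral> x. indicator {..y} x *\<^sub>R (indicator {0..} x *\<^sub>R exp (- x\<^sup>2 :: real)) \<partial>lborel)"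
      using elim
      by (auto simp: interval_integral_Icc set_lebesgue_integral_def indicator_def intro!: Bochner_Integration.integral_cong)
    then show ?case by (simp add: erf_def)
  qed
  ultimately show ?thesis
    by (simp add: filterlim_cong)
qed

lemma erf_less_1: "erf x < 1"
proof -
  have "erf (x + 1) \<le> 1"
  proof (rule tendsto_lowerbound[OF tendsto_erf_at_top])
    show "eventually (\<lambda>y. erf (x + 1) \<le> erf y) at_top"
      using eventually_ge_at_top[of "x + 1"]
      by eventually_elim (use strict_mono_erf in \<open>simp add: strict_mono_less_eq\<close>)
  qed simp
  moreover have "erf x < erf (x + 1)"
    using strict_mono_erf by (simp add: strict_mono_less)
  ultimately show ?thesis by simp
qed

lemma erf_pos_iff: "0 < erf x \<longleftrightarrow> 0 < x"
  using strict_mono_less[OF strict_mono_erf, of 0 x] by simp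

lemma erfc_pos: "0 < erfc x"
  using erf_less_1[of x] by (simp add: erfc_def)

lemma erf_erfinv:
  assumes "0 < y" "y < 1"
  shows "erf (erfinv y) = y" "0 < erfinv y"
proof -
  obtain b where b: "0 < b" "y < erf b"
  proof -
    have "eventually (\<lambda>x. y < erf x) at_top"
      using order_tendstoD(1)[OF tendsto_erf_at_top assms(2)] .
    moreover have "eventually (\<lambda>x::real. 0 < x) at_top"
      by (rule eventually_gt_at_top)
    ultimately have "eventually (\<lambda>x. y < erf x \<and> 0 < x) at_top"
      by eventually_elim simp
    then show ?thesis
      using that eventually_happens'[of "at_top :: real filter"] by (auto simp: trivial_limit_at_top_linorder)
  qed
  obtain x where x: "erf x = y"
    using IVT'[of erf 0 y b] b assms continuous_on_erf by auto
  have "erfinv y = x"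
    unfolding erfinv_def x[symmetric]
    by (rule the_inv_f_f) (rule strict_mono_imp_inj_on[OF strict_mono_erf])
  with x assms show "erf (erfinv y) = y" "0 < erfinv y"
    using erf_pos_iff[of x] by simp_all
qed

section \<open>The standard Gaussian measure on the line and its exponential integrals\<close>

definition gauss :: "real measure"
  where "gauss = density lborel (\<lambda>x. ennreal (std_normal_density x))"

lemma space_gauss [simp]: "space gauss = UNIV"
  and sets_gauss [simp, measurable_cong]: "sets gauss = sets borel"
  by (simp_all add: gauss_def)

lemma prob_space_gauss: "prob_space gauss"
  unfolding gauss_def by (rule prob_space_normal_density) simp

lemma has_bochner_integral_gauss:
  assumes "has_bochner_integral lborel (\<lambda>x. std_normal_density x * f x) y"
    and [measurable]: "f \<in> borel_measurable borel"
  shows "has_bochner_integral gauss f y"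
  using assms unfolding gauss_def has_bochner_integral_iff
  by (subst integrable_density integral_density; simp)+

text \<open>Half of \<open>erf\<close> at the standardized variable is an antiderivative of the
  density. The fundamental theorem for nonnegative integrands on a half-line then delivers
  integrability together with the value.\<close>

lemma has_bochner_integral_normal_tail:
  assumes "0 < \<sigma>"
  shows "has_bochner_integral lborel (\<lambda>x. normal_density \<mu> \<sigma> x * indicator {a<..} x)
           (erfc ((a - \<mu>) / (sqrt 2 * \<sigma>)) / 2)"
proof -
  define F where "F x = erf ((x - \<mu>) / (sqrt 2 * \<sigma>)) / 2" for x
  have D: "(F has_real_derivative normal_density \<mu> \<sigma> x) (at x)" for x
  proof -
    have "(F has_real_derivative 2 / sqrt pi * exp (- ((x - \<mu>) / (sqrt 2 * \<sigma>))\<^sup>2) * (1 / (sqrt 2 * \<sigma>)) / 2) (at x)"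
      unfolding F_def[abs_def] using assms by (auto intro!: derivative_eq_intros)
    also have "2 / sqrt pi * exp (- ((x - \<mu>) / (sqrt 2 * \<sigma>))\<^sup>2) * (1 / (sqrt 2 * \<sigma>)) / 2 = normal_density \<mu> \<sigma> x"
      using assms by (simp add: normal_density_def power_divide power_mult_distrib real_sqrt_mult)
    finally show ?thesis .
  qed
  have lim: "(F \<longlongrightarrow> 1 / 2) at_top"
  proof -
    have "filterlim (\<lambda>x. (x - \<mu>) / (sqrt 2 * \<sigma>)) at_top at_top"
      using assms by real_asymp
    from filterlim_compose[OF tendsto_erf_at_top this] show ?thesis
      unfolding F_def by (intro tendsto_intros) auto
  qed
  have "((F \<circ> real_of_ereal) \<longlongrightarrow> F a) (at_right (ereal a))"
    unfolding ereal_tendsto_simps using D[of a]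
    by (metis DERIV_isCont continuous_within filterlim_at_split isContD)
  moreover have "((F \<circ> real_of_ereal) \<longlongrightarrow> 1 / 2) (at_left \<infinity>)"
    unfolding ereal_tendsto_simps by (rule lim)
  moreover have "isCont (normal_density \<mu> \<sigma>) x" for x
    unfolding normal_density_def[abs_def] using assms by (intro continuous_intros) auto
  ultimately have "set_integrable lborel (einterval a \<infinity>) (normal_density \<mu> \<sigma>)"
    "(LBINT x=ereal a..\<infinity>. normal_density \<mu> \<sigma> x) = 1 / 2 - F a"
    using interval_integral_FTC_nonneg[of "ereal a" \<infinity> F "normal_density \<mu> \<sigma>" "F a" "1/2"] D by auto
  then show ?thesis
    unfolding has_bochner_integral_iff set_integrable_def interval_lebesgue_integral_def set_lebesgue_integral_def
    by (simp add: F_def erfc_def mult.commute diff_divide_distrib)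
qed

text \<open>Completing the square: an exponential-quadratic tilt of the standard normal is a
  multiple of a normal density with variance \<open>1 / (1 - a)\<close>. All integrals below thereby
  reduce to the total mass or to a tail of a normal law.\<close>

lemma std_normal_density_tilt:
  assumes "a < 1"
  shows "std_normal_density x * exp (a * x\<^sup>2 / 2 + b * x) =
    exp (b\<^sup>2 / (2 * (1 - a))) / sqrt (1 - a) * normal_density (b / (1 - a)) (1 / sqrt (1 - a)) x"
proof -
  define c where "c = 1 - a"
  have c: "0 < c" "a = 1 - c" using assms by (simp_all add: c_def)
  have "(x - b / c)\<^sup>2 * c = c * x\<^sup>2 - 2 * b * x + b\<^sup>2 / c"
    using c by (simp add: power2_eq_square field_simps)
  then have eq: "b\<^sup>2 / (2 * c) + - ((x - b / c)\<^sup>2 * c / 2) = - x\<^sup>2 / 2 + (a * x\<^sup>2 / 2 + b * x)"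
    unfolding c(2) by (simp add: field_simps)
  have "std_normal_density x * exp (a * x\<^sup>2 / 2 + b * x) = 1 / sqrt (2 * pi) * exp (- x\<^sup>2 / 2 + (a * x\<^sup>2 / 2 + b * x))"
    by (simp add: std_normal_density_def flip: exp_add)
  also have "\<dots> = 1 / sqrt (2 * pi) * (exp (b\<^sup>2 / (2 * c)) * exp (- ((x - b / c)\<^sup>2 * c / 2)))"
    by (simp only: eq[symmetric] exp_add)
  also have "\<dots> = exp (b\<^sup>2 / (2 * c)) / sqrt c * normal_density (b / c) (1 / sqrt c) x"
    using c(1) by (simp add: normal_density_def power_divide real_sqrt_divide)
  finally show ?thesis by (simp add: c_def)
qed

lemma gauss_exp_quadratic:
  assumes "a < 1"
  shows "has_bochner_integral gauss (\<lambda>x. exp (a * x\<^sup>2 / 2 + b * x)) (exp (b\<^sup>2 / (2 * (1 - a))) / sqrt (1 - a))"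
proof (rule has_bochner_integral_gauss)
  have "has_bochner_integral lborel (normal_density (b / (1 - a)) (1 / sqrt (1 - a))) 1"
    using assms by (auto simp: has_bochner_integral_iff)
  from has_bochner_integral_mult_right[OF this, of "exp (b\<^sup>2 / (2 * (1 - a))) / sqrt (1 - a)"]
  show "has_bochner_integral lborel (\<lambda>x. std_normal_density x * exp (a * x\<^sup>2 / 2 + b * x)) (exp (b\<^sup>2 / (2 * (1 - a))) / sqrt (1 - a))"
    unfolding std_normal_density_tilt[OF assms] by simp
qed measurable


lemma has_bochner_integral_gauss_reflect:
  fixes f :: "real \<Rightarrow> real"
  assumes "has_bochner_integral gauss f y"
  shows "has_bochner_integral gauss (\<lambda>x. f (- x)) y"
proof -
  have [measurable]: "f \<in> borel_measurable borel"
    using assms borel_measurable_has_bochner_integral by fastforce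
  have "has_bochner_integral lborel (\<lambda>x. std_normal_density x * f x) y"
    using assms integrable_density[of f lborel std_normal_density] integral_density[of f lborel std_normal_density]
    unfolding gauss_def has_bochner_integral_iff by auto
  then have "has_bochner_integral lborel (\<lambda>x. std_normal_density x * f (- x)) y"
    using lborel_has_bochner_integral_real_affine_iff[of "-1" "\<lambda>x. std_normal_density x * f x" y 0]
    by (simp add: std_normal_density_def)
  then show ?thesis
    by (rule has_bochner_integral_gauss) measurable
qed

lemma gauss_exp_square_shift:
  assumes "\<theta> < 1"
  shows "has_bochner_integral gauss (\<lambda>x. exp (\<theta> * (x + \<nu>)\<^sup>2 / 2)) (exp (\<theta> * \<nu>\<^sup>2 / (2 * (1 - \<theta>))) / sqrt (1 - \<theta>))"
proof -
  define c where "c = 1 - \<theta>"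
  have c: "0 < c" "\<theta> = 1 - c" using assms by (simp_all add: c_def)
  have "(\<theta> * \<nu>)\<^sup>2 / (2 * c) + \<theta> * \<nu>\<^sup>2 / 2 = \<theta> * \<nu>\<^sup>2 / (2 * c)"
    using c(1) unfolding c(2) by (simp add: field_simps power2_eq_square)
  then have "exp ((\<theta> * \<nu>)\<^sup>2 / (2 * c)) * exp (\<theta> * \<nu>\<^sup>2 / 2) = exp (\<theta> * \<nu>\<^sup>2 / (2 * c))"
    by (simp flip: exp_add)
  then have "exp ((\<theta> * \<nu>)\<^sup>2 / (2 * (1 - \<theta>))) / sqrt (1 - \<theta>) * exp (\<theta> * \<nu>\<^sup>2 / 2) = exp (\<theta> * \<nu>\<^sup>2 / (2 * (1 - \<theta>))) / sqrt (1 - \<theta>)"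
    by (simp add: c_def)
  moreover have "exp (\<theta> * x\<^sup>2 / 2 + \<theta> * \<nu> * x) * exp (\<theta> * \<nu>\<^sup>2 / 2) = exp (\<theta> * (x + \<nu>)\<^sup>2 / 2)" for x
    by (simp add: power2_eq_square algebra_simps add_divide_distrib flip: exp_add)
  ultimately show ?thesis
    using has_bochner_integral_mult_left[OF gauss_exp_quadratic[OF assms, of "\<theta> * \<nu>"], of "exp (\<theta> * \<nu>\<^sup>2 / 2)"]
    by (simp only:)
qed

lemma gauss_exp_square_tail:
  assumes "\<theta> < 1"
  shows "has_bochner_integral gauss (\<lambda>x. exp (\<theta> * (x - \<nu>)\<^sup>2 / 2) * indicator {\<nu><..} x)
     (exp (\<theta> * \<nu>\<^sup>2 / (2 * (1 - \<theta>))) / sqrt (1 - \<theta>) * (erfc (\<nu> / (sqrt 2 * sqrt (1 - \<theta>))) / 2))"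
proof (rule has_bochner_integral_gauss)
  define c where "c = 1 - \<theta>"
  have c: "0 < c" "\<theta> = 1 - c" using assms by (simp_all add: c_def)
  define B where "B = exp (\<theta> * \<nu>\<^sup>2 / (2 * c)) / sqrt c"
  have "std_normal_density x * exp (\<theta> * (x - \<nu>)\<^sup>2 / 2) = B * normal_density (- (\<theta> * \<nu>) / c) (1 / sqrt c) x" for x
  proof -
    have e1: "exp (\<theta> * (x - \<nu>)\<^sup>2 / 2) = exp (\<theta> * x\<^sup>2 / 2 + (- (\<theta> * \<nu>)) * x) * exp (\<theta> * \<nu>\<^sup>2 / 2)"
      by (simp add: power2_eq_square algebra_simps add_divide_distrib diff_divide_distrib flip: exp_add)
    have "(- (\<theta> * \<nu>))\<^sup>2 / (2 * c) + \<theta> * \<nu>\<^sup>2 / 2 = \<theta> * \<nu>\<^sup>2 / (2 * c)"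
      using c(1) unfolding c(2) by (simp add: field_simps power2_eq_square)
    then have e2: "exp ((- (\<theta> * \<nu>))\<^sup>2 / (2 * c)) * exp (\<theta> * \<nu>\<^sup>2 / 2) = exp (\<theta> * \<nu>\<^sup>2 / (2 * c))"
      by (simp only: exp_add[symmetric])
    have e3: "std_normal_density x * exp (\<theta> * x\<^sup>2 / 2 + (- (\<theta> * \<nu>)) * x) =
        exp ((- (\<theta> * \<nu>))\<^sup>2 / (2 * c)) / sqrt c * normal_density (- (\<theta> * \<nu>) / c) (1 / sqrt c) x"
      using std_normal_density_tilt[OF assms, of x "- (\<theta> * \<nu>)"] by (simp add: c_def)
    have "std_normal_density x * exp (\<theta> * (x - \<nu>)\<^sup>2 / 2) =
        exp ((- (\<theta> * \<nu>))\<^sup>2 / (2 * c)) / sqrt c * normal_density (- (\<theta> * \<nu>) / c) (1 / sqrt c) x * exp (\<theta> * \<nu>\<^sup>2 / 2)"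
      by (simp only: e1 mult.assoc[symmetric] e3)
    also have "\<dots> = (exp ((- (\<theta> * \<nu>))\<^sup>2 / (2 * c)) * exp (\<theta> * \<nu>\<^sup>2 / 2)) / sqrt c * normal_density (- (\<theta> * \<nu>) / c) (1 / sqrt c) x"
      by (simp only: times_divide_eq_left times_divide_eq_right mult_ac)
    finally show ?thesis by (simp only: e2 B_def)
  qed
  then have "std_normal_density x * (exp (\<theta> * (x - \<nu>)\<^sup>2 / 2) * indicator {\<nu><..} x) =
      B * (normal_density (- (\<theta> * \<nu>) / c) (1 / sqrt c) x * indicator {\<nu><..} x)" for x
    by (simp only: mult.assoc[symmetric])
  \<comment> \<open>The distance from the threshold to the tilted mean is \<open>\<nu> / c\<close>;
    measured in the tilted standard deviation \<open>1 / sqrt c\<close> it is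
    \<open>\<nu> / sqrt c\<close>, the argument of \<open>erfc\<close> in \<open>w1\<close> up to
    \<open>sqrt 2\<close>.\<close>
  moreover have "(\<nu> - (- (\<theta> * \<nu>)) / c) / (sqrt 2 * (1 / sqrt c)) = \<nu> / (sqrt 2 * sqrt c)"
  proof -
    have "\<nu> - (- (\<theta> * \<nu>)) / c = \<nu> / c"
      using c(1) unfolding c(2) by (simp add: field_simps)
    moreover obtain r where "0 < r" "c = r * r"
      using c(1) by (metis real_sqrt_gt_zero real_sqrt_mult_self abs_of_pos)
    ultimately show ?thesis by simp
  qed
  ultimately show "has_bochner_integral lborel (\<lambda>x. std_normal_density x * (exp (\<theta> * (x - \<nu>)\<^sup>2 / 2) * indicator {\<nu><..} x))
     (exp (\<theta> * \<nu>\<^sup>2 / (2 * (1 - \<theta>))) / sqrt (1 - \<theta>) * (erfc (\<nu> / (sqrt 2 * sqrt (1 - \<theta>))) / 2))"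
    using has_bochner_integral_mult_right[OF has_bochner_integral_normal_tail[of "1 / sqrt c" "- (\<theta> * \<nu>) / c" \<nu>], of B] c
    by (simp add: B_def flip: c_def)
qed measurable

lemma gauss_exp_square_soft_threshold:
  assumes "\<theta> < 1" "0 \<le> \<nu>"
  shows "has_bochner_integral gauss (\<lambda>x. exp (\<theta> * (max 0 (\<bar>x\<bar> - \<nu>))\<^sup>2 / 2))
     (exp (\<theta> * \<nu>\<^sup>2 / (2 * (1 - \<theta>))) / sqrt (1 - \<theta>) * erfc (\<nu> / (sqrt 2 * sqrt (1 - \<theta>))) + erf (\<nu> / sqrt 2))"
proof -
  let ?t = "\<lambda>\<theta> x. exp (\<theta> * (x - \<nu>)\<^sup>2 / 2) * indicator {\<nu><..} x"
  let ?v = "\<lambda>\<theta>. exp (\<theta> * \<nu>\<^sup>2 / (2 * (1 - \<theta>))) / sqrt (1 - \<theta>) * (erfc (\<nu> / (sqrt 2 * sqrt (1 - \<theta>))) / 2)"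
  interpret prob_space gauss by (rule prob_space_gauss)
  have one: "has_bochner_integral gauss (\<lambda>x. 1) (1::real)"
    using prob_space by (simp add: has_bochner_integral_iff)
  have t: "has_bochner_integral gauss (\<lambda>x. ?t \<theta> x + ?t \<theta> (- x)) (?v \<theta> + ?v \<theta>)" if "\<theta> < 1" for \<theta>
    by (intro has_bochner_integral_add has_bochner_integral_gauss_reflect gauss_exp_square_tail that)
  \<comment> \<open>For parameter 0 the function \<open>?t\<close> is the indicator of the tail, so
    1 minus both tails is the indicator of the band where the absolute value of x is at most \<nu>;
    there the thresholded integrand equals 1.\<close>
  have "has_bochner_integral gauss (\<lambda>x. (?t \<theta> x + ?t \<theta> (- x)) + (1 - (?t 0 x + ?t 0 (- x)))) ((?v \<theta> + ?v \<theta>) + (1 - (?v 0 + ?v 0)))"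
    by (intro has_bochner_integral_add has_bochner_integral_diff one t) (use assms in auto)
  moreover have "(?t \<theta> x + ?t \<theta> (- x)) + (1 - (?t 0 x + ?t 0 (- x))) = exp (\<theta> * (max 0 (\<bar>x\<bar> - \<nu>))\<^sup>2 / 2)" for x
    using assms by (auto simp: indicator_def max_def abs_if)
  moreover have "(?v \<theta> + ?v \<theta>) + (1 - (?v 0 + ?v 0)) = exp (\<theta> * \<nu>\<^sup>2 / (2 * (1 - \<theta>))) / sqrt (1 - \<theta>) * erfc (\<nu> / (sqrt 2 * sqrt (1 - \<theta>))) + erf (\<nu> / sqrt 2)"
    by (simp add: erfc_def)
  ultimately show ?thesis by simp
qed

lemma integrable_gauss_exp_abs: "integrable gauss (\<lambda>x. exp (c * \<bar>x\<bar>))"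
proof (rule Bochner_Integration.integrable_bound)
  have "integrable gauss (\<lambda>x. exp (0 * x\<^sup>2 / 2 + b * x))" for b :: real
    by (rule integrable.intros[OF gauss_exp_quadratic]) simp
  from this[of c] this[of "- c"] show "integrable gauss (\<lambda>x. exp (c * x) + exp (- c * x))"
    by simp
  show "AE x in gauss. norm (exp (c * \<bar>x\<bar>)) \<le> norm (exp (c * x) + exp (- c * x))"
  proof (rule AE_I2)
    fix x :: real
    have "exp (c * \<bar>x\<bar>) \<le> exp (c * x) + exp (- c * x)"
      by (cases "0 \<le> x") auto
    also have "\<dots> = norm (exp (c * x) + exp (- c * x))"
      by (simp add: add_nonneg_nonneg)
    finally show "norm (exp (c * \<bar>x\<bar>)) \<le> norm (exp (c * x) + exp (- c * x))"
      by simp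
  qed
qed measurable

text \<open>Integration by parts, since the density has derivative \<open>- x\<close> times itself.
  Exponential growth is allowed because the functional of the comparison grows exponentially; the
  Gaussian decay still kills the boundary terms.\<close>

lemma gauss_stein:
  assumes F: "\<And>x. (F has_real_derivative F' x) (at x)"
    and cont: "\<And>x. isCont F' x"
    and bound: "\<And>x. \<bar>F x\<bar> \<le> K * exp (c * \<bar>x\<bar>)" "\<And>x. \<bar>F' x\<bar> \<le> K * exp (c * \<bar>x\<bar>)"
  shows "(\<integral>x. x * F x \<partial>gauss) = (\<integral>x. F' x \<partial>gauss)"
proof -
  let ?\<phi> = "std_normal_density"
  have "continuous_on UNIV F" "continuous_on UNIV F'"
    using F cont by (auto simp: continuous_on_eq_continuous_at intro: DERIV_isCont)
  then have [measurable]: "F \<in> borel_measurable borel" "F' \<in> borel_measurable borel"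
    by (auto intro: borel_measurable_continuous_onI)
  have "0 \<le> K" using bound(1)[of 0] by simp
  have F'_int: "integrable gauss F'"
    by (rule Bochner_Integration.integrable_bound[OF integrable_mult_right[OF integrable_gauss_exp_abs[of c], of K]])
       (use bound(2) \<open>0 \<le> K\<close> in auto)
  have xF_int: "integrable gauss (\<lambda>x. x * F x)"
  proof (rule Bochner_Integration.integrable_bound[OF integrable_mult_right[OF integrable_gauss_exp_abs[of "c + 1"], of K]])
    have "\<bar>x\<bar> * \<bar>F x\<bar> \<le> exp \<bar>x\<bar> * (K * exp (c * \<bar>x\<bar>))" for x
    proof (intro mult_mono bound)
      show "\<bar>x\<bar> \<le> exp \<bar>x\<bar>" using exp_ge_add_one_self[of "\<bar>x\<bar>"] by linarith
    qed auto
    then show "AE x in gauss. norm (x * F x) \<le> norm (K * exp ((c + 1) * \<bar>x\<bar>))"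
      using \<open>0 \<le> K\<close> by (auto simp: abs_mult exp_add algebra_simps)
  qed measurable
  have int: "integrable lborel (\<lambda>x. ?\<phi> x * F' x)" "integrable lborel (\<lambda>x. ?\<phi> x * (x * F x))"
    using F'_int xF_int integrable_density[of F' lborel ?\<phi>] integrable_density[of "\<lambda>x. x * F x" lborel ?\<phi>]
    unfolding gauss_def by auto
  let ?G = "\<lambda>x. ?\<phi> x * F' x - ?\<phi> x * (x * F x)"
  have D: "((\<lambda>x. ?\<phi> x * F x) has_real_derivative ?G x) (at x)" for x
  proof -
    have "(?\<phi> has_real_derivative - x * ?\<phi> x) (at x)"
      unfolding std_normal_density_def[abs_def] by (rule derivative_eq_intros refl | simp)+
    from DERIV_mult[OF this F] show ?thesis by (simp add: mult_ac)
  qed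
  have lim: "((\<lambda>x. ?\<phi> x * F x) \<longlongrightarrow> 0) A"
    if "((\<lambda>x. K * (?\<phi> x * exp (c * \<bar>x\<bar>))) \<longlongrightarrow> 0) A" for A
  proof (rule Lim_null_comparison[OF _ that], intro always_eventually allI)
    fix x
    have "?\<phi> x * \<bar>F x\<bar> \<le> ?\<phi> x * (K * exp (c * \<bar>x\<bar>))"
      by (intro mult_left_mono bound) auto
    then show "norm (?\<phi> x * F x) \<le> K * (?\<phi> x * exp (c * \<bar>x\<bar>))"
      by (simp add: abs_mult mult_ac)
  qed
  \<comment> \<open>Half of the Gaussian exponent pays for the exponential growth: expand the square
    of \<open>\<bar>x\<bar> / 2 - c\<close>.\<close>
  have decay: "?\<phi> x * exp (c * \<bar>x\<bar>) \<le> exp (c\<^sup>2) * exp (- x\<^sup>2 / 4)" for x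
  proof -
    have "- x\<^sup>2 / 2 + c * \<bar>x\<bar> \<le> c\<^sup>2 + - x\<^sup>2 / 4"
      using zero_le_power2[of "\<bar>x\<bar> / 2 - c"] by (simp add: power2_eq_square field_simps)
    then have "exp (- x\<^sup>2 / 2) * exp (c * \<bar>x\<bar>) \<le> exp (c\<^sup>2) * exp (- x\<^sup>2 / 4)"
      by (simp flip: exp_add)
    moreover have "1 / sqrt (2 * pi) \<le> 1"
      using pi_ge_two by (auto simp: divide_le_eq_1 intro: real_le_rsqrt)
    then have "?\<phi> x \<le> 1 * exp (- x\<^sup>2 / 2)"
      unfolding std_normal_density_def by (intro mult_right_mono) auto
    then have "?\<phi> x * exp (c * \<bar>x\<bar>) \<le> exp (- x\<^sup>2 / 2) * exp (c * \<bar>x\<bar>)"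
      by (intro mult_right_mono) auto
    ultimately show ?thesis by linarith
  qed
  have sq: "((\<lambda>x::real. exp (c\<^sup>2) * exp (- x\<^sup>2 / 4)) \<longlongrightarrow> 0) at_top"
    by (intro tendsto_mult_right_zero) real_asymp
  have top: "((\<lambda>x. ?\<phi> x * exp (c * \<bar>x\<bar>)) \<longlongrightarrow> 0) at_top"
    by (rule Lim_null_comparison[OF _ sq], intro always_eventually allI)
       (use decay in \<open>simp add: abs_mult\<close>)
  have "((\<lambda>x. ?\<phi> x * exp (c * \<bar>x\<bar>)) \<longlongrightarrow> 0) at_bot"
    using top unfolding filterlim_at_bot_mirror by (simp add: std_normal_density_def)
  with top have "((\<lambda>x. ?\<phi> x * F x) \<longlongrightarrow> 0) at_top" "((\<lambda>x. ?\<phi> x * F x) \<longlongrightarrow> 0) at_bot"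
    by (auto intro!: lim tendsto_mult_right_zero)
  then have "(LBINT x=-\<infinity>..\<infinity>. ?G x) = 0 - 0"
  proof (intro interval_integral_FTC_integrable)
    show "((\<lambda>x. ?\<phi> x * F x) has_vector_derivative ?G x) (at x)" for x
      using D by (simp add: has_real_derivative_iff_has_vector_derivative)
    show "isCont ?G x" for x
      unfolding std_normal_density_def[abs_def]
      by (intro continuous_intros cont DERIV_isCont[OF F]) auto
    show "set_integrable lborel (einterval (- \<infinity>) \<infinity>) ?G"
      using int by (simp add: set_integrable_def)
  qed (simp_all add: ereal_tendsto_simps)
  then have "(\<integral>x. ?G x \<partial>lborel) = 0"
    by (simp add: interval_lebesgue_integral_def set_lebesgue_integral_def)
  then have "(\<integral>x. ?\<phi> x * F' x \<partial>lborel) = (\<integral>x. ?\<phi> x * (x * F x) \<partial>lborel)"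
    using int by simp
  then show ?thesis
    unfolding gauss_def by (simp add: integral_density)
qed

subsection \<open>Gaussian interpolation\<close>

abbreviation gauss_vec :: "'i set \<Rightarrow> ('i \<Rightarrow> real) measure"
  where "gauss_vec I \<equiv> Pi\<^sub>M I (\<lambda>_. gauss)"

lemma product_prob_space_gauss: "product_prob_space (\<lambda>_. gauss)"
  using prob_space_gauss by (simp add: product_prob_spaceI)

lemma has_bochner_integral_gauss_vec_prod:
  fixes f :: "'i \<Rightarrow> real \<Rightarrow> real"
  assumes "finite I" "\<And>i. i \<in> I \<Longrightarrow> has_bochner_integral gauss (f i) (y i)"
  shows "has_bochner_integral (gauss_vec I) (\<lambda>\<xi>. \<Prod>i\<in>I. f i (\<xi> i)) (\<Prod>i\<in>I. y i)"
proof -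
  interpret product_prob_space "\<lambda>_::'i. gauss" I by (rule product_prob_space_gauss)
  have "integrable gauss (f i)" "integral\<^sup>L gauss (f i) = y i" if "i \<in> I" for i
    using assms(2)[OF that] by (auto simp: has_bochner_integral_iff)
  then show ?thesis
    using product_integrable_prod[OF assms(1), of f] product_integral_prod[OF assms(1), of f]
    by (simp add: has_bochner_integral_iff)
qed

lemma integrable_gauss_vec_exp_sum:
  assumes "finite I"
  shows "integrable (gauss_vec I) (\<lambda>\<xi>. exp (c * (\<Sum>i\<in>I. \<bar>\<xi> i\<bar>)))"
proof -
  have "has_bochner_integral (gauss_vec I) (\<lambda>\<xi>. \<Prod>i\<in>I. exp (c * \<bar>\<xi> i\<bar>))
      (\<Prod>i\<in>I. integral\<^sup>L gauss (\<lambda>x. exp (c * \<bar>x\<bar>)))"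
    using assms by (rule has_bochner_integral_gauss_vec_prod) (simp add: has_bochner_integral_iff integrable_gauss_exp_abs)
  then show ?thesis
    using assms by (simp add: has_bochner_integral_iff exp_sum sum_distrib_left)
qed

lemma integrable_gauss_vec_exp_growth:
  assumes "finite I" and [measurable]: "f \<in> borel_measurable (gauss_vec I)"
    and "\<And>\<xi>. \<bar>f \<xi>\<bar> \<le> K * exp (c * (\<Sum>i\<in>I. \<bar>\<xi> i\<bar>))"
  shows "integrable (gauss_vec I) f"
proof (rule Bochner_Integration.integrable_bound[OF integrable_mult_right[OF integrable_gauss_vec_exp_sum[OF assms(1), of c], of K]])
  show "AE x in gauss_vec I. norm (f x) \<le> norm (K * exp (c * (\<Sum>i\<in>I. \<bar>x i\<bar>)))"
    using assms(3) by (auto intro: order_trans[OF _ abs_ge_self])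
qed measurable

lemma gauss_vec_stein:
  fixes F F' :: "('i \<Rightarrow> real) \<Rightarrow> real"
  assumes I: "finite I" "i \<in> I"
    and [measurable]: "F \<in> borel_measurable (gauss_vec I)" "F' \<in> borel_measurable (gauss_vec I)"
    and D: "\<And>\<xi> s. ((\<lambda>s. F (\<xi>(i := s))) has_real_derivative F' (\<xi>(i := s))) (at s)"
    and cont: "\<And>\<xi> s. isCont (\<lambda>s. F' (\<xi>(i := s))) s"
    and bound: "\<And>\<xi>. \<bar>F \<xi>\<bar> \<le> K * exp (c * (\<Sum>i\<in>I. \<bar>\<xi> i\<bar>))"
      "\<And>\<xi>. \<bar>F' \<xi>\<bar> \<le> K * exp (c * (\<Sum>i\<in>I. \<bar>\<xi> i\<bar>))"
  shows "integrable (gauss_vec I) (\<lambda>\<xi>. \<xi> i * F \<xi>)"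
    and "(\<integral>\<xi>. \<xi> i * F \<xi> \<partial>gauss_vec I) = (\<integral>\<xi>. F' \<xi> \<partial>gauss_vec I)"
proof -
  interpret product_prob_space "\<lambda>_::'i. gauss" I by (rule product_prob_space_gauss)
  have "0 \<le> K * exp (c * (\<Sum>i\<in>I. \<bar>0\<bar>))"
    using order_trans[OF abs_ge_zero bound(1)[of "\<lambda>_. 0"]] by simp
  then have "0 \<le> K" by simp
  have [measurable]: "(\<lambda>\<xi>. \<xi> i) \<in> borel_measurable (gauss_vec I)"
    using I(2) by measurable
  show int: "integrable (gauss_vec I) (\<lambda>\<xi>. \<xi> i * F \<xi>)"
  proof (rule integrable_gauss_vec_exp_growth[OF I(1)])
    fix \<xi> :: "'i \<Rightarrow> real"
    have "\<bar>\<xi> i\<bar> \<le> (\<Sum>i\<in>I. \<bar>\<xi> i\<bar>)"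
      using I by (intro member_le_sum) auto
    also have "\<dots> \<le> exp (\<Sum>i\<in>I. \<bar>\<xi> i\<bar>)"
      using exp_ge_add_one_self[of "\<Sum>i\<in>I. \<bar>\<xi> i\<bar>"] by linarith
    finally have "\<bar>\<xi> i * F \<xi>\<bar> \<le> exp (\<Sum>i\<in>I. \<bar>\<xi> i\<bar>) * (K * exp (c * (\<Sum>i\<in>I. \<bar>\<xi> i\<bar>)))"
      unfolding abs_mult by (intro mult_mono bound) auto
    then show "\<bar>\<xi> i * F \<xi>\<bar> \<le> K * exp ((c + 1) * (\<Sum>i\<in>I. \<bar>\<xi> i\<bar>))"
      by (simp add: exp_add distrib_right mult_ac)
  qed measurable
  have int': "integrable (gauss_vec I) F'"
    by (rule integrable_gauss_vec_exp_growth[OF I(1)]) (use bound in auto)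
  have ins: "insert i (I - {i}) = I" using I by auto
  note fold = product_integral_insert[of "I - {i}" i, unfolded ins]
  have inner: "(\<integral>s. s * F (\<xi>(i := s)) \<partial>gauss) = (\<integral>s. F' (\<xi>(i := s)) \<partial>gauss)" for \<xi>
  proof (rule gauss_stein[OF D cont])
    let ?S = "\<Sum>j\<in>I - {i}. \<bar>\<xi> j\<bar>"
    have S: "(\<Sum>j\<in>I. \<bar>(\<xi>(i := s)) j\<bar>) = \<bar>s\<bar> + ?S" for s
    proof -
      have "(\<Sum>j\<in>I. \<bar>(\<xi>(i := s)) j\<bar>) = \<bar>(\<xi>(i := s)) i\<bar> + (\<Sum>j\<in>I - {i}. \<bar>(\<xi>(i := s)) j\<bar>)"
        using I by (rule sum.remove)
      also have "(\<Sum>j\<in>I - {i}. \<bar>(\<xi>(i := s)) j\<bar>) = ?S"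
        by (intro sum.cong) auto
      finally show ?thesis by simp
    qed
    show "\<bar>F (\<xi>(i := s))\<bar> \<le> K * exp (c * ?S) * exp (c * \<bar>s\<bar>)"
      "\<bar>F' (\<xi>(i := s))\<bar> \<le> K * exp (c * ?S) * exp (c * \<bar>s\<bar>)" for s
      using bound[of "\<xi>(i := s)"] unfolding S by (simp_all add: exp_add distrib_left mult_ac)
  qed
  show "(\<integral>\<xi>. \<xi> i * F \<xi> \<partial>gauss_vec I) = (\<integral>\<xi>. F' \<xi> \<partial>gauss_vec I)"
    using fold[OF _ _ int] fold[OF _ _ int'] I inner by simp
qed

text \<open>Along the rotation \<open>cos t * X + sin t * Y\<close>, for t from 0 to
  \<open>pi / 2\<close>, Stein's identity turns the derivative of the expectation of \<Phi> into
  \<open>- (sin t * cos t)\<close> times the expectation of the sum in \<open>sign\<close>, hence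
  into something nonnegative. One Gaussian vector drives both processes, and \<open>orth\<close>
  makes them uncorrelated. The chain rules are required along arbitrary curves because they serve
  both the rotation in t and the variation of a single coordinate in Stein's identity.\<close>

lemma gauss_interpolation:
  fixes X Y :: "'j \<Rightarrow> 'i \<Rightarrow> real" and \<Phi> :: "('j \<Rightarrow> real) \<Rightarrow> real"
  assumes fin: "finite I" "finite J"
    and meas [measurable]: "\<Phi> \<in> borel_measurable (Pi\<^sub>M UNIV (\<lambda>_. borel))"
      "\<And>a. \<Phi>\<^sub>1 a \<in> borel_measurable (Pi\<^sub>M UNIV (\<lambda>_. borel))"
      "\<And>a b. \<Phi>\<^sub>2 a b \<in> borel_measurable (Pi\<^sub>M UNIV (\<lambda>_. borel))"
    and D1: "\<And>u u' t. (\<And>a. a \<in> J \<Longrightarrow> (u a has_real_derivative u' a) (at t)) \<Longrightarrow>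
      ((\<lambda>t. \<Phi> (\<lambda>a. u a t)) has_real_derivative (\<Sum>a\<in>J. \<Phi>\<^sub>1 a (\<lambda>a. u a t) * u' a)) (at t)"
    and D2: "\<And>a u u' t. a \<in> J \<Longrightarrow> (\<And>a. a \<in> J \<Longrightarrow> (u a has_real_derivative u' a) (at t)) \<Longrightarrow>
      ((\<lambda>t. \<Phi>\<^sub>1 a (\<lambda>a. u a t)) has_real_derivative (\<Sum>b\<in>J. \<Phi>\<^sub>2 a b (\<lambda>a. u a t) * u' b)) (at t)"
    and C2: "\<And>a b u (t::real). a \<in> J \<Longrightarrow> b \<in> J \<Longrightarrow> (\<And>a. a \<in> J \<Longrightarrow> isCont (u a) t) \<Longrightarrow> isCont (\<lambda>t. \<Phi>\<^sub>2 a b (\<lambda>a. u a t)) t"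
    and c: "0 \<le> c"
    and bound0: "\<And>u. \<bar>\<Phi> u\<bar> \<le> K * exp (c * (\<Sum>a\<in>J. \<bar>u a\<bar>))"
    and bound1: "\<And>a u. a \<in> J \<Longrightarrow> \<bar>\<Phi>\<^sub>1 a u\<bar> \<le> K * exp (c * (\<Sum>a\<in>J. \<bar>u a\<bar>))"
    and bound2: "\<And>a b u. a \<in> J \<Longrightarrow> b \<in> J \<Longrightarrow> \<bar>\<Phi>\<^sub>2 a b u\<bar> \<le> K * exp (c * (\<Sum>a\<in>J. \<bar>u a\<bar>))"
    and orth: "\<And>a b. a \<in> J \<Longrightarrow> b \<in> J \<Longrightarrow> (\<Sum>i\<in>I. X a i * Y b i) = 0"
    and sign: "\<And>u. (\<Sum>a\<in>J. \<Sum>b\<in>J. ((\<Sum>i\<in>I. X a i * X b i) - (\<Sum>i\<in>I. Y a i * Y b i)) * \<Phi>\<^sub>2 a b u) \<le> 0"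
  shows "integrable (gauss_vec I) (\<lambda>\<xi>. \<Phi> (\<lambda>a. \<Sum>i\<in>I. X a i * \<xi> i))"
    and "(\<integral>\<xi>. \<Phi> (\<lambda>a. \<Sum>i\<in>I. X a i * \<xi> i) \<partial>gauss_vec I) \<le> (\<integral>\<xi>. \<Phi> (\<lambda>a. \<Sum>i\<in>I. Y a i * \<xi> i) \<partial>gauss_vec I)"
proof -
  interpret product_prob_space "\<lambda>_::'i. gauss" I by (rule product_prob_space_gauss)
  interpret G: prob_space "gauss_vec I"
    by (intro prob_space_PiM prob_space_gauss)
  interpret P: pair_sigma_finite lborel "gauss_vec I" ..
  \<comment> \<open>\<open>L\<close> holds the rotated coefficients, \<open>L'\<close> their
    derivative in t; likewise \<open>Z\<close> is the interpolating process and \<open>Z'\<close>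
    its velocity.\<close>
  define L where "L t a i = cos t * X a i + sin t * Y a i" for t a i
  define L' where "L' t a i = cos t * Y a i - sin t * X a i" for t a i
  define Z where "Z t \<xi> a = (\<Sum>i\<in>I. L t a i * \<xi> i)" for t \<xi> a
  define Z' where "Z' t \<xi> a = (\<Sum>i\<in>I. L' t a i * \<xi> i)" for t \<xi> a
  define B where "B = (\<Sum>a\<in>J. \<Sum>i\<in>I. \<bar>X a i\<bar> + \<bar>Y a i\<bar>)"
  define S where "S \<xi> = (\<Sum>i\<in>I. \<bar>\<xi> i\<bar>)" for \<xi> :: "'i \<Rightarrow> real"
  define D where "D t \<xi> = (\<Sum>a\<in>J. \<Phi>\<^sub>1 a (Z t \<xi>) * Z' t \<xi> a)" for t \<xi>
  have B: "0 \<le> B" by (simp add: B_def sum_nonneg)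
  have S0: "0 \<le> S \<xi>" for \<xi> by (simp add: S_def sum_nonneg)
  have K: "0 \<le> K"
    using order_trans[OF abs_ge_zero bound0[of "\<lambda>_. 0"]] by simp
  have trig: "\<bar>cos t * x + sin t * y\<bar> \<le> \<bar>x\<bar> + \<bar>y\<bar>" "\<bar>cos t * y - sin t * x\<bar> \<le> \<bar>x\<bar> + \<bar>y\<bar>" for t x y :: real
  proof -
    have "\<bar>cos t * z\<bar> \<le> \<bar>z\<bar>" "\<bar>sin t * z\<bar> \<le> \<bar>z\<bar>" for z
      by (simp_all add: abs_mult mult_left_le_one_le)
    from this[of x] this[of y] show "\<bar>cos t * x + sin t * y\<bar> \<le> \<bar>x\<bar> + \<bar>y\<bar>" "\<bar>cos t * y - sin t * x\<bar> \<le> \<bar>x\<bar> + \<bar>y\<bar>"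
      by linarith+
  qed
  have lin_le: "(\<Sum>a\<in>J. \<bar>\<Sum>i\<in>I. R a i * \<xi> i\<bar>) \<le> B * S \<xi>"
    if R: "\<And>a i. \<bar>R a i\<bar> \<le> \<bar>X a i\<bar> + \<bar>Y a i\<bar>" for R :: "'j \<Rightarrow> 'i \<Rightarrow> real" and \<xi>
  proof -
    have "(\<Sum>a\<in>J. \<bar>\<Sum>i\<in>I. R a i * \<xi> i\<bar>) \<le> (\<Sum>a\<in>J. \<Sum>i\<in>I. (\<bar>X a i\<bar> + \<bar>Y a i\<bar>) * S \<xi>)"
    proof (rule sum_mono)
      fix a assume "a \<in> J"
      have "\<bar>\<Sum>i\<in>I. R a i * \<xi> i\<bar> \<le> (\<Sum>i\<in>I. \<bar>R a i * \<xi> i\<bar>)" by (rule sum_abs)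
      also have "\<dots> \<le> (\<Sum>i\<in>I. (\<bar>X a i\<bar> + \<bar>Y a i\<bar>) * S \<xi>)"
      proof (rule sum_mono)
        fix i assume "i \<in> I"
        then have "\<bar>\<xi> i\<bar> \<le> S \<xi>" unfolding S_def using fin by (intro member_le_sum) auto
        with R[of a i] show "\<bar>R a i * \<xi> i\<bar> \<le> (\<bar>X a i\<bar> + \<bar>Y a i\<bar>) * S \<xi>"
          unfolding abs_mult by (intro mult_mono) auto
      qed
      finally show "\<bar>\<Sum>i\<in>I. R a i * \<xi> i\<bar> \<le> (\<Sum>i\<in>I. (\<bar>X a i\<bar> + \<bar>Y a i\<bar>) * S \<xi>)" .
    qed
    then show ?thesis by (simp add: B_def sum_distrib_right)
  qed
  have Z_le: "(\<Sum>a\<in>J. \<bar>Z t \<xi> a\<bar>) \<le> B * S \<xi>" for t \<xi>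
    unfolding Z_def L_def by (intro lin_le trig)
  have Z'_le: "(\<Sum>a\<in>J. \<bar>Z' t \<xi> a\<bar>) \<le> B * S \<xi>" for t \<xi>
    unfolding Z'_def L'_def by (intro lin_le trig)
  have growth: "K * exp (c * (\<Sum>a\<in>J. \<bar>Z t \<xi> a\<bar>)) \<le> K * exp (c * B * S \<xi>)" for t \<xi>
    using mult_left_mono[OF Z_le[of t \<xi>] c] K by (intro mult_left_mono) (auto simp: mult.assoc)
  note \<Phi>_le = order_trans[OF bound0 growth]
  note \<Phi>1_le = order_trans[OF bound1 growth]
  note \<Phi>2_le = order_trans[OF bound2 growth]
  have [measurable]: "(\<lambda>(t, \<xi>). Z t \<xi>) \<in> (lborel \<Otimes>\<^sub>M gauss_vec I) \<rightarrow>\<^sub>M Pi\<^sub>M UNIV (\<lambda>_. borel)"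
    unfolding Z_def[abs_def] L_def
    by (rule measurable_PiM_single') (auto simp: case_prod_beta')
  have [measurable]: "(\<lambda>(t, \<xi>). Z' t \<xi> a) \<in> borel_measurable (lborel \<Otimes>\<^sub>M gauss_vec I)" for a
    unfolding Z'_def[abs_def] L'_def by measurable
  have [measurable]: "Z t \<in> gauss_vec I \<rightarrow>\<^sub>M Pi\<^sub>M UNIV (\<lambda>_. borel)" for t
    unfolding Z_def[abs_def] by (rule measurable_PiM_single') auto
  have Dm [measurable]: "(\<lambda>(t, \<xi>). D t \<xi>) \<in> borel_measurable (lborel \<Otimes>\<^sub>M gauss_vec I)"
    unfolding D_def case_prod_beta'
    by measurable
  define C where "C = K * B"
  have D_le: "\<bar>D t \<xi>\<bar> \<le> C * exp ((c * B + 1) * S \<xi>)" for t \<xi>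
  proof -
    have "\<bar>D t \<xi>\<bar> \<le> (\<Sum>a\<in>J. \<bar>\<Phi>\<^sub>1 a (Z t \<xi>) * Z' t \<xi> a\<bar>)" unfolding D_def by (rule sum_abs)
    also have "\<dots> \<le> (\<Sum>a\<in>J. K * exp (c * B * S \<xi>) * \<bar>Z' t \<xi> a\<bar>)"
      unfolding abs_mult by (intro sum_mono mult_right_mono \<Phi>1_le) auto
    also have "\<dots> = K * exp (c * B * S \<xi>) * (\<Sum>a\<in>J. \<bar>Z' t \<xi> a\<bar>)" by (simp add: sum_distrib_left)
    also have "\<dots> \<le> K * exp (c * B * S \<xi>) * (B * exp (S \<xi>))"
    proof (intro mult_left_mono order_trans[OF Z'_le])
      show "S \<xi> \<le> exp (S \<xi>)" using exp_ge_add_one_self[of "S \<xi>"] by linarith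
    qed (use K B in auto)
    also have "\<dots> = C * (exp (c * B * S \<xi>) * exp (S \<xi>))"
      by (simp only: C_def mult_ac)
    also have "\<dots> = C * exp ((c * B + 1) * S \<xi>)"
      by (simp add: distrib_right flip: exp_add)
    finally show ?thesis .
  qed
  have int_bound: "integrable (gauss_vec I) (\<lambda>\<xi>. C * exp ((c * B + 1) * S \<xi>))"
    unfolding S_def by (intro integrable_mult_right integrable_gauss_vec_exp_sum fin)
  \<comment> \<open>Writing the time integral over the whole line with an indicator puts both
    integrations on one product measure, ready for Fubini.\<close>
  let ?T = "indicator {0..pi / 2} :: real \<Rightarrow> real"
  have int_pair: "integrable (lborel \<Otimes>\<^sub>M gauss_vec I) (\<lambda>(t, \<xi>). ?T t * D t \<xi>)"
  proof (rule Bochner_Integration.integrable_bound)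
    show "integrable (lborel \<Otimes>\<^sub>M gauss_vec I) (\<lambda>(t, \<xi>). ?T t * (C * exp ((c * B + 1) * S \<xi>)))"
    proof (rule P.Fubini_integrable)
      show "(\<lambda>(t, \<xi>). ?T t * (C * exp ((c * B + 1) * S \<xi>))) \<in> borel_measurable (lborel \<Otimes>\<^sub>M gauss_vec I)"
        unfolding S_def by measurable
      have eq: "(\<integral>\<xi>. norm (case (t, \<xi>) of (t, \<xi>) \<Rightarrow> ?T t * (C * exp ((c * B + 1) * S \<xi>))) \<partial>gauss_vec I) =
          ?T t * (\<integral>\<xi>. C * exp ((c * B + 1) * S \<xi>) \<partial>gauss_vec I)" for t
        using K B by (simp add: abs_mult C_def)
      have "integrable lborel (\<lambda>t. ?T t * (\<integral>\<xi>. C * exp ((c * B + 1) * S \<xi>) \<partial>gauss_vec I))"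
        by (intro integrable_mult_left) auto
      then show "integrable lborel (\<lambda>t. \<integral>\<xi>. norm (case (t, \<xi>) of (t, \<xi>) \<Rightarrow> ?T t * (C * exp ((c * B + 1) * S \<xi>))) \<partial>gauss_vec I)"
        unfolding eq .
      show "AE t in lborel. integrable (gauss_vec I) (\<lambda>\<xi>. case (t, \<xi>) of (t, \<xi>) \<Rightarrow> ?T t * (C * exp ((c * B + 1) * S \<xi>)))"
        using int_bound by auto
    qed
    show "AE x in lborel \<Otimes>\<^sub>M gauss_vec I. norm (case x of (t, \<xi>) \<Rightarrow> ?T t * D t \<xi>)
        \<le> norm (case x of (t, \<xi>) \<Rightarrow> ?T t * (C * exp ((c * B + 1) * S \<xi>)))"
    proof (rule AE_I2)
      fix x :: "real \<times> ('i \<Rightarrow> real)"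
      obtain t \<xi> where x: "x = (t, \<xi>)" by (cases x)
      show "norm (case x of (t, \<xi>) \<Rightarrow> ?T t * D t \<xi>)
          \<le> norm (case x of (t, \<xi>) \<Rightarrow> ?T t * (C * exp ((c * B + 1) * S \<xi>)))"
        using order_trans[OF D_le[of t \<xi>] abs_ge_self] unfolding x by (auto simp: indicator_def)
    qed
  qed measurable
  have ftc: "(\<integral>t. ?T t * D t \<xi> \<partial>lborel) = \<Phi> (Z (pi / 2) \<xi>) - \<Phi> (Z 0 \<xi>)" for \<xi>
  proof -
    have DZ: "((\<lambda>t. Z t \<xi> a) has_real_derivative Z' t \<xi> a) (at t)" for t a
      unfolding Z_def Z'_def L_def L'_def
      by (auto intro!: derivative_eq_intros sum.cong simp: algebra_simps)
    have D\<Phi>: "((\<lambda>t. \<Phi> (Z t \<xi>)) has_real_derivative D t \<xi>) (at t)" for t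
      unfolding D_def using D1[of "\<lambda>a t. Z t \<xi> a" "Z' t \<xi>" t] DZ by simp
    have "isCont (\<lambda>t. D t \<xi>) t" for t
      unfolding D_def
    proof (intro continuous_intros)
      fix a assume "a \<in> J"
      then show "isCont (\<lambda>t. \<Phi>\<^sub>1 a (Z t \<xi>)) t"
        using D2[of a "\<lambda>a t. Z t \<xi> a" "Z' t \<xi>" t] DZ by (auto intro: DERIV_isCont)
      show "isCont (\<lambda>t. Z' t \<xi> a) t"
        unfolding Z'_def L'_def by (intro continuous_intros)
    qed
    then have "(\<integral>t. ?T t *\<^sub>R D t \<xi> \<partial>lborel) = \<Phi> (Z (pi / 2) \<xi>) - \<Phi> (Z 0 \<xi>)"
    proof (intro integral_FTC_atLeastAtMost continuous_at_imp_continuous_on)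
      show "((\<lambda>t. \<Phi> (Z t \<xi>)) has_vector_derivative D t \<xi>) (at t within {0..pi / 2})" for t
        using has_field_derivative_at_within[OF D\<Phi>] by (simp add: has_real_derivative_iff_has_vector_derivative)
    qed auto
    then show ?thesis by simp
  qed
  have nonneg: "0 \<le> (\<integral>\<xi>. D t \<xi> \<partial>gauss_vec I)" if t: "0 \<le> t" "t \<le> pi / 2" for t
  proof -
    let ?V = "\<lambda>a b. \<integral>\<xi>. \<Phi>\<^sub>2 a b (Z t \<xi>) \<partial>gauss_vec I"
    have V_int: "integrable (gauss_vec I) (\<lambda>\<xi>. \<Phi>\<^sub>2 a b (Z t \<xi>))" if "a \<in> J" "b \<in> J" for a b
      using \<Phi>2_le[OF that] unfolding S_def by (intro integrable_gauss_vec_exp_growth[OF fin(1)]) auto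
    have upd: "((\<lambda>s. Z t (\<xi>(i := s)) a) has_real_derivative L t a i) (at s)" if "i \<in> I" for \<xi> i a s
    proof -
      have "Z t (\<xi>(i := s)) a = L t a i * s + (\<Sum>j\<in>I - {i}. L t a j * \<xi> j)" for s
      proof -
        have "Z t (\<xi>(i := s)) a = L t a i * s + (\<Sum>j\<in>I - {i}. L t a j * (\<xi>(i := s)) j)"
          unfolding Z_def using sum.remove[OF fin(1) that, of "\<lambda>j. L t a j * (\<xi>(i := s)) j"] by simp
        also have "(\<Sum>j\<in>I - {i}. L t a j * (\<xi>(i := s)) j) = (\<Sum>j\<in>I - {i}. L t a j * \<xi> j)"
          by (intro sum.cong) auto
        finally show ?thesis .
      qed
      then show ?thesis by (auto intro!: derivative_eq_intros)
    qed
    \<comment> \<open>One constant for both growth bounds of Stein's identity: K serves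
      \<open>\<Phi>\<^sub>1\<close>, and \<open>K * B\<close> serves its derivative in direction
      i.\<close>
    define K2 where "K2 = K * (1 + B)"
    have st: "integrable (gauss_vec I) (\<lambda>\<xi>. \<xi> i * \<Phi>\<^sub>1 a (Z t \<xi>))"
      "(\<integral>\<xi>. \<xi> i * \<Phi>\<^sub>1 a (Z t \<xi>) \<partial>gauss_vec I) = (\<Sum>b\<in>J. L t b i * ?V a b)"
      if "a \<in> J" "i \<in> I" for a i
    proof -
      let ?F' = "\<lambda>\<xi>. \<Sum>b\<in>J. \<Phi>\<^sub>2 a b (Z t \<xi>) * L t b i"
      have 1: "((\<lambda>s. \<Phi>\<^sub>1 a (Z t (\<xi>(i := s)))) has_real_derivative ?F' (\<xi>(i := s))) (at s)" for \<xi> s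
        using D2[of a "\<lambda>b s. Z t (\<xi>(i := s)) b" "\<lambda>b. L t b i" s] upd that by simp
      have 2: "isCont (\<lambda>s. ?F' (\<xi>(i := s))) s" for \<xi> s
      proof (intro continuous_intros)
        fix b assume "b \<in> J"
        then show "isCont (\<lambda>s. \<Phi>\<^sub>2 a b (Z t (\<xi>(i := s)))) s"
          using that(1)
          by (intro C2[where u = "\<lambda>b s. Z t (\<xi>(i := s)) b"] DERIV_isCont[OF upd[OF that(2)]])
      qed
      have 3: "\<bar>\<Phi>\<^sub>1 a (Z t \<xi>)\<bar> \<le> K2 * exp (c * B * (\<Sum>i\<in>I. \<bar>\<xi> i\<bar>))" for \<xi>
      proof (rule order_trans[OF \<Phi>1_le[OF that(1)]])
        show "K * exp (c * B * S \<xi>) \<le> K2 * exp (c * B * (\<Sum>i\<in>I. \<bar>\<xi> i\<bar>))"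
          using K B by (intro mult_mono) (auto simp: K2_def S_def algebra_simps)
      qed
      have 4: "\<bar>?F' \<xi>\<bar> \<le> K2 * exp (c * B * (\<Sum>i\<in>I. \<bar>\<xi> i\<bar>))" for \<xi>
      proof -
        have "\<bar>?F' \<xi>\<bar> \<le> (\<Sum>b\<in>J. \<bar>\<Phi>\<^sub>2 a b (Z t \<xi>) * L t b i\<bar>)" by (rule sum_abs)
        also have "\<dots> \<le> (\<Sum>b\<in>J. K * exp (c * B * S \<xi>) * (\<Sum>i\<in>I. \<bar>X b i\<bar> + \<bar>Y b i\<bar>))"
        proof (intro sum_mono)
          fix b assume "b \<in> J"
          have "\<bar>L t b i\<bar> \<le> \<bar>X b i\<bar> + \<bar>Y b i\<bar>" unfolding L_def by (rule trig)
          also have "\<dots> \<le> (\<Sum>i\<in>I. \<bar>X b i\<bar> + \<bar>Y b i\<bar>)"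
            using that fin by (intro member_le_sum) auto
          finally show "\<bar>\<Phi>\<^sub>2 a b (Z t \<xi>) * L t b i\<bar> \<le> K * exp (c * B * S \<xi>) * (\<Sum>i\<in>I. \<bar>X b i\<bar> + \<bar>Y b i\<bar>)"
            unfolding abs_mult using K \<open>b \<in> J\<close> that by (intro mult_mono \<Phi>2_le) auto
        qed
        also have "\<dots> = K * exp (c * B * S \<xi>) * B" by (simp add: B_def sum_distrib_left)
        also have "\<dots> \<le> K2 * exp (c * B * (\<Sum>i\<in>I. \<bar>\<xi> i\<bar>))"
          using K by (simp add: K2_def S_def algebra_simps)
        finally show ?thesis .
      qed
      show "integrable (gauss_vec I) (\<lambda>\<xi>. \<xi> i * \<Phi>\<^sub>1 a (Z t \<xi>))"
        using fin(1) that(2) _ _ 1 2 3 4 by (rule gauss_vec_stein(1)) measurable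
      have "(\<integral>\<xi>. \<xi> i * \<Phi>\<^sub>1 a (Z t \<xi>) \<partial>gauss_vec I) = (\<integral>\<xi>. ?F' \<xi> \<partial>gauss_vec I)"
        using fin(1) that(2) _ _ 1 2 3 4 by (rule gauss_vec_stein(2)) measurable
      also have "\<dots> = (\<Sum>b\<in>J. L t b i * ?V a b)"
        using V_int that by (simp add: mult.commute)
      finally show "(\<integral>\<xi>. \<xi> i * \<Phi>\<^sub>1 a (Z t \<xi>) \<partial>gauss_vec I) = (\<Sum>b\<in>J. L t b i * ?V a b)" .
    qed
    let ?W = "\<lambda>a b. (\<Sum>i\<in>I. X a i * X b i) - (\<Sum>i\<in>I. Y a i * Y b i)"
    \<comment> \<open>The terms with squared cosine and squared sine are mixed sums of X and Y and
      vanish by \<open>orth\<close>; what remains carries \<open>sin t * cos t\<close>, which is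
      nonnegative on the quarter turn.\<close>
    have W: "(\<Sum>i\<in>I. L' t a i * L t b i) = - (sin t * cos t) * ?W a b" if "a \<in> J" "b \<in> J" for a b
    proof -
      have "(\<Sum>i\<in>I. L' t a i * L t b i) =
        (\<Sum>i\<in>I. sin t * cos t * (Y a i * Y b i) - sin t * cos t * (X a i * X b i)
          + (cos t)\<^sup>2 * (X b i * Y a i) - (sin t)\<^sup>2 * (X a i * Y b i))"
        unfolding L_def L'_def by (intro sum.cong) (auto simp: algebra_simps power2_eq_square)
      also have "\<dots> = sin t * cos t * (\<Sum>i\<in>I. Y a i * Y b i) - sin t * cos t * (\<Sum>i\<in>I. X a i * X b i)
          + (cos t)\<^sup>2 * (\<Sum>i\<in>I. X b i * Y a i) - (sin t)\<^sup>2 * (\<Sum>i\<in>I. X a i * Y b i)"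
        by (simp add: sum.distrib sum_subtractf sum_distrib_left)
      finally show ?thesis using orth that by (simp add: algebra_simps)
    qed
    have "(\<integral>\<xi>. D t \<xi> \<partial>gauss_vec I) = (\<integral>\<xi>. (\<Sum>a\<in>J. \<Sum>i\<in>I. L' t a i * (\<xi> i * \<Phi>\<^sub>1 a (Z t \<xi>))) \<partial>gauss_vec I)"
      unfolding D_def Z'_def by (simp add: sum_distrib_left mult_ac)
    also have "\<dots> = (\<Sum>a\<in>J. \<Sum>i\<in>I. L' t a i * (\<Sum>b\<in>J. L t b i * ?V a b))"
      using st by (simp add: Bochner_Integration.integral_sum)
    also have "\<dots> = (\<Sum>a\<in>J. \<Sum>b\<in>J. (\<Sum>i\<in>I. L' t a i * L t b i) * ?V a b)"
    proof (rule sum.cong[OF refl])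
      fix a
      have "(\<Sum>i\<in>I. L' t a i * (\<Sum>b\<in>J. L t b i * ?V a b)) = (\<Sum>i\<in>I. \<Sum>b\<in>J. L' t a i * L t b i * ?V a b)"
        by (simp add: sum_distrib_left mult.assoc)
      also have "\<dots> = (\<Sum>b\<in>J. \<Sum>i\<in>I. L' t a i * L t b i * ?V a b)" by (rule sum.swap)
      finally show "(\<Sum>i\<in>I. L' t a i * (\<Sum>b\<in>J. L t b i * ?V a b)) = (\<Sum>b\<in>J. (\<Sum>i\<in>I. L' t a i * L t b i) * ?V a b)"
        by (simp add: sum_distrib_right)
    qed
    also have "\<dots> = (\<Sum>a\<in>J. \<Sum>b\<in>J. - (sin t * cos t) * (?W a b * ?V a b))"
      by (intro sum.cong refl) (simp add: W)
    also have "\<dots> = - (sin t * cos t) * (\<Sum>a\<in>J. \<Sum>b\<in>J. ?W a b * ?V a b)"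
      by (simp add: sum_distrib_left)
    also have "(\<Sum>a\<in>J. \<Sum>b\<in>J. ?W a b * ?V a b) = (\<integral>\<xi>. (\<Sum>a\<in>J. \<Sum>b\<in>J. ?W a b * \<Phi>\<^sub>2 a b (Z t \<xi>)) \<partial>gauss_vec I)"
      using V_int by (simp add: Bochner_Integration.integral_sum)
    finally have eq: "(\<integral>\<xi>. D t \<xi> \<partial>gauss_vec I) = - (sin t * cos t) * (\<integral>\<xi>. (\<Sum>a\<in>J. \<Sum>b\<in>J. ?W a b * \<Phi>\<^sub>2 a b (Z t \<xi>)) \<partial>gauss_vec I)" .
    have "0 \<le> sin t * cos t"
      using t by (intro mult_nonneg_nonneg sin_ge_zero cos_ge_zero) auto
    moreover have "0 \<le> (\<integral>\<xi>. - (\<Sum>a\<in>J. \<Sum>b\<in>J. ?W a b * \<Phi>\<^sub>2 a b (Z t \<xi>)) \<partial>gauss_vec I)"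
      by (rule integral_nonneg_AE) (use sign in auto)
    then have "(\<integral>\<xi>. (\<Sum>a\<in>J. \<Sum>b\<in>J. ?W a b * \<Phi>\<^sub>2 a b (Z t \<xi>)) \<partial>gauss_vec I) \<le> 0"
      by (simp only: Bochner_Integration.integral_minus neg_0_le_iff_le)
    ultimately show ?thesis
      unfolding eq by (simp add: mult_nonneg_nonpos)
  qed
  have \<Phi>_int: "integrable (gauss_vec I) (\<lambda>\<xi>. \<Phi> (Z t \<xi>))" for t
    using \<Phi>_le unfolding S_def by (intro integrable_gauss_vec_exp_growth[OF fin(1)]) auto
  show "integrable (gauss_vec I) (\<lambda>\<xi>. \<Phi> (\<lambda>a. \<Sum>i\<in>I. X a i * \<xi> i))"
    using \<Phi>_int[of 0] by (simp add: Z_def[abs_def] L_def)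
  have "0 \<le> (\<integral>t. ?T t * (\<integral>\<xi>. D t \<xi> \<partial>gauss_vec I) \<partial>lborel)"
    by (rule integral_nonneg_AE) (use nonneg in \<open>auto simp: indicator_def\<close>)
  also have "\<dots> = (\<integral>t. (\<integral>\<xi>. ?T t * D t \<xi> \<partial>gauss_vec I) \<partial>lborel)"
    by simp
  also have "\<dots> = (\<integral>\<xi>. (\<integral>t. ?T t * D t \<xi> \<partial>lborel) \<partial>gauss_vec I)"
    by (rule P.Fubini_integral[OF int_pair, symmetric])
  also have "\<dots> = (\<integral>\<xi>. \<Phi> (Z (pi / 2) \<xi>) - \<Phi> (Z 0 \<xi>) \<partial>gauss_vec I)"
    by (simp add: ftc)
  also have "\<dots> = (\<integral>\<xi>. \<Phi> (Z (pi / 2) \<xi>) \<partial>gauss_vec I) - (\<integral>\<xi>. \<Phi> (Z 0 \<xi>) \<partial>gauss_vec I)"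
    by (rule Bochner_Integration.integral_diff[OF \<Phi>_int \<Phi>_int])
  finally show "(\<integral>\<xi>. \<Phi> (\<lambda>a. \<Sum>i\<in>I. X a i * \<xi> i) \<partial>gauss_vec I) \<le> (\<integral>\<xi>. \<Phi> (\<lambda>a. \<Sum>i\<in>I. Y a i * \<xi> i) \<partial>gauss_vec I)"
    by (simp add: Z_def[abs_def] L_def)
qed

subsection \<open>Gordon's comparison\<close>

lemma sum_mult_le_1:
  fixes f g :: "'a \<Rightarrow> real"
  assumes "(\<Sum>i\<in>A. (f i)\<^sup>2) \<le> 1" "(\<Sum>i\<in>A. (g i)\<^sup>2) \<le> 1"
  shows "(\<Sum>i\<in>A. f i * g i) \<le> 1"
proof -
  have "f i * g i \<le> ((f i)\<^sup>2 + (g i)\<^sup>2) / 2" for i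
    using zero_le_power2[of "f i - g i"] by (simp add: power2_eq_square algebra_simps)
  then have "(\<Sum>i\<in>A. f i * g i) \<le> (\<Sum>i\<in>A. ((f i)\<^sup>2 + (g i)\<^sup>2) / 2)"
    by (rule sum_mono)
  also have "\<dots> = ((\<Sum>i\<in>A. (f i)\<^sup>2) + (\<Sum>i\<in>A. (g i)\<^sup>2)) / 2"
    by (simp add: sum.distrib add_divide_distrib sum_divide_distrib)
  finally show ?thesis using assms by simp
qed

text \<open>The Gaussian vector is arranged as an \<open>(m + 1) \<times> (n + 1)\<close> matrix: the block \<open>i < m\<close>, \<open>j < n\<close> is the
  matrix \<open>A\<close>, its last column and its last row are the vectors \<open>g\<close> and \<open>h\<close> of the comparison process, and the corner
  is \<open>g\<^sub>0\<close>. An argument \<open>u\<close> of the functional \<open>\<Phi>\<close> has, for each direction \<open>k\<close>, the coordinates of \<open>A w\<^sub>k\<close> (or \<open>g\<close>) at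
  \<open>a < m\<close> and of \<open>g\<^sub>0\<close> (or \<open>h \<cdot> w\<^sub>k\<close>) at \<open>a = m\<close>. The covariances of the two processes agree for \<open>k = l\<close>; for
  \<open>k \<noteq> l\<close> the mixed second derivatives of \<open>\<Phi>\<close> carry the sign of \<open>q - 1\<close>, so \<open>q \<le> 1\<close> decides the
  comparison, and \<open>\<epsilon>\<close> only serves to smooth the norm.\<close>

locale gordon =
  fixes m n N :: nat and w :: "nat \<Rightarrow> nat \<Rightarrow> real" and M q \<epsilon> :: real
  assumes unit: "k < N \<Longrightarrow> (\<Sum>j<n. (w k j)\<^sup>2) = 1"
    and N: "0 < N" and M: "0 < M" and q: "0 < q" "q \<le> 1" and \<epsilon>: "0 < \<epsilon>"
begin

definition \<rho> :: "nat \<Rightarrow> (nat \<times> nat \<Rightarrow> real) \<Rightarrow> real"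
  where "\<rho> k u = sqrt (\<epsilon>\<^sup>2 + (\<Sum>a<m. (u (k, a))\<^sup>2))"

definition E :: "nat \<Rightarrow> (nat \<times> nat \<Rightarrow> real) \<Rightarrow> real"
  where "E k u = exp (- M * (\<rho> k u + u (k, m)))"

definition Q :: "(nat \<times> nat \<Rightarrow> real) \<Rightarrow> real"
  where "Q u = (\<Sum>k<N. E k u)"

definition \<Phi> :: "(nat \<times> nat \<Rightarrow> real) \<Rightarrow> real"
  where "\<Phi> u = Q u powr q"

text \<open>\<open>d k\<close> is the gradient of the exponent \<open>\<rho> k u + u (k, m)\<close>
  in the coordinates \<open>(k, a)\<close> with a at most m, and \<open>d'\<close> is its Hessian;
  the value 1 comes from the linear coordinate \<open>a = m\<close>.\<close>

definition d :: "nat \<Rightarrow> nat \<Rightarrow> (nat \<times> nat \<Rightarrow> real) \<Rightarrow> real"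
  where "d k a u = (if a < m then u (k, a) / \<rho> k u else 1)"

definition d' :: "nat \<Rightarrow> nat \<Rightarrow> nat \<Rightarrow> (nat \<times> nat \<Rightarrow> real) \<Rightarrow> real"
  where "d' k a b u = (if a < m \<and> b < m then ((if a = b then 1 else 0) - d k a u * d k b u) / \<rho> k u else 0)"

definition \<Phi>\<^sub>1 :: "nat \<times> nat \<Rightarrow> (nat \<times> nat \<Rightarrow> real) \<Rightarrow> real"
  where "\<Phi>\<^sub>1 = (\<lambda>(k, a) u. - (q * M) * (Q u powr (q - 1) * E k u * d k a u))"

text \<open>The first summand arises from differentiating the power of Q. The second arises from
  \<open>E k\<close> and \<open>d k\<close>, which depend on the coordinates of direction k alone,
  so it is present for \<open>k = l\<close> only.\<close>

definition \<Phi>\<^sub>2 :: "nat \<times> nat \<Rightarrow> nat \<times> nat \<Rightarrow> (nat \<times> nat \<Rightarrow> real) \<Rightarrow> real"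
  where "\<Phi>\<^sub>2 = (\<lambda>(k, a) (l, b) u. q * (q - 1) * M\<^sup>2 * (Q u powr (q - 2) * E k u * E l u * d k a u * d l b u)
     + (if k = l then q * M * (Q u powr (q - 1) * E k u * (M * d k a u * d k b u - d' k a b u)) else 0))"

lemma \<rho>_ge: "\<epsilon> \<le> \<rho> k u"
  unfolding \<rho>_def using \<epsilon> by (intro real_le_rsqrt) (simp add: sum_nonneg)

lemma \<rho>_pos: "0 < \<rho> k u"
  using \<rho>_ge \<epsilon> by (rule less_le_trans[rotated])

lemma \<rho>_sq: "(\<rho> k u)\<^sup>2 = \<epsilon>\<^sup>2 + (\<Sum>a<m. (u (k, a))\<^sup>2)"
  unfolding \<rho>_def by (simp add: sum_nonneg)

lemma E_pos: "0 < E k u"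
  by (simp add: E_def)

lemma Q_pos: "0 < Q u"
  unfolding Q_def using N by (intro sum_pos E_pos) auto

lemma E_le_Q: "k < N \<Longrightarrow> E k u \<le> Q u"
  unfolding Q_def by (intro member_le_sum) (auto intro: less_imp_le E_pos)

lemma d_le: "\<bar>d k a u\<bar> \<le> 1"
proof (cases "a < m")
  case True
  have "(u (k, a))\<^sup>2 \<le> (\<rho> k u)\<^sup>2"
    unfolding \<rho>_sq using True by (intro add_increasing member_le_sum) auto
  then have "\<bar>u (k, a)\<bar> \<le> \<rho> k u"
    using \<rho>_pos[of k u] abs_le_square_iff[of "u (k, a)" "\<rho> k u"] by simp
  then show ?thesis using \<rho>_pos[of k u] True by (simp add: d_def)
qed (simp add: d_def)

lemma sum_d_sq: "(\<Sum>a<m. (d k a u)\<^sup>2) \<le> 1"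
proof -
  have "(\<Sum>a<m. (d k a u)\<^sup>2) = (\<Sum>a<m. (u (k, a))\<^sup>2) / (\<rho> k u)\<^sup>2"
    by (simp add: d_def power_divide sum_divide_distrib)
  also have "\<dots> \<le> 1"
    using \<rho>_pos[of k u] by (simp add: divide_le_eq_1) (simp add: \<rho>_sq)
  finally show ?thesis .
qed

lemma d'_le: "\<bar>d' k a b u\<bar> \<le> 2 / \<epsilon>"
proof -
  have "\<bar>d k a u * d k b u\<bar> \<le> 1 * 1"
    unfolding abs_mult by (intro mult_mono d_le) auto
  moreover have "\<bar>(if a = b then 1 else 0) - d k a u * d k b u\<bar> \<le> \<bar>if a = b then 1 else 0\<bar> + \<bar>d k a u * d k b u\<bar>"
    by (rule abs_triangle_ineq4)
  moreover have "\<bar>if a = b then 1 else 0 :: real\<bar> \<le> 1" by simp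
  ultimately have "\<bar>(if a = b then 1 else 0) - d k a u * d k b u\<bar> \<le> 2"
    by linarith
  then have "\<bar>(if a = b then 1 else 0) - d k a u * d k b u\<bar> / \<rho> k u \<le> 2 / \<epsilon>"
    using \<rho>_ge \<epsilon> by (intro frac_le) auto
  then show ?thesis using \<rho>_pos[of k u] \<epsilon> by (simp add: d'_def)
qed

lemma measurable_components [measurable]:
  "\<rho> k \<in> borel_measurable (Pi\<^sub>M UNIV (\<lambda>_. borel))"
  "E k \<in> borel_measurable (Pi\<^sub>M UNIV (\<lambda>_. borel))"
  "Q \<in> borel_measurable (Pi\<^sub>M UNIV (\<lambda>_. borel))"
  "d k a \<in> borel_measurable (Pi\<^sub>M UNIV (\<lambda>_. borel))"
  "d' k a b \<in> borel_measurable (Pi\<^sub>M UNIV (\<lambda>_. borel))"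
proof -
  show 1 [measurable]: "\<rho> k \<in> borel_measurable (Pi\<^sub>M UNIV (\<lambda>_. borel))" for k
    unfolding \<rho>_def[abs_def] by measurable
  show [measurable]: "E k \<in> borel_measurable (Pi\<^sub>M UNIV (\<lambda>_. borel))" for k
    unfolding E_def[abs_def] by measurable
  show "Q \<in> borel_measurable (Pi\<^sub>M UNIV (\<lambda>_. borel))"
    unfolding Q_def[abs_def] by measurable
  show [measurable]: "d k a \<in> borel_measurable (Pi\<^sub>M UNIV (\<lambda>_. borel))" for a
    unfolding d_def[abs_def] by measurable
  show "d' k a b \<in> borel_measurable (Pi\<^sub>M UNIV (\<lambda>_. borel))"
    unfolding d'_def[abs_def] by measurable
qed

lemma measurable_\<Phi>:
  "\<Phi> \<in> borel_measurable (Pi\<^sub>M UNIV (\<lambda>_. borel))"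
  "\<Phi>\<^sub>1 p \<in> borel_measurable (Pi\<^sub>M UNIV (\<lambda>_. borel))"
  "\<Phi>\<^sub>2 p p' \<in> borel_measurable (Pi\<^sub>M UNIV (\<lambda>_. borel))"
  unfolding \<Phi>_def[abs_def] \<Phi>\<^sub>1_def \<Phi>\<^sub>2_def by (simp_all add: case_prod_beta')

lemma sum_J: "(\<Sum>p\<in>{..<N} \<times> {..m}. f p) = (\<Sum>k<N. \<Sum>a\<le>m. f (k, a))" for f :: "nat \<times> nat \<Rightarrow> real"
  by (simp add: sum.cartesian_product case_prod_beta')

section \<open>Chain rules for the functional along a curve\<close>

context
  fixes u :: "nat \<times> nat \<Rightarrow> real \<Rightarrow> real" and u' :: "nat \<times> nat \<Rightarrow> real" and t :: real
  assumes u: "\<And>p. p \<in> {..<N} \<times> {..m} \<Longrightarrow> (u p has_real_derivative u' p) (at t)"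
begin

lemma DERIV_\<rho>:
  assumes "k < N"
  shows "((\<lambda>t. \<rho> k (\<lambda>p. u p t)) has_real_derivative (\<Sum>a<m. d k a (\<lambda>p. u p t) * u' (k, a))) (at t)"
proof -
  have "0 < \<epsilon>\<^sup>2 + (\<Sum>a<m. (u (k, a) t)\<^sup>2)"
    using \<epsilon> by (simp add: add_pos_nonneg sum_nonneg)
  moreover have "((\<lambda>t. \<epsilon>\<^sup>2 + (\<Sum>a<m. (u (k, a) t)\<^sup>2)) has_real_derivative (\<Sum>a<m. 2 * u (k, a) t * u' (k, a))) (at t)"
    using assms by (auto intro!: derivative_eq_intros u simp: mult_ac)
  ultimately have "((\<lambda>t. \<rho> k (\<lambda>p. u p t)) has_real_derivative
      inverse (\<rho> k (\<lambda>p. u p t)) / 2 * (\<Sum>a<m. 2 * u (k, a) t * u' (k, a))) (at t)"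
    unfolding \<rho>_def using DERIV_chain2[OF DERIV_real_sqrt] by fastforce
  also have "inverse (\<rho> k (\<lambda>p. u p t)) / 2 * (\<Sum>a<m. 2 * u (k, a) t * u' (k, a)) = (\<Sum>a<m. d k a (\<lambda>p. u p t) * u' (k, a))"
    by (simp add: sum_distrib_left d_def field_simps)
  finally show ?thesis .
qed

text \<open>The derivative of the exponent \<open>\<rho> k u + u (k, m)\<close> along the curve,
  that is, the logarithmic derivative of \<open>E k\<close> divided by \<open>- M\<close>.\<close>

definition r :: "nat \<Rightarrow> real"
  where "r k = (\<Sum>a\<le>m. d k a (\<lambda>p. u p t) * u' (k, a))"

lemma DERIV_E:
  assumes "k < N"
  shows "((\<lambda>t. E k (\<lambda>p. u p t)) has_real_derivative - M * E k (\<lambda>p. u p t) * r k) (at t)"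
proof -
  have "((\<lambda>t. E k (\<lambda>p. u p t)) has_real_derivative
      exp (- M * (\<rho> k (\<lambda>p. u p t) + u (k, m) t)) * (- M * ((\<Sum>a<m. d k a (\<lambda>p. u p t) * u' (k, a)) + u' (k, m)))) (at t)"
    unfolding E_def using assms by (auto intro!: derivative_eq_intros DERIV_\<rho> u)
  also have "(\<Sum>a<m. d k a (\<lambda>p. u p t) * u' (k, a)) + u' (k, m) = r k"
    by (simp add: r_def d_def flip: lessThan_Suc_atMost)
  finally show ?thesis by (simp add: E_def mult_ac)
qed

lemma DERIV_Q:
  "((\<lambda>t. Q (\<lambda>p. u p t)) has_real_derivative - M * (\<Sum>k<N. E k (\<lambda>p. u p t) * r k)) (at t)"
proof -
  have "((\<lambda>t. Q (\<lambda>p. u p t)) has_real_derivative (\<Sum>k<N. - M * E k (\<lambda>p. u p t) * r k)) (at t)"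
    unfolding Q_def by (intro DERIV_sum DERIV_E) auto
  then show ?thesis by (simp add: sum_distrib_left mult.assoc)
qed

lemma DERIV_Q_powr:
  "((\<lambda>t. Q (\<lambda>p. u p t) powr s) has_real_derivative
     - (s * M) * Q (\<lambda>p. u p t) powr (s - 1) * (\<Sum>k<N. E k (\<lambda>p. u p t) * r k)) (at t)"
  using DERIV_fun_powr[OF DERIV_Q Q_pos, of s] by (simp add: mult_ac)

lemma DERIV_d:
  assumes "k < N" "a \<le> m"
  shows "((\<lambda>t. d k a (\<lambda>p. u p t)) has_real_derivative (\<Sum>b\<le>m. d' k a b (\<lambda>p. u p t) * u' (k, b))) (at t)"
proof (cases "a < m")
  case True
  let ?\<rho> = "\<rho> k (\<lambda>p. u p t)" and ?d = "\<lambda>a. d k a (\<lambda>p. u p t)"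
  let ?R = "\<Sum>b<m. ?d b * u' (k, b)"
  have "((\<lambda>t. u (k, a) t / \<rho> k (\<lambda>p. u p t)) has_real_derivative
      (u' (k, a) * ?\<rho> - u (k, a) t * ?R) / (?\<rho> * ?\<rho>)) (at t)"
    using True assms \<rho>_pos[of k "\<lambda>p. u p t"] by (intro DERIV_divide u DERIV_\<rho>) auto
  also have "(u' (k, a) * ?\<rho> - u (k, a) t * ?R) / (?\<rho> * ?\<rho>) = (u' (k, a) - ?d a * ?R) / ?\<rho>"
    using \<rho>_pos[of k "\<lambda>p. u p t"] True by (simp add: d_def field_simps)
  also have "u' (k, a) - ?d a * ?R = (\<Sum>b<m. ((if a = b then 1 else 0) - ?d a * ?d b) * u' (k, b))"
    using True by (simp add: left_diff_distrib sum_subtractf sum_distrib_left mult.assoc if_distrib[of "\<lambda>x. x * _"] sum.delta cong: if_cong)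
  also have "\<dots> / ?\<rho> = (\<Sum>b\<le>m. d' k a b (\<lambda>p. u p t) * u' (k, b))"
    using True by (simp add: d'_def sum_divide_distrib flip: lessThan_Suc_atMost)
  finally show ?thesis using True by (simp add: d_def)
qed (simp add: d_def d'_def)

lemma DERIV_\<Phi>:
  "((\<lambda>t. \<Phi> (\<lambda>p. u p t)) has_real_derivative (\<Sum>p\<in>{..<N} \<times> {..m}. \<Phi>\<^sub>1 p (\<lambda>p. u p t) * u' p)) (at t)"
proof -
  have "(\<Sum>p\<in>{..<N} \<times> {..m}. \<Phi>\<^sub>1 p (\<lambda>p. u p t) * u' p) =
      - (q * M) * Q (\<lambda>p. u p t) powr (q - 1) * (\<Sum>k<N. E k (\<lambda>p. u p t) * r k)"
    by (simp add: sum_J \<Phi>\<^sub>1_def r_def sum_distrib_left sum_negf mult_ac)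
  then show ?thesis
    unfolding \<Phi>_def using DERIV_Q_powr[of q] by simp
qed

lemma DERIV_\<Phi>\<^sub>1:
  assumes "p \<in> {..<N} \<times> {..m}"
  shows "((\<lambda>t. \<Phi>\<^sub>1 p (\<lambda>p. u p t)) has_real_derivative (\<Sum>p'\<in>{..<N} \<times> {..m}. \<Phi>\<^sub>2 p p' (\<lambda>p. u p t) * u' p')) (at t)"
proof -
  obtain k a where p: "p = (k, a)" "k < N" "a \<le> m" using assms by auto
  let ?u = "\<lambda>p. u p t"
  let ?D = "\<Sum>b\<le>m. d' k a b ?u * u' (k, b)"
  let ?R = "\<Sum>l<N. E l ?u * r l"
  have "((\<lambda>t. \<Phi>\<^sub>1 p (\<lambda>p. u p t)) has_real_derivative
      - (q * M) * (((- ((q - 1) * M) * Q ?u powr (q - 1 - 1) * ?R) * E k ?u + (- M * E k ?u * r k) * Q ?u powr (q - 1)) * d k a ?u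
        + ?D * (Q ?u powr (q - 1) * E k ?u))) (at t)"
    unfolding \<Phi>\<^sub>1_def p prod.case
    by (intro DERIV_cmult DERIV_mult DERIV_Q_powr DERIV_E DERIV_d p)
  also have "- (q * M) * (((- ((q - 1) * M) * Q ?u powr (q - 1 - 1) * ?R) * E k ?u + (- M * E k ?u * r k) * Q ?u powr (q - 1)) * d k a ?u
        + ?D * (Q ?u powr (q - 1) * E k ?u)) =
      q * (q - 1) * M\<^sup>2 * (Q ?u powr (q - 2) * E k ?u * d k a ?u) * ?R
      + q * M * (Q ?u powr (q - 1) * E k ?u) * (M * d k a ?u * r k - ?D)"
    by (simp add: power2_eq_square algebra_simps)
  also have "\<dots> = (\<Sum>p'\<in>{..<N} \<times> {..m}. \<Phi>\<^sub>2 p p' ?u * u' p')"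
  proof -
    have "(\<Sum>l<N. \<Sum>b\<le>m. (if k = l then q * M * (Q ?u powr (q - 1) * E k ?u * (M * d k a ?u * d k b ?u - d' k a b ?u)) else 0) * u' (l, b))
      = (\<Sum>l<N. if k = l then \<Sum>b\<le>m. q * M * (Q ?u powr (q - 1) * E k ?u * (M * d k a ?u * d k b ?u - d' k a b ?u)) * u' (l, b) else 0)"
      by (intro sum.cong) auto
    also have "\<dots> = (\<Sum>b\<le>m. q * M * (Q ?u powr (q - 1) * E k ?u * (M * d k a ?u * d k b ?u - d' k a b ?u)) * u' (k, b))"
      using p by simp
    also have "\<dots> = q * M * (Q ?u powr (q - 1) * E k ?u) * (M * d k a ?u * r k - ?D)"
      by (simp add: r_def sum_distrib_left right_diff_distrib left_diff_distrib sum_subtractf mult_ac)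
    finally have 1: "(\<Sum>l<N. \<Sum>b\<le>m. (if k = l then q * M * (Q ?u powr (q - 1) * E k ?u * (M * d k a ?u * d k b ?u - d' k a b ?u)) else 0) * u' (l, b))
      = q * M * (Q ?u powr (q - 1) * E k ?u) * (M * d k a ?u * r k - ?D)" .
    have 2: "(\<Sum>l<N. \<Sum>b\<le>m. q * (q - 1) * M\<^sup>2 * (Q ?u powr (q - 2) * E k ?u * E l ?u * d k a ?u * d l b ?u) * u' (l, b))
      = q * (q - 1) * M\<^sup>2 * (Q ?u powr (q - 2) * E k ?u * d k a ?u) * ?R"
      by (simp add: r_def sum_distrib_left mult_ac)
    show ?thesis
      unfolding 1[symmetric] 2[symmetric]
      by (simp add: sum_J \<Phi>\<^sub>2_def p distrib_right sum.distrib)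
  qed
  finally show ?thesis .
qed

end

lemma isCont_\<Phi>\<^sub>2:
  assumes "p \<in> {..<N} \<times> {..m}" "p' \<in> {..<N} \<times> {..m}"
    and u: "\<And>p. p \<in> {..<N} \<times> {..m} \<Longrightarrow> isCont (u p) t"
  shows "isCont (\<lambda>t. \<Phi>\<^sub>2 p p' (\<lambda>p. u p t)) t"
proof -
  obtain k a l b where p: "p = (k, a)" "p' = (l, b)" "k < N" "a \<le> m" "l < N" "b \<le> m"
    using assms by auto
  have \<rho>: "isCont (\<lambda>t. \<rho> k (\<lambda>p. u p t)) t" if "k < N" for k
    unfolding \<rho>_def using that by (auto intro!: continuous_intros u)
  have E: "isCont (\<lambda>t. E k (\<lambda>p. u p t)) t" if "k < N" for k
    unfolding E_def using that by (intro continuous_intros u \<rho>) auto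
  have Q: "isCont (\<lambda>t. Q (\<lambda>p. u p t) powr s) t" for s
  proof (rule continuous_at_within_powr)
    show "isCont (\<lambda>t. Q (\<lambda>p. u p t)) t"
      unfolding Q_def by (intro continuous_intros E) auto
  qed (use Q_pos[of "\<lambda>p. u p t"] in auto)
  have d: "isCont (\<lambda>t. d k a (\<lambda>p. u p t)) t" if "k < N" "a \<le> m" for k a
    unfolding d_def using that \<rho>_pos[of k "\<lambda>p. u p t"]
    by (cases "a < m") (auto intro!: continuous_intros u \<rho>)
  have d': "isCont (\<lambda>t. d' k a b (\<lambda>p. u p t)) t" if "k < N" "a \<le> m" "b \<le> m" for k a b
    unfolding d'_def using that \<rho>_pos[of k "\<lambda>p. u p t"]
    by (cases "a < m \<and> b < m") (auto intro!: continuous_intros u \<rho> d)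
  show ?thesis
    unfolding p \<Phi>\<^sub>2_def prod.case using p
    by (cases "k = l") (auto intro!: continuous_intros E Q d d')
qed

section \<open>Growth bounds for the functional and its derivatives\<close>

abbreviation J :: "(nat \<times> nat) set" where "J \<equiv> {..<N} \<times> {..m}"

text \<open>Collects the constants of \<open>Q u powr q \<le> 1 + Q u\<close>, where Q is a sum of N
  exponentials.\<close>

definition R :: real where "R = 1 + N * exp (M * \<epsilon>)"

lemma Q_powr_le: "Q u powr q \<le> R * exp (M * (\<Sum>p\<in>J. \<bar>u p\<bar>))"
proof -
  let ?S = "\<Sum>p\<in>J. \<bar>u p\<bar>"
  have S0: "0 \<le> ?S" by (simp add: sum_nonneg)
  have "E k u \<le> exp (M * \<epsilon>) * exp (M * ?S)" if "k < N" for k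
  proof -
    have "0 \<le> \<rho> k u" using \<rho>_pos by (rule less_imp_le)
    moreover have "\<bar>u (k, m)\<bar> \<le> ?S"
      using that by (intro member_le_sum) auto
    ultimately have "- (\<rho> k u + u (k, m)) \<le> \<epsilon> + ?S"
      using \<epsilon> by linarith
    then have "M * (- (\<rho> k u + u (k, m))) \<le> M * (\<epsilon> + ?S)"
      using M by (intro mult_left_mono) auto
    then show ?thesis
      unfolding E_def by (simp add: algebra_simps flip: exp_add)
  qed
  then have "Q u \<le> N * (exp (M * \<epsilon>) * exp (M * ?S))"
    unfolding Q_def using sum_bounded_above[of "{..<N}" "\<lambda>k. E k u"] by simp
  moreover have "1 \<le> exp (M * ?S)" using M S0 by simp
  ultimately have "1 + Q u \<le> R * exp (M * ?S)"
    unfolding R_def distrib_right mult_1 mult.assoc by linarith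
  moreover have "Q u powr q \<le> 1 + Q u"
  proof (cases "Q u \<le> 1")
    case True
    then have "Q u powr q \<le> 1" using q Q_pos[of u] by (simp add: powr_le_one_le powr_le1)
    then show ?thesis using Q_pos[of u] by linarith
  next
    case False
    then have "Q u powr q \<le> Q u powr 1" using q by (intro powr_mono) auto
    then show ?thesis using Q_pos[of u] by simp
  qed
  ultimately show ?thesis by linarith
qed

text \<open>Every derivative lowers the exponent of Q by one but brings in a factor
  \<open>E k u\<close>, which is at most Q. So negative powers of Q are harmless, and all
  derivatives are bounded by multiples of \<open>Q u powr q\<close>.\<close>

lemma Q_powr_E_le:
  assumes "k < N"
  shows "Q u powr (q - 1) * E k u \<le> Q u powr q"
proof -
  have "Q u powr (q - 1) * E k u \<le> Q u powr (q - 1) * Q u"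
    using assms by (intro mult_left_mono E_le_Q) auto
  also have "\<dots> = Q u powr q"
    using Q_pos[of u] by (simp add: powr_diff)
  finally show ?thesis .
qed

lemma Q_powr_E_E_le:
  assumes "k < N" "l < N"
  shows "Q u powr (q - 2) * E k u * E l u \<le> Q u powr q"
proof -
  have "Q u powr (q - 2) * E k u * E l u \<le> Q u powr (q - 2) * Q u * Q u"
    using assms by (intro mult_mono mult_left_mono E_le_Q mult_nonneg_nonneg less_imp_le[OF Q_pos] less_imp_le[OF E_pos]) auto
  also have "\<dots> = Q u powr q"
    using Q_pos[of u] by (simp add: powr_diff power2_eq_square)
  finally show ?thesis .
qed

text \<open>The bracket dominates the coefficients of \<open>Q u powr q\<close> in the three bounds:
  1 for \<open>\<Phi>\<close>, M for \<open>\<Phi>\<^sub>1\<close>, and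
  \<open>2 * M\<^sup>2 + M * (2 / \<epsilon>)\<close> for \<open>\<Phi>\<^sub>2\<close>, where
  \<open>2 / \<epsilon>\<close> bounds the Hessian \<open>d'\<close>.\<close>

definition K :: real where "K = R * (1 + M + 2 * M\<^sup>2 + M * (2 / \<epsilon>))"

lemma bound_aux:
  assumes "x \<le> B * Q u powr q" "0 \<le> B" "B \<le> 1 + M + 2 * M\<^sup>2 + M * (2 / \<epsilon>)"
  shows "x \<le> K * exp (M * (\<Sum>p\<in>J. \<bar>u p\<bar>))"
proof -
  have "B * Q u powr q \<le> (1 + M + 2 * M\<^sup>2 + M * (2 / \<epsilon>)) * (R * exp (M * (\<Sum>p\<in>J. \<bar>u p\<bar>)))"
    using assms by (intro mult_mono Q_powr_le) auto
  then show ?thesis using assms(1) by (simp add: K_def mult_ac)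
qed

lemma \<Phi>_le: "\<bar>\<Phi> u\<bar> \<le> K * exp (M * (\<Sum>p\<in>J. \<bar>u p\<bar>))"
  by (rule bound_aux[where B = 1]) (use M \<epsilon> in \<open>auto simp: \<Phi>_def\<close>)

lemma \<Phi>\<^sub>1_le:
  assumes "p \<in> J"
  shows "\<bar>\<Phi>\<^sub>1 p u\<bar> \<le> K * exp (M * (\<Sum>p\<in>J. \<bar>u p\<bar>))"
proof -
  obtain k a where p: "p = (k, a)" "k < N" "a \<le> m" using assms by auto
  have "\<bar>\<Phi>\<^sub>1 p u\<bar> = (q * M) * ((Q u powr (q - 1) * E k u) * \<bar>d k a u\<bar>)"
    unfolding p \<Phi>\<^sub>1_def using q M E_pos[of k u] by (simp add: abs_mult)
  also have "\<dots> \<le> (1 * M) * (Q u powr q * 1)"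
    using q M p less_imp_le[OF E_pos[of k u]] by (intro mult_mono Q_powr_E_le d_le) auto
  finally show ?thesis
    by (intro bound_aux[where B = M]) (use M \<epsilon> in auto)
qed

lemma \<Phi>\<^sub>2_le:
  assumes "p \<in> J" "p' \<in> J"
  shows "\<bar>\<Phi>\<^sub>2 p p' u\<bar> \<le> K * exp (M * (\<Sum>p\<in>J. \<bar>u p\<bar>))"
proof -
  obtain k a l b where p: "p = (k, a)" "p' = (l, b)" "k < N" "l < N" using assms by auto
  let ?P = "Q u powr q"
  let ?x = "q * (q - 1) * M\<^sup>2 * (Q u powr (q - 2) * E k u * E l u * d k a u * d l b u)"
  let ?y = "q * M * (Q u powr (q - 1) * E k u * (M * d k a u * d k b u - d' k a b u))"
  have dd: "\<bar>d k a u\<bar> * \<bar>d l b u\<bar> \<le> 1" for k a l b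
    using mult_mono[OF d_le d_le] by simp
  have "\<bar>?x\<bar> = (q * (1 - q) * M\<^sup>2) * ((Q u powr (q - 2) * E k u * E l u) * (\<bar>d k a u\<bar> * \<bar>d l b u\<bar>))"
    using q M less_imp_le[OF E_pos] by (simp add: abs_mult)
  also have "\<dots> \<le> (1 * 1 * M\<^sup>2) * (?P * 1)"
    using q M p less_imp_le[OF E_pos] dd by (intro mult_mono Q_powr_E_E_le) auto
  finally have x: "\<bar>?x\<bar> \<le> M\<^sup>2 * ?P" by simp
  have "\<bar>M * d k a u * d k b u - d' k a b u\<bar> \<le> \<bar>M * d k a u * d k b u\<bar> + \<bar>d' k a b u\<bar>"
    by (rule abs_triangle_ineq4)
  also have "\<bar>M * d k a u * d k b u\<bar> = M * (\<bar>d k a u\<bar> * \<bar>d k b u\<bar>)"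
    using M by (simp add: abs_mult)
  also have "\<dots> \<le> M * 1"
    using M dd by (intro mult_left_mono) auto
  finally have z: "\<bar>M * d k a u * d k b u - d' k a b u\<bar> \<le> M + 2 / \<epsilon>"
    using d'_le[of k a b u] by simp
  have "\<bar>?y\<bar> = (q * M) * ((Q u powr (q - 1) * E k u) * \<bar>M * d k a u * d k b u - d' k a b u\<bar>)"
    using q M less_imp_le[OF E_pos] by (simp add: abs_mult)
  also have "\<dots> \<le> (1 * M) * (?P * (M + 2 / \<epsilon>))"
    using q M p less_imp_le[OF E_pos] z by (intro mult_mono Q_powr_E_le) auto
  finally have y: "\<bar>?y\<bar> \<le> M * (M + 2 / \<epsilon>) * ?P" by (simp add: mult_ac)
  have "\<bar>\<Phi>\<^sub>2 p p' u\<bar> \<le> \<bar>?x\<bar> + \<bar>?y\<bar>"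
    unfolding p \<Phi>\<^sub>2_def by (auto intro: abs_triangle_ineq)
  also have "\<dots> \<le> (2 * M\<^sup>2 + M * (2 / \<epsilon>)) * ?P"
    using x y by (simp add: algebra_simps power2_eq_square)
  finally show ?thesis
    by (rule bound_aux) (use M \<epsilon> in auto)
qed

section \<open>The two Gaussian processes and their covariances\<close>

definition row :: "bool \<Rightarrow> nat \<Rightarrow> nat \<Rightarrow> real"
  where "row b k j = (if b then if j < n then w k j else 0 else if j = n then 1 else 0)"

text \<open>In row a the process X reads the columns below n against \<open>w k\<close> if
  \<open>a < m\<close>, and column n if \<open>a = m\<close>; Y does the opposite. In each row the
  two read complementary columns, so they are uncorrelated.\<close>

definition X :: "nat \<times> nat \<Rightarrow> nat \<times> nat \<Rightarrow> real"
  where "X = (\<lambda>(k, a) (i, j). if i = a then row (a < m) k j else 0)"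

definition Y :: "nat \<times> nat \<Rightarrow> nat \<times> nat \<Rightarrow> real"
  where "Y = (\<lambda>(k, a) (i, j). if i = a then row (\<not> a < m) k j else 0)"

lemma sum_rows:
  fixes f :: "nat \<Rightarrow> real"
  assumes "a \<le> m"
  shows "(\<Sum>p\<in>{..m} \<times> {..n}. (case p of (i, j) \<Rightarrow> if i = a then f j else 0) * g p) = (\<Sum>j\<le>n. f j * g (a, j))"
proof -
  have "(\<Sum>p\<in>{..m} \<times> {..n}. (case p of (i, j) \<Rightarrow> if i = a then f j else 0) * g p)
    = (\<Sum>i\<le>m. \<Sum>j\<le>n. (if i = a then f j else 0) * g (i, j))"
    by (simp add: sum.cartesian_product case_prod_beta')
  also have "\<dots> = (\<Sum>i\<le>m. if i = a then \<Sum>j\<le>n. f j * g (i, j) else 0)"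
    by (intro sum.cong) auto
  finally show ?thesis using assms by simp
qed

lemma sum_row: "(\<Sum>j\<le>n. row b k j * f j) = (if b then \<Sum>j<n. w k j * f j else f n)"
  by (simp add: row_def flip: lessThan_Suc_atMost)

lemma sum_row_row: "(\<Sum>j\<le>n. row b k j * row b' l j) = (if b = b' then if b then \<Sum>j<n. w k j * w l j else 1 else 0)"
  unfolding sum_row by (simp add: row_def)

lemma sum_XX: "a \<le> m \<Longrightarrow> (\<Sum>p\<in>{..m} \<times> {..n}. X (k, a) p * X (l, b) p) = (if a = b then if a < m then \<Sum>j<n. w k j * w l j else 1 else 0)"
  unfolding X_def prod.case by (subst sum_rows) (auto simp: sum_row_row)

lemma sum_YY: "a \<le> m \<Longrightarrow> (\<Sum>p\<in>{..m} \<times> {..n}. Y (k, a) p * Y (l, b) p) = (if a = b then if a < m then 1 else \<Sum>j<n. w k j * w l j else 0)"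
  unfolding Y_def prod.case by (subst sum_rows) (auto simp: sum_row_row)

lemma sum_XY: "a \<le> m \<Longrightarrow> (\<Sum>p\<in>{..m} \<times> {..n}. X (k, a) p * Y (l, b) p) = 0"
  unfolding X_def Y_def prod.case by (subst sum_rows; cases "a = b") (auto simp: sum_row_row)

lemma sum_X: "a \<le> m \<Longrightarrow> (\<Sum>p\<in>{..m} \<times> {..n}. X (k, a) p * \<xi> p) = (if a < m then \<Sum>j<n. w k j * \<xi> (a, j) else \<xi> (a, n))"
  unfolding X_def prod.case by (subst sum_rows) (auto simp: sum_row)

lemma sum_Y: "a \<le> m \<Longrightarrow> (\<Sum>p\<in>{..m} \<times> {..n}. Y (k, a) p * \<xi> p) = (if a < m then \<xi> (a, n) else \<Sum>j<n. w k j * \<xi> (a, j))"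
  unfolding Y_def prod.case by (subst sum_rows) (auto simp: sum_row)

text \<open>Only \<open>a = b\<close> contributes: the covariances differ by \<open>g - 1\<close>
  for \<open>a < m\<close> and by \<open>1 - g\<close> for \<open>a = m\<close>, where g is the
  inner product of the two directions. Unit length removes \<open>k = l\<close>. For other pairs
  only the first summand of \<open>\<Phi>\<^sub>2\<close> is present, and the sum over a is a
  nonnegative factor times the inner product of two gradients of smoothed norms minus 1. These
  gradients have length at most 1, so Cauchy-Schwarz settles both signs.\<close>

lemma covariance_sign:
  "(\<Sum>p\<in>J. \<Sum>p'\<in>J. ((\<Sum>i\<in>{..m} \<times> {..n}. X p i * X p' i) - (\<Sum>i\<in>{..m} \<times> {..n}. Y p i * Y p' i)) * \<Phi>\<^sub>2 p p' u) \<le> 0"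
proof -
  let ?g = "\<lambda>k l. \<Sum>j<n. w k j * w l j"
  let ?\<sigma> = "\<lambda>a. if a < m then 1 else - 1 :: real"
  have "(\<Sum>p\<in>J. \<Sum>p'\<in>J. ((\<Sum>i\<in>{..m} \<times> {..n}. X p i * X p' i) - (\<Sum>i\<in>{..m} \<times> {..n}. Y p i * Y p' i)) * \<Phi>\<^sub>2 p p' u)
    = (\<Sum>k<N. \<Sum>a\<le>m. \<Sum>l<N. \<Sum>b\<le>m. if b = a then (?g k l - 1) * ?\<sigma> a * \<Phi>\<^sub>2 (k, a) (l, b) u else 0)"
    unfolding sum_J by (intro sum.cong refl) (auto simp: sum_XX sum_YY algebra_simps)
  also have "\<dots> = (\<Sum>k<N. \<Sum>a\<le>m. \<Sum>l<N. (?g k l - 1) * ?\<sigma> a * \<Phi>\<^sub>2 (k, a) (l, a) u)"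
    by (intro sum.cong refl) (simp add: sum.delta)
  also have "\<dots> \<le> 0"
  proof (rule sum_nonpos)
    fix k assume "k \<in> {..<N}"
    then have k: "k < N" by simp
    have "(\<Sum>a\<le>m. \<Sum>l<N. (?g k l - 1) * ?\<sigma> a * \<Phi>\<^sub>2 (k, a) (l, a) u) = (\<Sum>l<N. \<Sum>a\<le>m. (?g k l - 1) * ?\<sigma> a * \<Phi>\<^sub>2 (k, a) (l, a) u)"
      by (rule sum.swap)
    also have "\<dots> \<le> 0"
    proof (rule sum_nonpos)
      fix l assume "l \<in> {..<N}"
      then have l: "l < N" by simp
      show "(\<Sum>a\<le>m. (?g k l - 1) * ?\<sigma> a * \<Phi>\<^sub>2 (k, a) (l, a) u) \<le> 0"
      proof (cases "k = l")
        case True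
        then have "?g k l = 1" using unit[OF k] by (simp add: power2_eq_square)
        then show ?thesis by simp
      next
        case False
        let ?c = "(1 - ?g k l) * (q * (1 - q) * M\<^sup>2 * (Q u powr (q - 2) * E k u * E l u))"
        have "(\<Sum>a\<le>m. (?g k l - 1) * ?\<sigma> a * \<Phi>\<^sub>2 (k, a) (l, a) u) = (\<Sum>a\<le>m. ?c * (?\<sigma> a * d k a u * d l a u))"
          using False by (intro sum.cong refl) (simp add: \<Phi>\<^sub>2_def algebra_simps)
        also have "\<dots> = ?c * ((\<Sum>a<m. d k a u * d l a u) - 1)"
        proof -
          have "(\<Sum>a\<le>m. ?\<sigma> a * d k a u * d l a u) = (\<Sum>a<m. d k a u * d l a u) - 1"
            by (simp add: d_def flip: lessThan_Suc_atMost)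
          then show ?thesis by (simp only: sum_distrib_left[symmetric])
        qed
        also have "\<dots> \<le> 0"
        proof (rule mult_nonneg_nonpos)
          have "?g k l \<le> 1"
            using unit k l by (intro sum_mult_le_1) auto
          then show "0 \<le> ?c"
            using q less_imp_le[OF E_pos] by (intro mult_nonneg_nonneg) auto
          show "(\<Sum>a<m. d k a u * d l a u) - 1 \<le> 0"
            using sum_mult_le_1[OF sum_d_sq sum_d_sq] by simp
        qed
        finally show ?thesis .
      qed
    qed
    finally show "(\<Sum>a\<le>m. \<Sum>l<N. (?g k l - 1) * ?\<sigma> a * \<Phi>\<^sub>2 (k, a) (l, a) u) \<le> 0" .
  qed
  finally show ?thesis .
qed

lemma gordon_comparison:
  "integrable (gauss_vec ({..m} \<times> {..n}))
     (\<lambda>\<xi>. (\<Sum>k<N. exp (- M * (sqrt (\<epsilon>\<^sup>2 + (\<Sum>a<m. (\<Sum>j<n. w k j * \<xi> (a, j))\<^sup>2)) + \<xi> (m, n)))) powr q)"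
  "(\<integral>\<xi>. (\<Sum>k<N. exp (- M * (sqrt (\<epsilon>\<^sup>2 + (\<Sum>a<m. (\<Sum>j<n. w k j * \<xi> (a, j))\<^sup>2)) + \<xi> (m, n)))) powr q \<partial>gauss_vec ({..m} \<times> {..n})) \<le>
   (\<integral>\<xi>. (\<Sum>k<N. exp (- M * (sqrt (\<epsilon>\<^sup>2 + (\<Sum>a<m. (\<xi> (a, n))\<^sup>2)) + (\<Sum>j<n. w k j * \<xi> (m, j))))) powr q \<partial>gauss_vec ({..m} \<times> {..n}))"
proof -
  let ?I = "{..m} \<times> {..n}"
  have orth: "(\<Sum>i\<in>?I. X p i * Y p' i) = 0" if "p \<in> J" "p' \<in> J" for p p'
    using that by (cases p; cases p') (auto intro!: sum_XY)
  note interp = gauss_interpolation[where I = ?I and J = J and \<Phi> = \<Phi> and \<Phi>\<^sub>1 = \<Phi>\<^sub>1 and \<Phi>\<^sub>2 = \<Phi>\<^sub>2 and X = X and Y = Y and c = M and K = K,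
    OF _ _ measurable_\<Phi> DERIV_\<Phi> DERIV_\<Phi>\<^sub>1 isCont_\<Phi>\<^sub>2 _ \<Phi>_le \<Phi>\<^sub>1_le \<Phi>\<^sub>2_le orth covariance_sign]
  have "integrable (gauss_vec ?I) (\<lambda>\<xi>. \<Phi> (\<lambda>p. \<Sum>i\<in>?I. X p i * \<xi> i))"
    by (rule interp(1)) (use M in auto)
  then show "integrable (gauss_vec ({..m} \<times> {..n}))
     (\<lambda>\<xi>. (\<Sum>k<N. exp (- M * (sqrt (\<epsilon>\<^sup>2 + (\<Sum>a<m. (\<Sum>j<n. w k j * \<xi> (a, j))\<^sup>2)) + \<xi> (m, n)))) powr q)"
    by (simp add: \<Phi>_def Q_def E_def \<rho>_def sum_X)
  have "(\<integral>\<xi>. \<Phi> (\<lambda>p. \<Sum>i\<in>?I. X p i * \<xi> i) \<partial>gauss_vec ?I) \<le> (\<integral>\<xi>. \<Phi> (\<lambda>p. \<Sum>i\<in>?I. Y p i * \<xi> i) \<partial>gauss_vec ?I)"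
    by (rule interp(2)) (use M in auto)
  then show "(\<integral>\<xi>. (\<Sum>k<N. exp (- M * (sqrt (\<epsilon>\<^sup>2 + (\<Sum>a<m. (\<Sum>j<n. w k j * \<xi> (a, j))\<^sup>2)) + \<xi> (m, n)))) powr q \<partial>gauss_vec ?I) \<le>
   (\<integral>\<xi>. (\<Sum>k<N. exp (- M * (sqrt (\<epsilon>\<^sup>2 + (\<Sum>a<m. (\<xi> (a, n))\<^sup>2)) + (\<Sum>j<n. w k j * \<xi> (m, j))))) powr q \<partial>gauss_vec ?I)"
    by (simp add: \<Phi>_def Q_def E_def \<rho>_def sum_X sum_Y)
qed

end

subsection \<open>Small values of a Gaussian matrix on finitely many directions\<close>

text \<open>Splits off the corner variable: invariance of f under updates of coordinate i is the
  form in which independence of that coordinate is available.\<close>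

lemma gauss_vec_integral_indep:
  fixes f :: "('i \<Rightarrow> real) \<Rightarrow> real" and g :: "real \<Rightarrow> real"
  assumes I: "finite I" "i \<in> I"
    and f [measurable]: "f \<in> borel_measurable (gauss_vec I)" and f_le: "\<And>\<xi>. \<bar>f \<xi>\<bar> \<le> 1"
    and f_upd: "\<And>\<xi> s. f (\<xi>(i := s)) = f \<xi>"
    and g: "integrable gauss g"
  shows "integrable (gauss_vec I) (\<lambda>\<xi>. f \<xi> * g (\<xi> i))"
    and "(\<integral>\<xi>. f \<xi> * g (\<xi> i) \<partial>gauss_vec I) = (\<integral>\<xi>. f \<xi> \<partial>gauss_vec I) * (\<integral>x. g x \<partial>gauss)"
proof -
  interpret product_prob_space "\<lambda>_::'i. gauss" I by (rule product_prob_space_gauss)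
  have ins: "insert i (I - {i}) = I" using I by auto
  note fold = product_integral_insert[of "I - {i}" i, unfolded ins]
  have gm [measurable]: "g \<in> borel_measurable gauss" using g by auto
  have int_g: "integrable (gauss_vec I) (\<lambda>\<xi>. g (\<xi> i))"
  proof -
    have "has_bochner_integral (gauss_vec I) (\<lambda>\<xi>. \<Prod>j\<in>I. (if j = i then g else (\<lambda>_. 1)) (\<xi> j))
        (\<Prod>j\<in>I. integral\<^sup>L gauss (if j = i then g else (\<lambda>_. 1)))"
      using I g by (intro has_bochner_integral_gauss_vec_prod) (auto simp: has_bochner_integral_iff)
    moreover have "(\<Prod>j\<in>I. (if j = i then g else (\<lambda>_. 1)) (\<xi> j)) = g (\<xi> i)" for \<xi> :: "'i \<Rightarrow> real"
      using I by (simp add: if_distribR prod.delta)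
    ultimately show ?thesis by (simp add: has_bochner_integral_iff)
  qed
  have [measurable]: "(\<lambda>\<xi>. \<xi> i) \<in> gauss_vec I \<rightarrow>\<^sub>M gauss"
    using I(2) by measurable
  show int: "integrable (gauss_vec I) (\<lambda>\<xi>. f \<xi> * g (\<xi> i))"
  proof (rule Bochner_Integration.integrable_bound[OF int_g])
    show "AE \<xi> in gauss_vec I. norm (f \<xi> * g (\<xi> i)) \<le> norm (g (\<xi> i))"
      using f_le by (auto simp: abs_mult intro!: mult_left_le_one_le)
  qed measurable
  have int_f: "integrable (gauss_vec I) f"
    by (rule P.integrable_const_bound[of _ 1]) (use f_le in auto)
  show "(\<integral>\<xi>. f \<xi> * g (\<xi> i) \<partial>gauss_vec I) = (\<integral>\<xi>. f \<xi> \<partial>gauss_vec I) * (\<integral>x. g x \<partial>gauss)"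
    using fold[OF _ _ int] fold[OF _ _ int_f] I prob_space.prob_space[OF prob_space_gauss] by (simp add: f_upd)
qed

text \<open>The expectation of \<open>exp (- \<kappa> |g|\<^sup>2)\<close> has rate
  \<open>- \<alpha> / 2 * ln (1 + 2 * \<kappa>)\<close>. For fixed \<rho> the left-hand side is
  smallest at \<open>1 + 2 * \<kappa> = \<alpha> / \<rho>\<^sup>2\<close>. The value obtained, as a
  function of \<rho>, is largest at the positive root s of
  \<open>s\<^sup>2 + c * s = \<alpha>\<close>, where it equals \<open>I_sph\<close>; moreover
  \<open>s = - 2 * gamma_hat \<alpha> c\<close>.\<close>

lemma I_sph_tangent:
  fixes \<alpha> c \<rho> :: real
  assumes \<alpha>: "0 < \<alpha>" and c: "0 < c" and \<rho>: "0 < \<rho>"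
  shows "\<exists>\<kappa>\<ge>0. - c * \<rho> + \<kappa> * \<rho>\<^sup>2 - \<alpha> / 2 * ln (1 + 2 * \<kappa>) \<le> I_sph \<alpha> c"
proof -
  define s where "s = (sqrt (c\<^sup>2 + 4 * \<alpha>) - c) / 2"
  have "c = sqrt (c\<^sup>2)" using c by simp
  also have "\<dots> < sqrt (c\<^sup>2 + 4 * \<alpha>)" using \<alpha> by (subst real_sqrt_less_iff) simp
  finally have s: "0 < s" by (simp add: s_def)
  have "2 * s + c = sqrt (c\<^sup>2 + 4 * \<alpha>)" by (simp add: s_def field_simps)
  then have "(2 * s + c)\<^sup>2 = c\<^sup>2 + 4 * \<alpha>" using \<alpha> by simp
  then have quad: "s\<^sup>2 + c * s = \<alpha>" by (simp add: power2_eq_square algebra_simps)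
  have I: "I_sph \<alpha> c = - (s * c) / 2 - \<alpha> / 2 * ln (\<alpha> / s\<^sup>2)"
  proof -
    have "gamma_hat \<alpha> c = - s / 2" unfolding gamma_hat_def s_def by (simp add: field_simps)
    moreover have "1 + c / s = \<alpha> / s\<^sup>2"
      using s unfolding quad[symmetric] by (simp add: field_simps power2_eq_square)
    ultimately show ?thesis by (simp add: I_sph_def)
  qed
  have small: "- c * \<rho> + ((\<alpha> / \<rho>\<^sup>2 - 1) / 2) * \<rho>\<^sup>2 - \<alpha> / 2 * ln (1 + 2 * ((\<alpha> / \<rho>\<^sup>2 - 1) / 2)) \<le> I_sph \<alpha> c"
    if \<rho>: "0 < \<rho>" for \<rho>
  proof -
    \<comment> \<open>Maximality at s: the logarithm lies below its tangent at 1, and the rest of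
      the difference is half the square of \<open>\<rho> - s\<close>.\<close>
    have "ln (\<rho> / s) \<le> \<rho> / s - 1"
      using \<rho> s by (intro ln_le_minus_one) auto
    then have "\<alpha> * ln (\<rho> / s) \<le> \<alpha> * (\<rho> / s - 1)"
      using \<alpha> by (intro mult_left_mono) auto
    also have "\<dots> = (c + s) * \<rho> - \<alpha>"
      using s unfolding quad[symmetric] by (simp add: field_simps power2_eq_square)
    finally have 1: "\<alpha> * ln (\<rho> / s) \<le> (c + s) * \<rho> - \<alpha>" .
    have 2: "\<alpha> / 2 * ln (\<alpha> / s\<^sup>2) - \<alpha> / 2 * ln (\<alpha> / \<rho>\<^sup>2) = \<alpha> * ln (\<rho> / s)"
      using s \<rho> \<alpha> by (simp add: ln_div ln_realpow algebra_simps)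
    have 3: "((\<alpha> / \<rho>\<^sup>2 - 1) / 2) * \<rho>\<^sup>2 = (\<alpha> - \<rho>\<^sup>2) / 2"
      using \<rho> by (simp add: field_simps)
    have 4: "1 + 2 * ((\<alpha> / \<rho>\<^sup>2 - 1) / 2) = \<alpha> / \<rho>\<^sup>2"
    proof -
      have "1 + 2 * ((z - 1) / 2) = z" for z :: real by (simp add: field_simps)
      then show ?thesis .
    qed
    have "0 \<le> (\<rho> - s)\<^sup>2" by simp
    then have 5: "- c * \<rho> + (\<alpha> - \<rho>\<^sup>2) / 2 + (c + s) * \<rho> - \<alpha> \<le> - (s * c) / 2"
      using quad by (simp add: power2_eq_square field_simps)
    show ?thesis
      unfolding 3 4 I using 1 2 5 by linarith
  qed
  show ?thesis
  proof (cases "\<rho>\<^sup>2 \<le> \<alpha>")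
    case True
    then have "0 \<le> (\<alpha> / \<rho>\<^sup>2 - 1) / 2" using \<rho> by simp
    with small[OF \<rho>] show ?thesis by blast
  next
    \<comment> \<open>Here the optimal \<kappa> would be negative; with 0 instead, the left side
      decreases in \<rho> and is already below the bound at \<open>sqrt \<alpha>\<close>.\<close>
    case False
    then have "sqrt \<alpha> \<le> \<rho>"
      using \<rho> \<alpha> by (intro real_le_lsqrt) auto
    then have "c * sqrt \<alpha> \<le> c * \<rho>" using c by (intro mult_left_mono) auto
    moreover have "- c * sqrt \<alpha> \<le> I_sph \<alpha> c"
      using small[of "sqrt \<alpha>"] \<alpha> by simp
    ultimately show ?thesis by (intro exI[of _ 0]) simp
  qed
qed

text \<open>No single Gaussian \<open>exp (b - \<kappa> r\<^sup>2)\<close> dominates \<open>exp (- c r)\<close> at the right rate, but the maximum of finitely many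
  does, up to \<open>exp (c D)\<close>; a finite sum does not affect exponential rates.\<close>

lemma I_sph_cover:
  fixes \<alpha> c D :: real
  assumes \<alpha>: "0 < \<alpha>" and c: "0 < c" and D: "0 < D"
  obtains L :: nat and \<kappa> b :: "nat \<Rightarrow> real"
  where "\<And>i. 0 \<le> \<kappa> i" "\<And>i. i \<le> L \<Longrightarrow> b i - \<alpha> / 2 * ln (1 + 2 * \<kappa> i) \<le> I_sph \<alpha> c + c * D"
    "\<And>r. 0 \<le> r \<Longrightarrow> \<exists>i\<le>L. - c * r \<le> b i - \<kappa> i * r\<^sup>2"
proof -
  obtain l where l: "\<And>\<rho>. 0 < \<rho> \<Longrightarrow> 0 \<le> l \<rho> \<and> - c * \<rho> + l \<rho> * \<rho>\<^sup>2 - \<alpha> / 2 * ln (1 + 2 * l \<rho>) \<le> I_sph \<alpha> c"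
    using I_sph_tangent[OF \<alpha> c] by metis
  \<comment> \<open>L is so large that \<open>- c * (L * D)\<close> is at most
    \<open>I_sph \<alpha> c\<close>: beyond \<open>L * D\<close> the constant bound of the last
    index, with \<kappa> zero, suffices.\<close>
  obtain L :: nat where L: "- I_sph \<alpha> c / (c * D) \<le> real L"
    using real_arch_simple by blast
  have cD: "0 < c * D" using c D by simp
  \<comment> \<open>Right end points of the cells of length D. The square of r is compared with that
    of the right end and the linear term with the left end; the mismatch costs
    \<open>c * D\<close>.\<close>
  define \<rho> where "\<rho> i = (real i + 1) * D" for i :: nat
  have \<rho>: "0 < \<rho> i" for i using D by (simp add: \<rho>_def)
  define \<kappa> where "\<kappa> i = (if i < L then l (\<rho> i) else 0)" for i
  define b where "b i = (if i < L then - c * \<rho> i + c * D + l (\<rho> i) * (\<rho> i)\<^sup>2 else - c * (L * D))" for i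
  show ?thesis
  proof (rule that)
    show "0 \<le> \<kappa> i" for i using l \<rho> by (simp add: \<kappa>_def)
    show "b i - \<alpha> / 2 * ln (1 + 2 * \<kappa> i) \<le> I_sph \<alpha> c + c * D" if "i \<le> L" for i
    proof (cases "i < L")
      case True
      then show ?thesis using l[OF \<rho>[of i]] by (simp add: b_def \<kappa>_def)
    next
      case False
      have "- I_sph \<alpha> c \<le> real L * (c * D)" using L cD by (simp only: pos_divide_le_eq)
      then show ?thesis using False cD by (simp add: b_def \<kappa>_def algebra_simps)
    qed
    show "\<exists>i\<le>L. - c * r \<le> b i - \<kappa> i * r\<^sup>2" if r: "0 \<le> r" for r
    proof (cases "nat \<lfloor>r / D\<rfloor> < L")
      case True
      define i where "i = nat \<lfloor>r / D\<rfloor>"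
      have i: "real i = of_int \<lfloor>r / D\<rfloor>" using r D by (simp add: i_def)
      have "r < \<rho> i"
        using real_of_int_floor_add_one_gt[of "r / D"] unfolding \<rho>_def i pos_divide_less_eq[OF D] .
      moreover have "\<rho> i - D \<le> r"
        using of_int_floor_le[of "r / D"] unfolding \<rho>_def i pos_le_divide_eq[OF D] by (simp add: algebra_simps)
      ultimately have "r\<^sup>2 \<le> (\<rho> i)\<^sup>2" "c * (\<rho> i - D) \<le> c * r"
        using r c by (auto intro: power_mono mult_left_mono)
      moreover from this(1) have "l (\<rho> i) * r\<^sup>2 \<le> l (\<rho> i) * (\<rho> i)\<^sup>2"
        using l[OF \<rho>[of i]] by (intro mult_left_mono) auto
      ultimately have "- c * r \<le> b i - \<kappa> i * r\<^sup>2"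
        using True by (simp add: b_def \<kappa>_def i_def[symmetric] algebra_simps)
      then show ?thesis using True i_def by (intro exI[of _ i]) auto
    next
      case False
      then have "real L \<le> real (nat \<lfloor>r / D\<rfloor>)" by simp
      also have "\<dots> = of_int \<lfloor>r / D\<rfloor>" using r D by simp
      finally have "real L \<le> of_int \<lfloor>r / D\<rfloor>" .
      then have "real L \<le> r / D" using of_int_floor_le[of "r / D"] by linarith
      then have "real L * D \<le> r" unfolding pos_le_divide_eq[OF D] .
      then have "c * (L * D) \<le> c * r" using c by (intro mult_left_mono) auto
      then show ?thesis by (intro exI[of _ L]) (simp add: b_def \<kappa>_def)
    qed
  qed
qed

lemma inner_le_sqrt_sum:
  fixes f g :: "'a \<Rightarrow> real"
  assumes "(\<Sum>i\<in>A. (f i)\<^sup>2) = 1"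
  shows "(\<Sum>i\<in>A. f i * g i) \<le> sqrt (\<Sum>i\<in>A. (g i)\<^sup>2)"
proof -
  have "(\<Sum>i\<in>A. f i * g i)\<^sup>2 \<le> (\<Sum>i\<in>A. (f i)\<^sup>2) * (\<Sum>i\<in>A. (g i)\<^sup>2)"
    by (rule Cauchy_Schwarz_ineq_sum)
  then show ?thesis using assms by (auto intro: real_le_rsqrt)
qed

lemma descent_cone_support_le:
  fixes w h \<sigma> :: "nat \<Rightarrow> real"
  assumes unit: "(\<Sum>j<n. (w j)\<^sup>2) = 1" and \<nu>: "0 \<le> \<nu>"
    and cone: "(\<Sum>j<n. if j \<in> S then \<sigma> j * w j else \<bar>w j\<bar>) \<le> 0"
  shows "- (\<Sum>j<n. w j * h j) \<le> sqrt (\<Sum>j<n. if j \<in> S then (h j + \<nu> * \<sigma> j)\<^sup>2 else (max 0 (\<bar>h j\<bar> - \<nu>))\<^sup>2)"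
proof -
  let ?g = "\<lambda>j. if j \<in> S then \<bar>h j + \<nu> * \<sigma> j\<bar> else max 0 (\<bar>h j\<bar> - \<nu>)"
  have "- (\<Sum>j<n. w j * h j) \<le> - (\<Sum>j<n. w j * h j) - \<nu> * (\<Sum>j<n. if j \<in> S then \<sigma> j * w j else \<bar>w j\<bar>)"
    using mult_nonneg_nonpos[OF \<nu> cone] by simp
  also have "\<dots> = (\<Sum>j<n. - (w j * h j) - \<nu> * (if j \<in> S then \<sigma> j * w j else \<bar>w j\<bar>))"
    by (simp add: sum_subtractf sum_negf sum_distrib_left)
  also have "\<dots> \<le> (\<Sum>j<n. \<bar>w j\<bar> * ?g j)"
  proof (rule sum_mono)
    fix j
    show "- (w j * h j) - \<nu> * (if j \<in> S then \<sigma> j * w j else \<bar>w j\<bar>) \<le> \<bar>w j\<bar> * ?g j"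
    proof (cases "j \<in> S")
      case True
      have "- (w j * h j) - \<nu> * (\<sigma> j * w j) = - (w j * (h j + \<nu> * \<sigma> j))" by (simp add: algebra_simps)
      also have "\<dots> \<le> \<bar>w j * (h j + \<nu> * \<sigma> j)\<bar>" by simp
      finally show ?thesis using True by (simp add: abs_mult)
    next
      case False
      have "- (w j * h j) \<le> \<bar>w j\<bar> * \<bar>h j\<bar>"
        unfolding abs_mult[symmetric] by simp
      then have "- (w j * h j) - \<nu> * \<bar>w j\<bar> \<le> \<bar>w j\<bar> * (\<bar>h j\<bar> - \<nu>)" by (simp add: algebra_simps)
      \<comment> \<open>Where the absolute value of \<open>h j\<close> is below \<nu>, the
        multiplier outweighs the coordinate, so the bound may be truncated at 0: this is the soft
        threshold.\<close>
      also have "\<dots> \<le> \<bar>w j\<bar> * max 0 (\<bar>h j\<bar> - \<nu>)" by (intro mult_left_mono) auto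
      finally show ?thesis using False by simp
    qed
  qed
  also have "\<dots> \<le> sqrt (\<Sum>j<n. (?g j)\<^sup>2)"
    using unit by (intro inner_le_sqrt_sum) simp
  also have "(\<Sum>j<n. (?g j)\<^sup>2) = (\<Sum>j<n. if j \<in> S then (h j + \<nu> * \<sigma> j)\<^sup>2 else (max 0 (\<bar>h j\<bar> - \<nu>))\<^sup>2)"
    by (intro sum.cong) auto
  finally show ?thesis .
qed

text \<open>The ball radius and the smoothing parameter are both \<open>1 / c\<close>, so on the
  event the smoothed norm is at most \<open>2 / c\<close> and the exponential loses only
  \<open>exp 2\<close>. The soft maximum contributes \<open>exp 1\<close>; together they give
  \<open>exp 3\<close>. The corner variable contributes \<open>exp (c\<^sup>2 / 2)\<close> on the
  left. The functions \<open>\<tau> j\<close> are the coordinate summands of the squared support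
  bound.\<close>

lemma gordon_small_ball:
  fixes w :: "nat \<Rightarrow> nat \<Rightarrow> real" and \<tau> :: "nat \<Rightarrow> real \<Rightarrow> real" and \<kappa> b :: "nat \<Rightarrow> real"
  assumes unit: "\<And>k. k < N \<Longrightarrow> (\<Sum>j<n. (w k j)\<^sup>2) = 1" and N: "0 < N"
    and c: "0 < c" and \<theta>: "0 < \<theta>"
    and supp: "\<And>k h. k < N \<Longrightarrow> - (\<Sum>j<n. w k j * h j) \<le> sqrt (\<Sum>j<n. \<tau> j (h j))"
    and \<tau>_nonneg: "\<And>j x. 0 \<le> \<tau> j x"
    and y: "\<And>j. j < n \<Longrightarrow> has_bochner_integral gauss (\<lambda>x. exp (\<theta> * \<tau> j x / 2)) (y j)"
    and \<kappa>: "\<And>i. 0 \<le> \<kappa> i"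
    and cover: "\<And>r. 0 \<le> r \<Longrightarrow> \<exists>i\<le>L. - c * r \<le> b i - \<kappa> i * r\<^sup>2"
  shows "measure (gauss_vec ({..m} \<times> {..n}))
      {\<xi> \<in> space (gauss_vec ({..m} \<times> {..n})). \<exists>k<N. (\<Sum>a<m. (\<Sum>j<n. w k j * \<xi> (a, j))\<^sup>2) \<le> (1 / c)\<^sup>2}
    \<le> exp 3 * exp (- c\<^sup>2 / 2 + c\<^sup>2 / (2 * \<theta>)) * (\<Prod>j<n. y j) * (\<Sum>i\<le>L. exp (b i) / sqrt (1 + 2 * \<kappa> i) ^ m)"
proof -
  let ?I = "{..m} \<times> {..n}"
  let ?G = "gauss_vec ?I"
  interpret GI: prob_space ?G by (intro prob_space_PiM prob_space_gauss)
  define B where "B = {\<xi> \<in> space ?G. \<exists>k<N. (\<Sum>a<m. (\<Sum>j<n. w k j * \<xi> (a, j))\<^sup>2) \<le> (1 / c)\<^sup>2}"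
  have [measurable]: "(\<lambda>\<xi>. \<xi> (a, j)) \<in> borel_measurable ?G" if "a \<le> m" "j \<le> n" for a j
  proof -
    have "(a, j) \<in> ?I" using that by simp
    then show ?thesis by measurable
  qed
  have m1: "(\<lambda>\<xi>. \<Sum>j<n. w k j * \<xi> (a, j)) \<in> borel_measurable ?G" if "a \<le> m" for a k
    by (rule borel_measurable_sum) (use that in \<open>auto intro!: borel_measurable_times\<close>)
  have m2 [measurable]: "(\<lambda>\<xi>. \<Sum>a<m. (\<Sum>j<n. w k j * \<xi> (a, j))\<^sup>2) \<in> borel_measurable ?G" for k
    by (rule borel_measurable_sum) (use m1 in \<open>auto intro!: borel_measurable_power\<close>)
  have B_sets [measurable]: "B \<in> sets ?G"
    unfolding B_def by measurable
  \<comment> \<open>With these choices the soft maximum over \<open>N\<close> directions costs only \<open>N powr q \<le> exp 1\<close>, uniformly in \<open>N\<close>.\<close>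
  define M where "M = c * (ln (real N) + 1)"
  define q where "q = 1 / (ln (real N) + 1)"
  have lnN: "0 \<le> ln (real N)" using N by simp
  have "0 < ln (real N) + 1" using lnN by linarith
  with lnN c have Mq: "M * q = c" "0 < M" "0 < q" "q \<le> 1"
    by (auto simp: M_def q_def)
  interpret gordon m n N w M q "1 / c"
    by unfold_locales (use unit N Mq c in auto)
  let ?X = "\<lambda>\<xi>. (\<Sum>k<N. exp (- M * (sqrt ((1 / c)\<^sup>2 + (\<Sum>a<m. (\<Sum>j<n. w k j * \<xi> (a, j))\<^sup>2)) + \<xi> (m, n)))) powr q"
  let ?Y = "\<lambda>\<xi>. (\<Sum>k<N. exp (- M * (sqrt ((1 / c)\<^sup>2 + (\<Sum>a<m. (\<xi> (a, n))\<^sup>2)) + (\<Sum>j<n. w k j * \<xi> (m, j))))) powr q"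
  let ?f = "\<lambda>\<xi>. if \<exists>k<N. (\<Sum>a<m. (\<Sum>j<n. w k j * \<xi> (a, j))\<^sup>2) \<le> (1 / c)\<^sup>2 then 1 else 0 :: real"
  have f_ind: "(\<integral>\<xi>. ?f \<xi> \<partial>?G) = measure ?G B"
  proof -
    have "(\<integral>\<xi>. ?f \<xi> \<partial>?G) = (\<integral>\<xi>. indicator B \<xi> \<partial>?G)"
      by (intro Bochner_Integration.integral_cong) (auto simp: B_def)
    then show ?thesis by simp
  qed
  have gi: "has_bochner_integral gauss (\<lambda>x. exp (- c * x)) (exp (c\<^sup>2 / 2))"
    using gauss_exp_quadratic[of 0 "- c"] by simp
  have indep: "integrable ?G (\<lambda>\<xi>. ?f \<xi> * exp (- c * \<xi> (m, n)))"
     "(\<integral>\<xi>. ?f \<xi> * exp (- c * \<xi> (m, n)) \<partial>?G) = (\<integral>\<xi>. ?f \<xi> \<partial>?G) * exp (c\<^sup>2 / 2)"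
  proof -
    have "?f \<in> borel_measurable ?G" by measurable
    moreover have "(\<Sum>a<m. (\<Sum>j<n. w k j * (\<xi>((m, n) := s)) (a, j))\<^sup>2) = (\<Sum>a<m. (\<Sum>j<n. w k j * \<xi> (a, j))\<^sup>2)" for k \<xi> s
      by (intro sum.cong) auto
    then have "?f (\<xi>((m, n) := s)) = ?f \<xi>" for \<xi> s by simp
    ultimately show "integrable ?G (\<lambda>\<xi>. ?f \<xi> * exp (- c * \<xi> (m, n)))"
      "(\<integral>\<xi>. ?f \<xi> * exp (- c * \<xi> (m, n)) \<partial>?G) = (\<integral>\<xi>. ?f \<xi> \<partial>?G) * exp (c\<^sup>2 / 2)"
      using gauss_vec_integral_indep[of ?I "(m, n)" ?f "\<lambda>x. exp (- c * x)"] gi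
      by (auto simp: has_bochner_integral_iff)
  qed
  have X_ge: "exp (- 2) * (?f \<xi> * exp (- c * \<xi> (m, n))) \<le> ?X \<xi>" for \<xi>
  proof (cases "\<exists>k<N. (\<Sum>a<m. (\<Sum>j<n. w k j * \<xi> (a, j))\<^sup>2) \<le> (1 / c)\<^sup>2")
    case True
    then obtain k where k: "k < N" "(\<Sum>a<m. (\<Sum>j<n. w k j * \<xi> (a, j))\<^sup>2) \<le> (1 / c)\<^sup>2" by auto
    let ?s = "sqrt ((1 / c)\<^sup>2 + (\<Sum>a<m. (\<Sum>j<n. w k j * \<xi> (a, j))\<^sup>2))"
    have "(1 / c)\<^sup>2 + (\<Sum>a<m. (\<Sum>j<n. w k j * \<xi> (a, j))\<^sup>2) \<le> (2 / c)\<^sup>2"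
    proof -
      have "(2 / c)\<^sup>2 = 4 * (1 / c)\<^sup>2" by (simp add: power_divide)
      then show ?thesis using k(2) zero_le_power2[of "1 / c"] by linarith
    qed
    then have "?s \<le> 2 / c"
      using c by (intro real_le_lsqrt) (auto simp: sum_nonneg)
    then have "c * ?s \<le> 2" using c by (simp add: field_simps)
    then have "exp (- 2) * exp (- c * \<xi> (m, n)) \<le> exp (- (M * q) * (?s + \<xi> (m, n)))"
      unfolding Mq by (simp add: algebra_simps flip: exp_add)
    also have "\<dots> = exp (- M * (?s + \<xi> (m, n))) powr q"
      by (simp add: powr_def mult_ac)
    also have "\<dots> \<le> ?X \<xi>"
      using k(1) Mq by (intro powr_mono2 member_le_sum[of k "{..<N}" "\<lambda>k. exp (- M * (sqrt ((1 / c)\<^sup>2 + (\<Sum>a<m. (\<Sum>j<n. w k j * \<xi> (a, j))\<^sup>2)) + \<xi> (m, n)))"]) auto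
    finally show ?thesis using True by simp
  next
    case False
    then have "?f \<xi> = 0" by (rule if_not_P)
    then show ?thesis by (simp only: mult_zero_left mult_zero_right powr_ge_zero)
  qed
  have "exp (- 2) * (measure ?G B * exp (c\<^sup>2 / 2)) = (\<integral>\<xi>. exp (- 2) * (?f \<xi> * exp (- c * \<xi> (m, n))) \<partial>?G)"
    using indep f_ind by simp
  also have "\<dots> \<le> (\<integral>\<xi>. ?X \<xi> \<partial>?G)"
    by (intro integral_mono X_ge integrable_mult_right indep gordon_comparison)
  also have "\<dots> \<le> (\<integral>\<xi>. ?Y \<xi> \<partial>?G)"
    by (rule gordon_comparison)
  finally have lower: "exp (- 2) * (measure ?G B * exp (c\<^sup>2 / 2)) \<le> (\<integral>\<xi>. ?Y \<xi> \<partial>?G)" .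

  \<comment> \<open>The dominating function is a sum over i of products over single entries: the
    last column carries \<open>exp (- \<kappa> i * x\<^sup>2)\<close>, the last row carries
    \<open>exp (\<theta> * \<tau> j x / 2)\<close>, and the block and the corner carry 1. Its
    expectation therefore factorizes.\<close>
  define \<phi> where "\<phi> i = (\<lambda>(a, j) x. if a < m \<and> j = n then exp (- \<kappa> i * x\<^sup>2)
    else if a = m \<and> j < n then exp (\<theta> * \<tau> j x / 2) else 1 :: real)" for i :: nat
  define v where "v i = (\<lambda>(a, j). if a < m \<and> j = n then 1 / sqrt (1 + 2 * \<kappa> i)
    else if a = m \<and> j < n then y j else 1 :: real)" for i :: nat
  have prod_I: "(\<Prod>p\<in>?I. (case p of (a, j) \<Rightarrow> if a < m \<and> j = n then f a else if a = m \<and> j < n then g j else 1)) = (\<Prod>a<m. f a) * (\<Prod>j<n. g j)"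
    for f g :: "nat \<Rightarrow> real"
  proof -
    have "(\<Prod>p\<in>?I. (case p of (a, j) \<Rightarrow> if a < m \<and> j = n then f a else if a = m \<and> j < n then g j else 1))
      = (\<Prod>a\<le>m. \<Prod>j\<le>n. if a < m \<and> j = n then f a else if a = m \<and> j < n then g j else 1)"
      by (simp add: prod.cartesian_product case_prod_beta')
    also have "\<dots> = (\<Prod>a\<le>m. if a < m then f a else \<Prod>j<n. g j)"
    proof (intro prod.cong refl)
      fix a assume "a \<in> {..m}"
      then show "(\<Prod>j\<le>n. if a < m \<and> j = n then f a else if a = m \<and> j < n then g j else 1) = (if a < m then f a else \<Prod>j<n. g j)"
        by (cases "a < m") (auto simp flip: lessThan_Suc_atMost)
    qed
    finally show ?thesis by (simp flip: lessThan_Suc_atMost)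
  qed
  have gl: "has_bochner_integral gauss (\<lambda>x. exp (- \<kappa> i * x\<^sup>2)) (1 / sqrt (1 + 2 * \<kappa> i))" for i
    using gauss_exp_quadratic[of "- 2 * \<kappa> i" 0] \<kappa>[of i] by simp
  have g1: "has_bochner_integral gauss (\<lambda>x. 1) (1::real)"
    using prob_space.prob_space[OF prob_space_gauss] finite_measure.integrable_const[OF prob_space.finite_measure[OF prob_space_gauss]]
    by (simp add: has_bochner_integral_iff)
  have \<phi>_int: "has_bochner_integral ?G (\<lambda>\<xi>. \<Prod>p\<in>?I. \<phi> i p (\<xi> p)) (\<Prod>p\<in>?I. v i p)" for i
    by (rule has_bochner_integral_gauss_vec_prod) (use gl g1 y in \<open>auto simp: \<phi>_def v_def\<close>)
  have \<phi>_prod: "(\<Prod>p\<in>?I. \<phi> i p (\<xi> p)) = exp (- \<kappa> i * (\<Sum>a<m. (\<xi> (a, n))\<^sup>2)) * exp (\<theta> / 2 * (\<Sum>j<n. \<tau> j (\<xi> (m, j))))" for i \<xi>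
  proof -
    have "(\<Prod>p\<in>?I. \<phi> i p (\<xi> p)) = (\<Prod>p\<in>?I. (case p of (a, j) \<Rightarrow> if a < m \<and> j = n then exp (- \<kappa> i * (\<xi> (a, n))\<^sup>2)
      else if a = m \<and> j < n then exp (\<theta> * \<tau> j (\<xi> (m, j)) / 2) else 1))"
      by (intro prod.cong) (auto simp: \<phi>_def)
    also have "\<dots> = (\<Prod>a<m. exp (- \<kappa> i * (\<xi> (a, n))\<^sup>2)) * (\<Prod>j<n. exp (\<theta> * \<tau> j (\<xi> (m, j)) / 2))"
      by (rule prod_I)
    finally show ?thesis by (simp add: exp_sum sum_distrib_left)
  qed
  have v_prod: "(\<Prod>p\<in>?I. v i p) = 1 / sqrt (1 + 2 * \<kappa> i) ^ m * (\<Prod>j<n. y j)" for i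
    unfolding v_def by (subst prod_I) (simp add: power_divide)
  let ?U = "\<lambda>\<xi>. \<Sum>i\<le>L. exp (1 + c\<^sup>2 / (2 * \<theta>) + b i) * (\<Prod>p\<in>?I. \<phi> i p (\<xi> p))"
  have Y_le: "?Y \<xi> \<le> ?U \<xi>" for \<xi>
  proof -
    define r where "r = sqrt (\<Sum>a<m. (\<xi> (a, n))\<^sup>2)"
    define T where "T = (\<Sum>j<n. \<tau> j (\<xi> (m, j)))"
    have r0: "0 \<le> r" by (simp add: r_def sum_nonneg)
    have T0: "0 \<le> T" by (simp add: T_def sum_nonneg \<tau>_nonneg)
    have r2: "r\<^sup>2 = (\<Sum>a<m. (\<xi> (a, n))\<^sup>2)" by (simp add: r_def sum_nonneg)
    have "exp (- M * (sqrt ((1 / c)\<^sup>2 + (\<Sum>a<m. (\<xi> (a, n))\<^sup>2)) + (\<Sum>j<n. w k j * \<xi> (m, j)))) \<le> exp (M * (sqrt T - r))"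
      if "k < N" for k
    proof -
      have "r \<le> sqrt ((1 / c)\<^sup>2 + (\<Sum>a<m. (\<xi> (a, n))\<^sup>2))" by (simp add: r_def)
      moreover have "- (\<Sum>j<n. w k j * \<xi> (m, j)) \<le> sqrt T"
        using supp[OF that, of "\<lambda>j. \<xi> (m, j)"] by (simp add: T_def)
      ultimately have "M * - (sqrt ((1 / c)\<^sup>2 + (\<Sum>a<m. (\<xi> (a, n))\<^sup>2)) + (\<Sum>j<n. w k j * \<xi> (m, j))) \<le> M * (sqrt T - r)"
        using Mq by (intro mult_left_mono) auto
      then show ?thesis
        by (simp only: exp_le_cancel_iff mult_minus_left mult_minus_right)
    qed
    then have "?Y \<xi> \<le> (real N * exp (M * (sqrt T - r))) powr q"
      using Mq sum_bounded_above[of "{..<N}" _ "exp (M * (sqrt T - r))"] by (intro powr_mono2 sum_nonneg) auto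
    also have "\<dots> = exp (q * ln (real N)) * exp (M * q * (sqrt T - r))"
      using N by (simp add: powr_mult powr_def[of "real N"] powr_def[of "exp _"] mult_ac)
    also have "\<dots> \<le> exp 1 * exp (M * q * (sqrt T - r))"
      using lnN by (intro mult_right_mono) (auto simp: q_def)
    also have "\<dots> = exp (1 + c * sqrt T - c * r)"
      unfolding Mq by (simp add: algebra_simps flip: exp_add)
    also have "\<dots> \<le> exp (1 + (c\<^sup>2 / (2 * \<theta>) + \<theta> / 2 * T) - c * r)"
    proof -
      have "0 \<le> (c / \<theta> - sqrt T)\<^sup>2 * (\<theta> / 2)" using \<theta> by simp
      also have "\<dots> = c\<^sup>2 / (2 * \<theta>) + \<theta> / 2 * T - c * sqrt T"
        using \<theta> T0 by (simp add: power2_diff power_divide field_simps) (simp add: power2_eq_square)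
      finally show ?thesis by simp
    qed
    also have "\<dots> \<le> ?U \<xi>"
    proof -
      obtain i where i: "i \<le> L" "- c * r \<le> b i - \<kappa> i * r\<^sup>2" using cover[OF r0] by auto
      have "exp (1 + (c\<^sup>2 / (2 * \<theta>) + \<theta> / 2 * T) - c * r) \<le> exp ((1 + c\<^sup>2 / (2 * \<theta>) + b i) + (- \<kappa> i * r\<^sup>2 + \<theta> / 2 * T))"
        using i by simp
      also have "\<dots> = exp (1 + c\<^sup>2 / (2 * \<theta>) + b i) * (\<Prod>p\<in>?I. \<phi> i p (\<xi> p))"
        unfolding \<phi>_prod r2[symmetric] T_def[symmetric] exp_add[symmetric] ..
      also have "\<dots> \<le> ?U \<xi>"
        using i(1) by (intro member_le_sum[of i "{..L}" "\<lambda>i. exp (1 + c\<^sup>2 / (2 * \<theta>) + b i) * (\<Prod>p\<in>?I. \<phi> i p (\<xi> p))"]) (auto simp: \<phi>_prod)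
      finally show ?thesis .
    qed
    finally show ?thesis .
  qed
  have U_int: "has_bochner_integral ?G ?U (\<Sum>i\<le>L. exp (1 + c\<^sup>2 / (2 * \<theta>) + b i) * (1 / sqrt (1 + 2 * \<kappa> i) ^ m * (\<Prod>j<n. y j)))"
    unfolding v_prod[symmetric] by (intro has_bochner_integral_sum has_bochner_integral_mult_right \<phi>_int)
  \<comment> \<open>\<open>integral_mono'\<close> asks for integrability of the upper side alone; a
    non-integrable function would have integral 0 by default, which is consistent with the
    bound.\<close>
  have "(\<integral>\<xi>. ?Y \<xi> \<partial>?G) \<le> (\<integral>\<xi>. ?U \<xi> \<partial>?G)"
  proof (rule integral_mono')
    show "integrable ?G ?U" using U_int by (rule integrable.intros)
    show "0 \<le> ?U \<xi>" for \<xi> by (rule order_trans[OF _ Y_le]) simp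
  qed (rule Y_le)
  also have "(\<integral>\<xi>. ?U \<xi> \<partial>?G) = (\<Sum>i\<le>L. exp (1 + c\<^sup>2 / (2 * \<theta>) + b i) * (1 / sqrt (1 + 2 * \<kappa> i) ^ m * (\<Prod>j<n. y j)))"
    using U_int by (rule has_bochner_integral_integral_eq)
  also have "\<dots> = exp (1 + c\<^sup>2 / (2 * \<theta>)) * ((\<Prod>j<n. y j) * (\<Sum>i\<le>L. exp (b i) / sqrt (1 + 2 * \<kappa> i) ^ m))"
    by (simp add: exp_add sum_distrib_left mult_ac)
  finally have upper: "exp (- 2) * (measure ?G B * exp (c\<^sup>2 / 2)) \<le> exp (1 + c\<^sup>2 / (2 * \<theta>)) * ((\<Prod>j<n. y j) * (\<Sum>i\<le>L. exp (b i) / sqrt (1 + 2 * \<kappa> i) ^ m))"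
    (is "_ \<le> _ * ?R") using lower by linarith
  have "measure ?G B = exp (2 - c\<^sup>2 / 2) * (exp (- 2) * (measure ?G B * exp (c\<^sup>2 / 2)))"
    by (simp add: exp_diff exp_minus)
  also have "\<dots> \<le> exp (2 - c\<^sup>2 / 2) * (exp (1 + c\<^sup>2 / (2 * \<theta>)) * ?R)"
    using upper by (rule mult_left_mono) simp
  also have "\<dots> = exp ((2 - c\<^sup>2 / 2) + (1 + c\<^sup>2 / (2 * \<theta>))) * ?R"
    by (simp only: exp_add mult.assoc)
  also have "(2 - c\<^sup>2 / 2) + (1 + c\<^sup>2 / (2 * \<theta>)) = 3 + (- c\<^sup>2 / 2 + c\<^sup>2 / (2 * \<theta>))" by simp
  finally show ?thesis unfolding B_def exp_add by (simp add: mult.assoc)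
qed

subsection \<open>The failure probability\<close>

text \<open>With S the support and \<sigma> the signs of x, the second condition says that the
  one-sided directional derivative of the \<open>l1_norm\<close> at x along w is nonpositive.
  Directions are functions, with values from n on left free, so that the product topology supplies a
  countable dense subset.\<close>

definition descent_sphere :: "nat \<Rightarrow> nat set \<Rightarrow> (nat \<Rightarrow> real) \<Rightarrow> (nat \<Rightarrow> real) set"
  where "descent_sphere n S \<sigma> = {w. (\<Sum>j<n. (w j)\<^sup>2) = 1 \<and> (\<Sum>j<n. if j \<in> S then \<sigma> j * w j else \<bar>w j\<bar>) \<le> 0}"

text \<open>Failure means a second minimizer or a strictly better point; either way some z other
  than x has the same image and no larger norm. Convexity of the absolute value bounds the
  directional derivative along \<open>z - x\<close> by the difference of the norms, and normalizing
  \<open>z - x\<close> gives w.\<close>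

lemma recovery_failure_direction:
  fixes A :: "real mat" and x :: "real vec"
  assumes A: "A \<in> carrier_mat m n" and x: "x \<in> carrier_vec n"
    and fail: "l1_solutions A (A *\<^sub>v x) \<noteq> {x}"
  shows "\<exists>w \<in> descent_sphere n {j. j < n \<and> x $ j \<noteq> 0} (\<lambda>j. sgn (x $ j)). \<forall>a<m. (\<Sum>j<n. w j * A $$ (a, j)) = 0"
proof -
  have dims: "dim_col A = n" "dim_row A = m" "dim_vec x = n" using A x by auto
  obtain z where z: "z \<in> carrier_vec n" "z \<noteq> x" "A *\<^sub>v z = A *\<^sub>v x" "l1_norm z \<le> l1_norm x"
  proof (cases "x \<in> l1_solutions A (A *\<^sub>v x)")
    case True
    with fail obtain z where "z \<in> l1_solutions A (A *\<^sub>v x)" "z \<noteq> x" by auto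
    then show ?thesis using that x by (auto simp: l1_solutions_def dims)
  next
    case False
    then obtain z where "z \<in> carrier_vec n" "A *\<^sub>v z = A *\<^sub>v x" "\<not> l1_norm x \<le> l1_norm z"
      using x by (auto simp: l1_solutions_def dims)
    then show ?thesis using that by force
  qed
  define u where "u j = z $ j - x $ j" for j
  define U where "U = (\<Sum>j<n. (u j)\<^sup>2)"
  have dz: "dim_vec z = n" using z by auto
  have "0 < U"
  proof -
    obtain j where "j < n" "u j \<noteq> 0"
      using z(2) dz dims(3) by (auto simp: u_def vec_eq_iff)
    then show ?thesis
      unfolding U_def by (intro sum_pos2[of _ j]) auto
  qed
  define w where "w j = u j / sqrt U" for j
  have Au: "(\<Sum>j<n. u j * A $$ (a, j)) = 0" if "a < m" for a
  proof -
    have "(A *\<^sub>v v) $ a = (\<Sum>j<n. A $$ (a, j) * v $ j)" if "v \<in> carrier_vec n" for v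
      using that \<open>a < m\<close> dims by (simp add: scalar_prod_def lessThan_atLeast0)
    from this[OF z(1)] this[OF x] z(3) show ?thesis
      by (simp add: u_def algebra_simps sum_subtractf)
  qed
  have cone: "(\<Sum>j<n. if j \<in> {j. j < n \<and> x $ j \<noteq> 0} then sgn (x $ j) * u j else \<bar>u j\<bar>) \<le> 0"
  proof -
    have "(\<Sum>j<n. if j \<in> {j. j < n \<and> x $ j \<noteq> 0} then sgn (x $ j) * u j else \<bar>u j\<bar>) \<le> (\<Sum>j<n. \<bar>z $ j\<bar> - \<bar>x $ j\<bar>)"
      by (intro sum_mono) (auto simp: u_def sgn_real_def abs_if)
    also have "\<dots> = l1_norm z - l1_norm x"
      by (simp add: l1_norm_def dz dims sum_subtractf)
    finally show ?thesis using z(4) by simp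
  qed
  have "(\<Sum>j<n. (w j)\<^sup>2) = U / U"
    using \<open>0 < U\<close> by (simp add: w_def power_divide U_def[symmetric] flip: sum_divide_distrib)
  moreover have "(\<Sum>j<n. if j \<in> {j. j < n \<and> x $ j \<noteq> 0} then sgn (x $ j) * w j else \<bar>w j\<bar>) =
      (\<Sum>j<n. if j \<in> {j. j < n \<and> x $ j \<noteq> 0} then sgn (x $ j) * u j else \<bar>u j\<bar>) / sqrt U"
    using \<open>0 < U\<close> by (simp add: w_def sum_divide_distrib) (intro sum.cong, auto simp: w_def)
  moreover have "\<dots> \<le> 0"
    using cone \<open>0 < U\<close> by (intro divide_nonpos_pos) auto
  ultimately have "w \<in> descent_sphere n {j. j < n \<and> x $ j \<noteq> 0} (\<lambda>j. sgn (x $ j))"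
    using \<open>0 < U\<close> by (simp add: descent_sphere_def)
  moreover have "(\<Sum>j<n. w j * A $$ (a, j)) = 0" if "a < m" for a
  proof -
    have "(\<Sum>j<n. w j * A $$ (a, j)) = (\<Sum>j<n. u j * A $$ (a, j)) / sqrt U"
      by (simp add: w_def sum_divide_distrib)
    then show ?thesis using Au[OF that] by simp
  qed
  ultimately show ?thesis by blast
qed

text \<open>Carries the abstract random matrix to the canonical product space on which the
  comparison lives.\<close>

lemma distr_std_normal_matrix:
  assumes A: "std_normal_matrix M m n A" and mn: "0 < m" "0 < n"
  defines "I \<equiv> {..<m} \<times> {..<n}"
  shows "(\<lambda>\<omega>. \<lambda>ij\<in>I. A \<omega> $$ ij) \<in> M \<rightarrow>\<^sub>M gauss_vec I"
    and "distr M (gauss_vec I) (\<lambda>\<omega>. \<lambda>ij\<in>I. A \<omega> $$ ij) = gauss_vec I"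
proof -
  interpret prob_space M using A by (simp add: std_normal_matrix_def)
  have I: "I \<noteq> {}" using mn by (auto simp: I_def)
  have indep: "indep_vars (\<lambda>_. borel) (\<lambda>ij \<omega>. A \<omega> $$ ij) I"
    and dist: "\<And>ij. ij \<in> I \<Longrightarrow> distributed M lborel (\<lambda>\<omega>. A \<omega> $$ ij) std_normal_density"
    using A by (auto simp: std_normal_matrix_def I_def)
  have rv: "(\<lambda>\<omega>. A \<omega> $$ ij) \<in> borel_measurable M" if "ij \<in> I" for ij
    using distributed_measurable[OF dist[OF that]] by simp
  have sets: "sets (gauss_vec I) = sets (Pi\<^sub>M I (\<lambda>_. borel))"
    by (intro sets_PiM_cong) auto
  have "distr M borel (\<lambda>\<omega>. A \<omega> $$ ij) = gauss" if "ij \<in> I" for ij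
  proof -
    have "distr M borel (\<lambda>\<omega>. A \<omega> $$ ij) = distr M lborel (\<lambda>\<omega>. A \<omega> $$ ij)"
      by (rule distr_cong) auto
    then show ?thesis using distributed_distr_eq_density[OF dist[OF that]] by (simp add: gauss_def)
  qed
  then have "(\<Pi>\<^sub>M ij\<in>I. distr M borel (\<lambda>\<omega>. A \<omega> $$ ij)) = gauss_vec I"
    by (intro PiM_cong) auto
  moreover have "distr M (\<Pi>\<^sub>M i\<in>I. borel) (\<lambda>\<omega>. \<lambda>ij\<in>I. A \<omega> $$ ij) = (\<Pi>\<^sub>M ij\<in>I. distr M borel (\<lambda>\<omega>. A \<omega> $$ ij))"
    using indep_vars_iff_distr_eq_PiM'[OF I rv] indep by simp
  moreover have "distr M (\<Pi>\<^sub>M i\<in>I. borel) (\<lambda>\<omega>. \<lambda>ij\<in>I. A \<omega> $$ ij) = distr M (gauss_vec I) (\<lambda>\<omega>. \<lambda>ij\<in>I. A \<omega> $$ ij)"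
    using sets by (intro distr_cong) auto
  ultimately show "distr M (gauss_vec I) (\<lambda>\<omega>. \<lambda>ij\<in>I. A \<omega> $$ ij) = gauss_vec I" by simp
  show "(\<lambda>\<omega>. \<lambda>ij\<in>I. A \<omega> $$ ij) \<in> M \<rightarrow>\<^sub>M gauss_vec I"
    by (rule measurable_restrict) (use rv in auto)
qed

text \<open>A kernel vector of \<open>A\<close> on the descent sphere forces \<open>A\<close> to be small on every countable dense subset, so finitely
  many directions at a time suffice.\<close>

lemma P_err_le_small_ball:
  fixes x :: "real vec"
  assumes A: "std_normal_matrix M m n A" and mn: "0 < m" "0 < n" and x: "x \<in> carrier_vec n"
    and \<delta>: "0 < \<delta>" and B: "0 \<le> B"
    and bound: "\<And>(N :: nat) w. 0 < N \<Longrightarrow> (\<And>k. k < N \<Longrightarrow> w k \<in> descent_sphere n {j. j < n \<and> x $ j \<noteq> 0} (\<lambda>j. sgn (x $ j))) \<Longrightarrow>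
      measure (gauss_vec ({..m} \<times> {..n}))
        {\<xi> \<in> space (gauss_vec ({..m} \<times> {..n})). \<exists>k<N. (\<Sum>a<m. (\<Sum>j<n. w k j * \<xi> (a, j))\<^sup>2) \<le> \<delta>\<^sup>2} \<le> B"
  shows "P_err M A x \<le> B"
proof -
  interpret Om: prob_space M using A by (simp add: std_normal_matrix_def)
  let ?W = "descent_sphere n {j. j < n \<and> x $ j \<noteq> 0} (\<lambda>j. sgn (x $ j))"
  let ?I = "{..<m} \<times> {..<n}" and ?I' = "{..m} \<times> {..n}"
  let ?A = "\<lambda>\<omega>. \<lambda>ij\<in>?I. A \<omega> $$ ij"
  interpret product_prob_space "\<lambda>_ :: nat \<times> nat. gauss" "?I'" by (rule product_prob_space_gauss)
  note law = distr_std_normal_matrix[OF A mn]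
  have Ac: "A \<omega> \<in> carrier_mat m n" if "\<omega> \<in> space M" for \<omega>
    using A that by (simp add: std_normal_matrix_def)
  obtain D where D: "countable D" "D \<subseteq> ?W" "?W \<subseteq> closure D" by (rule separable)
  show ?thesis
  proof (cases "D = {}")
    case True
    then have "?W = {}" using D by simp
    then have "{\<omega> \<in> space M. l1_solutions (A \<omega>) (A \<omega> *\<^sub>v x) \<noteq> {x}} = {}"
      using recovery_failure_direction[OF Ac x] by auto
    then show ?thesis unfolding P_err_def using B by (simp only: measure_empty)
  next
    case False
    \<comment> \<open>An enumeration needs D nonempty; otherwise the descent sphere is empty as well
      and recovery never fails.\<close>
    define w where "w = from_nat_into D"
    have w: "range w = D" using D(1) False by (simp add: w_def range_from_nat_into)
    define f where "f v \<xi> = (\<Sum>a<m. (\<Sum>j<n. v j * \<xi> (a, j))\<^sup>2)" for v :: "nat \<Rightarrow> real" and \<xi> :: "nat \<times> nat \<Rightarrow> real"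
    define C where "C N = {\<omega> \<in> space M. \<exists>k<Suc N. f (w k) (?A \<omega>) \<le> \<delta>\<^sup>2}" for N
    have comp [measurable]: "(\<lambda>\<xi>. \<xi> (a, j)) \<in> borel_measurable (gauss_vec I)" if "(a, j) \<in> I" for a j and I :: "(nat \<times> nat) set"
      using that by measurable
    have f_meas: "f v \<in> borel_measurable (gauss_vec I)" if "?I \<subseteq> I" for v and I :: "(nat \<times> nat) set"
      unfolding f_def[abs_def]
      by (intro borel_measurable_sum borel_measurable_power borel_measurable_times comp)
         (use that in auto)
    have set_meas: "{\<xi> \<in> space (gauss_vec I). \<exists>k<Suc N. f (w k) \<xi> \<le> \<delta>\<^sup>2} \<in> sets (gauss_vec I)"
      if "?I \<subseteq> I" for N and I :: "(nat \<times> nat) set"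
    proof -
      note f_meas[OF that, measurable]
      show ?thesis by measurable
    qed
    have C_eq: "C N = ?A -` {\<xi> \<in> space (gauss_vec ?I). \<exists>k<Suc N. f (w k) \<xi> \<le> \<delta>\<^sup>2} \<inter> space M" for N
      using measurable_space[OF law(1)] by (auto simp: C_def)
    have C_sets: "C N \<in> sets M" for N
      unfolding C_eq by (rule measurable_sets[OF law(1) set_meas]) auto
    have C_le: "measure M (C N) \<le> B" for N
    proof -
      define E where "E = {\<xi> \<in> space (gauss_vec ?I). \<exists>k<Suc N. f (w k) \<xi> \<le> \<delta>\<^sup>2}"
      have E_sets: "E \<in> sets (gauss_vec ?I)" unfolding E_def by (rule set_meas) simp
      have "measure M (C N) = measure (distr M (gauss_vec ?I) ?A) E"
        unfolding C_eq E_def[symmetric] by (rule measure_distr[symmetric, OF law(1) E_sets])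
      also have "\<dots> = measure (gauss_vec ?I) E"
        by (simp only: law(2))
      \<comment> \<open>The matrix law is a marginal of the larger vector, whose extra row and
        column hold the comparison variables.\<close>
      also have "\<dots> = measure (distr (gauss_vec ?I') (gauss_vec ?I) (\<lambda>\<xi>. restrict \<xi> ?I)) E"
        by (rule arg_cong[where f = "\<lambda>\<mu>. measure \<mu> E"], rule distr_restrict) auto
      also have "\<dots> = measure (gauss_vec ?I') ((\<lambda>\<xi>. restrict \<xi> ?I) -` E \<inter> space (gauss_vec ?I'))"
        by (intro measure_distr E_sets measurable_restrict_subset) auto
      also have "(\<lambda>\<xi>. restrict \<xi> ?I) -` E \<inter> space (gauss_vec ?I') =
          {\<xi> \<in> space (gauss_vec ?I'). \<exists>k<Suc N. f (w k) \<xi> \<le> \<delta>\<^sup>2}"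
      proof -
        have "f v (restrict \<xi> ?I) = f v \<xi>" for v \<xi>
          unfolding f_def by (intro sum.cong refl arg_cong[where f = "\<lambda>x. x\<^sup>2"]) auto
        then show ?thesis by (auto simp: E_def space_PiM)
      qed
      also have "measure (gauss_vec ?I') \<dots> \<le> B"
        unfolding f_def by (rule bound) (use w D(2) in auto)
      finally show ?thesis .
    qed
    have "incseq C"
      unfolding incseq_def C_def by (auto intro: less_le_trans)
    then have "(\<lambda>N. measure M (C N)) \<longlonglongrightarrow> measure M (\<Union>N. C N)"
      using C_sets by (intro Om.finite_Lim_measure_incseq) auto
    then have "measure M (\<Union>N. C N) \<le> B"
      by (rule LIMSEQ_le_const2) (use C_le in auto)
    moreover have "{\<omega> \<in> space M. l1_solutions (A \<omega>) (A \<omega> *\<^sub>v x) \<noteq> {x}} \<subseteq> (\<Union>N. C N)"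
    proof
      fix \<omega> assume "\<omega> \<in> {\<omega> \<in> space M. l1_solutions (A \<omega>) (A \<omega> *\<^sub>v x) \<noteq> {x}}"
      then have \<omega>: "\<omega> \<in> space M" "l1_solutions (A \<omega>) (A \<omega> *\<^sub>v x) \<noteq> {x}" by auto
      obtain v where v: "v \<in> ?W" "\<And>a. a < m \<Longrightarrow> (\<Sum>j<n. v j * A \<omega> $$ (a, j)) = 0"
        using recovery_failure_direction[OF Ac[OF \<omega>(1)] x \<omega>(2)] by auto
      have "(\<Sum>j<n. v j * ?A \<omega> (a, j)) = (\<Sum>j<n. v j * A \<omega> $$ (a, j))" if "a < m" for a
        using that by (intro sum.cong) auto
      then have fv: "f v (?A \<omega>) = 0"
        unfolding f_def using v(2) by simp
      \<comment> \<open>The size of the image is continuous in the direction and vanishes at v, so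
        it stays below the threshold at some member of the dense set.\<close>
      have "open {v. f v (?A \<omega>) < \<delta>\<^sup>2}"
        unfolding f_def
        by (intro open_Collect_less continuous_intros continuous_on_product_coordinates)
      moreover have "v \<in> {v. f v (?A \<omega>) < \<delta>\<^sup>2} \<inter> closure D"
        using fv \<delta> v(1) D(3) by auto
      ultimately have "{v. f v (?A \<omega>) < \<delta>\<^sup>2} \<inter> D \<noteq> {}"
        using open_Int_closure_eq_empty by blast
      then obtain k where "f (w k) (?A \<omega>) < \<delta>\<^sup>2"
        using w by auto
      then have "\<omega> \<in> C k"
        using \<omega>(1) by (auto simp: C_def intro!: exI[of _ k])
      then show "\<omega> \<in> (\<Union>N. C N)" by auto
    qed
    \<comment> \<open>Monotonicity of the measure asks for measurability of the larger set, so the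
      estimate applies to the failure event as it stands.\<close>
    moreover have "(\<Union>N. C N) \<in> sets M" using C_sets by auto
    ultimately show ?thesis
      unfolding P_err_def using Om.finite_measure_mono by (meson order_trans)
  qed
qed

lemma exp_inverse_power_le:
  assumes "0 \<le> \<kappa>" "real m = \<alpha> * real n" "b - \<alpha> / 2 * ln (1 + 2 * \<kappa>) \<le> C"
  shows "exp (real n * b) / sqrt (1 + 2 * \<kappa>) ^ m \<le> exp (real n * C)"
proof -
  have "sqrt (1 + 2 * \<kappa>) ^ m = exp (real m * ln (sqrt (1 + 2 * \<kappa>)))"
    using assms(1) by (simp add: exp_of_nat_mult)
  also have "real m * ln (sqrt (1 + 2 * \<kappa>)) = real n * (\<alpha> / 2 * ln (1 + 2 * \<kappa>))"
    using assms(1,2) by (simp add: ln_sqrt)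
  finally have "exp (real n * b) / sqrt (1 + 2 * \<kappa>) ^ m = exp (real n * (b - \<alpha> / 2 * ln (1 + 2 * \<kappa>)))"
    by (simp add: right_diff_distrib exp_diff)
  then show ?thesis using assms(3) by (simp add: mult_left_mono)
qed

lemma w1_pos: "0 < w1 c \<nu> \<gamma>" if "0 \<le> \<nu>" "0 < 1 - c / (2 * \<gamma>)"
  unfolding w1_def using that strict_mono_less_eq[OF strict_mono_erf, of 0 "\<nu> / sqrt 2"]
  by (intro add_pos_nonneg mult_pos_pos erfc_pos divide_pos_pos) auto

lemma w2_pos: "0 < w2 c \<nu> \<gamma>" if "0 < 1 - c / (2 * \<gamma>)"
  unfolding w2_def using that by (intro divide_pos_pos) auto

text \<open>L is fixed before n, the matrix and the signal, so it contributes nothing to the rate. D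
  is the mesh of the cover of \<open>exp (- c * r)\<close> and costs \<open>c * D\<close> in the
  exponent.\<close>

lemma P_err_exponential_bound:
  fixes \<alpha> \<beta> c \<nu> \<gamma> D :: real
  assumes \<alpha>: "0 < \<alpha>" and c: "0 < c" and \<nu>: "0 \<le> \<nu>" and \<gamma>: "c / 2 < \<gamma>" and D: "0 < D"
  obtains L :: real where "0 < L" and
    "\<And>n k m x (M :: 'w measure) A. 0 < n \<Longrightarrow> real k = \<beta> * real n \<Longrightarrow> real m = \<alpha> * real n \<Longrightarrow>
       std_normal_matrix M m n A \<Longrightarrow> x \<in> carrier_vec n \<Longrightarrow> k_sparse k x \<Longrightarrow>
       P_err M A x \<le> L * exp (real n * (objective \<alpha> \<beta> c \<nu> \<gamma> + c * D))"
proof -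
  obtain L :: nat and \<kappa> b :: "nat \<Rightarrow> real"
    where \<kappa>: "\<And>i. 0 \<le> \<kappa> i" and b: "\<And>i. i \<le> L \<Longrightarrow> b i - \<alpha> / 2 * ln (1 + 2 * \<kappa> i) \<le> I_sph \<alpha> c + c * D"
    and cover: "\<And>r. 0 \<le> r \<Longrightarrow> \<exists>i\<le>L. - c * r \<le> b i - \<kappa> i * r\<^sup>2"
    using I_sph_cover[OF \<alpha> c D] by metis
  have \<gamma>0: "0 < \<gamma>" using c \<gamma> by simp
  \<comment> \<open>With this value and \<open>C\<^sup>2 = c\<^sup>2 * real n\<close>, the
    decoupling cost \<open>C\<^sup>2 / (2 * \<theta>)\<close> is
    \<open>c * \<gamma> * real n\<close>, the last term of the objective.\<close>
  define \<theta> where "\<theta> = c / (2 * \<gamma>)"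
  have \<theta>: "0 < \<theta>" "\<theta> < 1" using c \<gamma> \<gamma>0 by (simp_all add: \<theta>_def)
  have w: "0 < w1 c \<nu> \<gamma>" "0 < w2 c \<nu> \<gamma>"
    using w1_pos[of \<nu> c \<gamma>] w2_pos[of c \<gamma> \<nu>] \<nu> \<theta> by (simp_all add: \<theta>_def)
  have arg: "(c * \<nu>\<^sup>2 / (4 * \<gamma>)) / (1 - c / (2 * \<gamma>)) = \<theta> * \<nu>\<^sup>2 / (2 * (1 - \<theta>))"
    unfolding \<theta>_def by simp
  have w2_eq: "w2 c \<nu> \<gamma> = exp (\<theta> * \<nu>\<^sup>2 / (2 * (1 - \<theta>))) / sqrt (1 - \<theta>)"
    unfolding w2_def arg by (simp add: \<theta>_def)
  have w1_eq: "w1 c \<nu> \<gamma> = exp (\<theta> * \<nu>\<^sup>2 / (2 * (1 - \<theta>))) / sqrt (1 - \<theta>) * erfc (\<nu> / (sqrt 2 * sqrt (1 - \<theta>))) + erf (\<nu> / sqrt 2)"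
    unfolding w1_def arg by (simp add: \<theta>_def)
  show ?thesis
  proof (rule that[of "exp 3 * (real L + 1)"])
    fix n k m :: nat and x :: "real vec" and M :: "'w measure" and A
    assume n: "0 < n" and k: "real k = \<beta> * real n" and m: "real m = \<alpha> * real n"
      and A: "std_normal_matrix M m n A" and x: "x \<in> carrier_vec n" and sparse: "k_sparse k x"
    define S where "S = {j. j < n \<and> x $ j \<noteq> 0}"
    define \<sigma> where "\<sigma> j = sgn (x $ j)" for j
    have S: "card S = k" "S \<subseteq> {..<n}"
      using sparse x by (auto simp: k_sparse_def S_def)
    have m0: "0 < m"
      using \<alpha> n m by (metis mult_pos_pos of_nat_0_less_iff)
    \<comment> \<open>Norms of Gaussian vectors are of order \<open>sqrt n\<close>, so this scale
      makes every exponent of order n; the cover is accordingly applied to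
      \<open>r / sqrt (real n)\<close> below.\<close>
    define C where "C = c * sqrt (real n)"
    have C: "0 < C" "C\<^sup>2 = c\<^sup>2 * real n" using c n by (simp_all add: C_def power_mult_distrib)
    define \<tau> where "\<tau> j z = (if j \<in> S then (z + \<nu> * \<sigma> j)\<^sup>2 else (max 0 (\<bar>z\<bar> - \<nu>))\<^sup>2)" for j z
    define y where "y j = (if j \<in> S then w2 c \<nu> \<gamma> else w1 c \<nu> \<gamma>)" for j
    define B where "B = exp 3 * exp (- C\<^sup>2 / 2 + C\<^sup>2 / (2 * \<theta>)) * (\<Prod>j<n. y j) * (\<Sum>i\<le>L. exp (real n * b i) / sqrt (1 + 2 * \<kappa> i) ^ m)"
    have y_pos: "0 < y j" for j using w by (simp add: y_def)
    have y_int: "has_bochner_integral gauss (\<lambda>z. exp (\<theta> * \<tau> j z / 2)) (y j)" for j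
    proof (cases "j \<in> S")
      case True
      then have "(\<nu> * \<sigma> j)\<^sup>2 = \<nu>\<^sup>2"
        by (auto simp: S_def \<sigma>_def sgn_real_def)
      then show ?thesis
        using True gauss_exp_square_shift[OF \<theta>(2), of "\<nu> * \<sigma> j"] by (simp add: \<tau>_def y_def w2_eq)
    next
      case False
      then show ?thesis
        using gauss_exp_square_soft_threshold[OF \<theta>(2) \<nu>] by (simp add: \<tau>_def y_def w1_eq)
    qed
    have "P_err M A x \<le> B"
    proof (rule P_err_le_small_ball[OF A m0 n x])
      show "0 < 1 / C" using C by simp
      show "0 \<le> B"
        unfolding B_def using y_pos \<kappa>
        by (intro mult_nonneg_nonneg prod_nonneg sum_nonneg divide_nonneg_nonneg) (auto intro: less_imp_le)
      fix N :: nat and u :: "nat \<Rightarrow> nat \<Rightarrow> real"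
      assume N: "0 < N" and u: "\<And>k. k < N \<Longrightarrow> u k \<in> descent_sphere n {j. j < n \<and> x $ j \<noteq> 0} (\<lambda>j. sgn (x $ j))"
      show "measure (gauss_vec ({..m} \<times> {..n}))
        {\<xi> \<in> space (gauss_vec ({..m} \<times> {..n})). \<exists>k<N. (\<Sum>a<m. (\<Sum>j<n. u k j * \<xi> (a, j))\<^sup>2) \<le> (1 / C)\<^sup>2} \<le> B"
        unfolding B_def
      proof (rule gordon_small_ball[OF _ N C(1) \<theta>(1)])
        show "(\<Sum>j<n. (u k j)\<^sup>2) = 1" if "k < N" for k
          using u[OF that] by (simp add: descent_sphere_def)
        show "- (\<Sum>j<n. u k j * h j) \<le> sqrt (\<Sum>j<n. \<tau> j (h j))" if "k < N" for k h
          unfolding \<tau>_def \<sigma>_def S_def using u[OF that] \<nu>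
          by (intro descent_cone_support_le) (auto simp: descent_sphere_def)
        show "0 \<le> \<tau> j z" for j z by (simp add: \<tau>_def)
        show "\<exists>i\<le>L. - C * r \<le> real n * b i - \<kappa> i * r\<^sup>2" if r: "0 \<le> r" for r
        proof -
          obtain i where i: "i \<le> L" "- c * (r / sqrt (real n)) \<le> b i - \<kappa> i * (r / sqrt (real n))\<^sup>2"
            using cover[of "r / sqrt (real n)"] r by auto
          have "real n * (- c * (r / sqrt (real n))) \<le> real n * (b i - \<kappa> i * (r / sqrt (real n))\<^sup>2)"
            using i(2) by (rule mult_left_mono) simp
          moreover have "real n * (- c * (r / sqrt (real n))) = - C * r"
            using n by (simp add: C_def real_div_sqrt field_simps)
          moreover have "real n * (b i - \<kappa> i * (r / sqrt (real n))\<^sup>2) = real n * b i - \<kappa> i * r\<^sup>2"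
            using n by (simp add: power_divide right_diff_distrib)
          ultimately show ?thesis using i(1) by auto
        qed
      qed (use y_int \<kappa> in auto)
    qed
    also have "B \<le> exp 3 * exp (- C\<^sup>2 / 2 + C\<^sup>2 / (2 * \<theta>)) * (\<Prod>j<n. y j) * ((real L + 1) * exp (real n * (I_sph \<alpha> c + c * D)))"
    proof -
      have "(\<Sum>i\<le>L. exp (real n * b i) / sqrt (1 + 2 * \<kappa> i) ^ m) \<le> (\<Sum>i\<le>L. exp (real n * (I_sph \<alpha> c + c * D)))"
        by (intro sum_mono exp_inverse_power_le[where \<alpha> = \<alpha>] \<kappa> m b) auto
      also have "\<dots> = (real L + 1) * exp (real n * (I_sph \<alpha> c + c * D))" by simp
      finally show ?thesis
        unfolding B_def using y_pos by (intro mult_left_mono mult_nonneg_nonneg prod_nonneg) (auto intro: less_imp_le)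
    qed
    also have "(\<Prod>j<n. y j) = exp (real n * ((1 - \<beta>) * ln (w1 c \<nu> \<gamma>) + \<beta> * ln (w2 c \<nu> \<gamma>)))"
    proof -
      have fin: "finite S" using S(2) finite_subset by auto
      have "(\<Prod>j<n. y j) = w2 c \<nu> \<gamma> ^ card S * w1 c \<nu> \<gamma> ^ card ({..<n} - S)"
      proof -
        have "(\<Prod>j<n. y j) = (\<Prod>j\<in>{..<n} - S. y j) * (\<Prod>j\<in>S. y j)"
          by (rule prod.subset_diff[OF S(2)]) simp
        then show ?thesis by (simp add: y_def mult.commute)
      qed
      also have "card ({..<n} - S) = n - k" using S fin by (simp add: card_Diff_subset)
      also have "card S = k" by (rule S(1))
      also have "w2 c \<nu> \<gamma> ^ k * w1 c \<nu> \<gamma> ^ (n - k) = exp (real k * ln (w2 c \<nu> \<gamma>)) * exp (real (n - k) * ln (w1 c \<nu> \<gamma>))"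
        using w by (simp add: exp_of_nat_mult)
      \<comment> \<open>S lies in \<open>{..<n}\<close>, so k is at most n and the subtraction of
        naturals is not truncated.\<close>
      also have "real (n - k) = real n - \<beta> * real n"
        using S card_mono[of "{..<n}" S] k by (simp add: of_nat_diff)
      finally show ?thesis
        unfolding k by (simp add: algebra_simps flip: exp_add)
    qed
    also have "- C\<^sup>2 / 2 + C\<^sup>2 / (2 * \<theta>) = real n * (- (c\<^sup>2 / 2) + c * \<gamma>)"
      unfolding C \<theta>_def using c by (simp add: field_simps power2_eq_square)
    finally have "P_err M A x \<le> exp 3 * (real L + 1) * (exp (real n * (- (c\<^sup>2 / 2) + c * \<gamma>)) *
        exp (real n * ((1 - \<beta>) * ln (w1 c \<nu> \<gamma>) + \<beta> * ln (w2 c \<nu> \<gamma>))) * exp (real n * (I_sph \<alpha> c + c * D)))"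
      by (simp only: mult_ac)
    also have "exp (real n * (- (c\<^sup>2 / 2) + c * \<gamma>)) *
        exp (real n * ((1 - \<beta>) * ln (w1 c \<nu> \<gamma>) + \<beta> * ln (w2 c \<nu> \<gamma>))) * exp (real n * (I_sph \<alpha> c + c * D)) =
        exp (real n * (objective \<alpha> \<beta> c \<nu> \<gamma> + c * D))"
      unfolding exp_add[symmetric] distrib_left[symmetric] by (simp add: objective_def algebra_simps)
    finally show "P_err M A x \<le> exp 3 * (real L + 1) * exp (real n * (objective \<alpha> \<beta> c \<nu> \<gamma> + c * D))" .
  qed (simp add: add_nonneg_pos)
qed

lemma I_err_le_objective:
  fixes \<alpha> \<beta> c \<nu> \<gamma> :: real and M :: "nat \<Rightarrow> 'w measure"
  assumes \<alpha>: "0 < \<alpha>" and c: "0 < c" and \<nu>: "0 \<le> \<nu>" and \<gamma>: "c / 2 < \<gamma>"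
    and model: "\<And>n k m. 0 < n \<Longrightarrow> real k = \<beta> * real n \<Longrightarrow> real m = \<alpha> * real n \<Longrightarrow>
           std_normal_matrix (M n) m n (A n) \<and> x n \<in> carrier_vec n \<and> k_sparse k (x n)"
  shows "I_err \<alpha> \<beta> (\<lambda>n. P_err (M n) (A n) (x n)) \<le> ereal (objective \<alpha> \<beta> c \<nu> \<gamma>)"
proof (rule ereal_le_epsilon2)
  fix e :: real assume e: "0 < e"
  \<comment> \<open>The slack e is shared: one half pays for the mesh, the other for
    \<open>ln L / n\<close>.\<close>
  define D where "D = e / (2 * c)"
  have D: "0 < D" "c * D = e / 2" using c e by (simp_all add: D_def)
  obtain L where L: "0 < L" and bound: "\<And>n k m x (M :: 'w measure) A. 0 < n \<Longrightarrow> real k = \<beta> * real n \<Longrightarrow> real m = \<alpha> * real n \<Longrightarrow>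
       std_normal_matrix M m n A \<Longrightarrow> x \<in> carrier_vec n \<Longrightarrow> k_sparse k x \<Longrightarrow>
       P_err M A x \<le> L * exp (real n * (objective \<alpha> \<beta> c \<nu> \<gamma> + c * D))"
    using P_err_exponential_bound[OF \<alpha> c \<nu> \<gamma> D(1), of \<beta>] by metis
  have "(\<lambda>n. ln L / real n) \<longlonglongrightarrow> 0" by real_asymp
  then have "eventually (\<lambda>n. ln L / real n < e / 2) sequentially"
    using e by (intro order_tendstoD) auto
  with eventually_gt_at_top[of 0] have
    "eventually (\<lambda>n. n \<in> {n. \<beta> * real n \<in> \<nat> \<and> \<alpha> * real n \<in> \<nat>} \<longrightarrow>
      log_prob (P_err (M n) (A n) (x n)) / ereal (real n) \<le> ereal (objective \<alpha> \<beta> c \<nu> \<gamma> + e)) sequentially"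
  proof eventually_elim
    case (elim n)
    show ?case
    proof
      assume "n \<in> {n. \<beta> * real n \<in> \<nat> \<and> \<alpha> * real n \<in> \<nat>}"
      then obtain k m where km: "real k = \<beta> * real n" "real m = \<alpha> * real n"
        unfolding Nats_def by auto
      let ?p = "P_err (M n) (A n) (x n)"
      have p: "?p \<le> L * exp (real n * (objective \<alpha> \<beta> c \<nu> \<gamma> + e / 2))"
        using bound[OF _ km] model[OF _ km] elim D(2) by auto
      show "log_prob ?p / ereal (real n) \<le> ereal (objective \<alpha> \<beta> c \<nu> \<gamma> + e)"
      proof (cases "?p = 0")
        \<comment> \<open>A vanishing probability has logarithm minus infinity, which division by a
          positive n preserves.\<close>
        case True
        then show ?thesis using elim by (simp add: log_prob_def)
      next
        case False
        then have "0 < ?p" by (simp add: P_err_def zero_less_measure_iff)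
        then have "ln ?p \<le> ln (L * exp (real n * (objective \<alpha> \<beta> c \<nu> \<gamma> + e / 2)))"
          using p by (intro ln_mono) auto
        also have "\<dots> = ln L + real n * (objective \<alpha> \<beta> c \<nu> \<gamma> + e / 2)"
          using L by (simp add: ln_mult)
        finally have "ln ?p / real n \<le> (ln L + real n * (objective \<alpha> \<beta> c \<nu> \<gamma> + e / 2)) / real n"
          by (rule divide_right_mono) simp
        also have "\<dots> = ln L / real n + (objective \<alpha> \<beta> c \<nu> \<gamma> + e / 2)"
          using elim by (simp add: add_divide_distrib)
        also have "\<dots> \<le> objective \<alpha> \<beta> c \<nu> \<gamma> + e"
          using elim by linarith
        finally show ?thesis using False elim by (simp add: log_prob_def)
      qed
    qed
  qed
  then show "I_err \<alpha> \<beta> (\<lambda>n. P_err (M n) (A n) (x n)) \<le> ereal (objective \<alpha> \<beta> c \<nu> \<gamma>) + ereal e"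
    unfolding I_err_def proportional_def by (auto intro!: Limsup_bounded simp: eventually_inf_principal)
qed

subsection \<open>The optimal parameters\<close>

text \<open>The left side plus \<open>erf\<close> has a positive derivative and tends to 1 at
  infinity, hence stays at most 1. In its derivative everything cancels except
  \<open>2 * exp (- x\<^sup>2)\<close> over the squared denominator.\<close>

lemma erfc_mills_lower:
  assumes "0 < q"
  shows "2 / sqrt pi * (q * exp (- q\<^sup>2) / (1 + 2 * q\<^sup>2)) \<le> erfc q"
proof -
  define r where "r x = 2 / sqrt pi * (x * exp (- x\<^sup>2) / (1 + 2 * x\<^sup>2)) + erf x" for x :: real
  have pos: "0 < 1 + 2 * x\<^sup>2" for x :: real
    by (simp add: add_pos_nonneg)
  have D: "(r has_real_derivative 2 / sqrt pi * (2 * exp (- x\<^sup>2) / (1 + 2 * x\<^sup>2)\<^sup>2)) (at x)" for x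
  proof -
    have "(r has_real_derivative 2 / sqrt pi * (((exp (- x\<^sup>2) - 2 * x\<^sup>2 * exp (- x\<^sup>2)) * (1 + 2 * x\<^sup>2) - x * exp (- x\<^sup>2) * (4 * x)) / ((1 + 2 * x\<^sup>2) * (1 + 2 * x\<^sup>2)))
        + 2 / sqrt pi * exp (- x\<^sup>2)) (at x)"
    proof -
      have "((\<lambda>x. x * exp (- x\<^sup>2)) has_real_derivative exp (- x\<^sup>2) - 2 * x\<^sup>2 * exp (- x\<^sup>2)) (at x)"
        by (auto intro!: derivative_eq_intros simp: power2_eq_square algebra_simps)
      moreover have "((\<lambda>x. 1 + 2 * x\<^sup>2) has_real_derivative 4 * x) (at x)"
        by (auto intro!: derivative_eq_intros)
      ultimately show ?thesis
        unfolding r_def using pos[of x] by (intro DERIV_add DERIV_cmult DERIV_divide DERIV_erf) auto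
    qed
    also have "2 / sqrt pi * (((exp (- x\<^sup>2) - 2 * x\<^sup>2 * exp (- x\<^sup>2)) * (1 + 2 * x\<^sup>2) - x * exp (- x\<^sup>2) * (4 * x)) / ((1 + 2 * x\<^sup>2) * (1 + 2 * x\<^sup>2)))
        + 2 / sqrt pi * exp (- x\<^sup>2) =
        2 / sqrt pi * ((((exp (- x\<^sup>2) - 2 * x\<^sup>2 * exp (- x\<^sup>2)) * (1 + 2 * x\<^sup>2) - x * exp (- x\<^sup>2) * (4 * x)) + exp (- x\<^sup>2) * (1 + 2 * x\<^sup>2)\<^sup>2) / (1 + 2 * x\<^sup>2)\<^sup>2)"
      using pos[of x] by (simp add: add_divide_distrib distrib_left flip: power2_eq_square)
    also have "((exp (- x\<^sup>2) - 2 * x\<^sup>2 * exp (- x\<^sup>2)) * (1 + 2 * x\<^sup>2) - x * exp (- x\<^sup>2) * (4 * x)) + exp (- x\<^sup>2) * (1 + 2 * x\<^sup>2)\<^sup>2 = 2 * exp (- x\<^sup>2)"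
      by (simp add: power2_eq_square algebra_simps)
    finally show ?thesis .
  qed
  have "(r \<longlongrightarrow> 2 / sqrt pi * 0 + 1) at_top"
    unfolding r_def by (intro tendsto_add tendsto_mult_left tendsto_erf_at_top) real_asymp
  moreover have "eventually (\<lambda>x. r q \<le> r x) at_top"
    using eventually_ge_at_top[of q]
  proof eventually_elim
    case (elim x)
    show ?case
      by (rule DERIV_nonneg_imp_nondecreasing[OF elim]) (use D in \<open>auto intro!: exI\<close>)
  qed
  ultimately have "r q \<le> 2 / sqrt pi * 0 + 1"
    by (rule tendsto_lowerbound) simp
  then show ?thesis by (simp add: r_def erfc_def)
qed

text \<open>Up to the factor \<open>exp (x\<^sup>2)\<close>, nonnegativity of the derivative is
  exactly the Mills bound \<open>erfc_mills_lower\<close>.\<close>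

lemma mono_exp_square_erfc:
  assumes "0 < p" "p \<le> q"
  shows "p * exp (p\<^sup>2) * erfc p \<le> q * exp (q\<^sup>2) * erfc q"
proof (rule DERIV_nonneg_imp_nondecreasing[OF assms(2)])
  fix x assume "p \<le> x" "x \<le> q"
  then have x: "0 < x" using assms by simp
  have pos: "0 < 1 + 2 * x\<^sup>2" by (simp add: add_pos_nonneg)
  have "((\<lambda>x. x * exp (x\<^sup>2) * erfc x) has_real_derivative
      (1 * exp (x\<^sup>2) + exp (x\<^sup>2) * (2 * x) * x) * erfc x + (- (2 / sqrt pi * exp (- x\<^sup>2))) * (x * exp (x\<^sup>2))) (at x)"
    unfolding erfc_def by (rule derivative_eq_intros DERIV_erf refl | simp)+
  also have "(1 * exp (x\<^sup>2) + exp (x\<^sup>2) * (2 * x) * x) * erfc x + (- (2 / sqrt pi * exp (- x\<^sup>2))) * (x * exp (x\<^sup>2))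
      = exp (x\<^sup>2) * ((1 + 2 * x\<^sup>2) * erfc x - 2 / sqrt pi * (x * exp (- x\<^sup>2)))"
    by (simp add: algebra_simps power2_eq_square)
  finally have D: "((\<lambda>x. x * exp (x\<^sup>2) * erfc x) has_real_derivative
      exp (x\<^sup>2) * ((1 + 2 * x\<^sup>2) * erfc x - 2 / sqrt pi * (x * exp (- x\<^sup>2)))) (at x)" .
  have "(1 + 2 * x\<^sup>2) * (2 / sqrt pi * (x * exp (- x\<^sup>2) / (1 + 2 * x\<^sup>2))) \<le> (1 + 2 * x\<^sup>2) * erfc x"
    using erfc_mills_lower[OF x] pos by (intro mult_left_mono) auto
  then have "0 \<le> (1 + 2 * x\<^sup>2) * erfc x - 2 / sqrt pi * (x * exp (- x\<^sup>2))"
    using pos by simp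
  with D show "\<exists>y. ((\<lambda>x. x * exp (x\<^sup>2) * erfc x) has_real_derivative y) (at x) \<and> 0 \<le> y"
    by (intro exI[of _ "exp (x\<^sup>2) * ((1 + 2 * x\<^sup>2) * erfc x - 2 / sqrt pi * (x * exp (- x\<^sup>2)))"]) simp
qed

text \<open>Replaces \<open>erfinv\<close> and the quotient in \<open>xi\<close> by polynomial
  identities in q, \<open>erf q\<close>, \<open>erfc q\<close> and \<open>exp (q\<^sup>2)\<close>.
  The argument of \<open>erfinv\<close> lies in its domain because \<open>b < \<alpha>\<close>; b
  may be negative.\<close>

lemma erfinv_ratio:
  assumes "0 < \<alpha>" "\<alpha> < 1" "b < \<alpha>"
  defines "q \<equiv> erfinv ((1 - \<alpha>) / (1 - b))"
  shows "0 < q" "(1 - b) * erf q = 1 - \<alpha>" "(1 - b) * erfc q = \<alpha> - b"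
    "xi \<alpha> b * (\<alpha> * sqrt pi * q) * exp (q\<^sup>2) = 1 - b"
proof -
  have b: "0 < 1 - b" using assms by simp
  have y: "0 < (1 - \<alpha>) / (1 - b)" "(1 - \<alpha>) / (1 - b) < 1"
    using assms by (auto simp: divide_less_eq)
  show q: "0 < q" unfolding q_def by (rule erf_erfinv[OF y])
  have "erf q = (1 - \<alpha>) / (1 - b)" unfolding q_def by (rule erf_erfinv[OF y])
  then show "(1 - b) * erf q = 1 - \<alpha>" using b by simp
  then show "(1 - b) * erfc q = \<alpha> - b" by (simp add: erfc_def right_diff_distrib)
  have "sqrt (2 / pi) = sqrt 2 / sqrt pi" by (rule real_sqrt_divide)
  then have "xi \<alpha> b = (1 - b) * exp (- q\<^sup>2) / (\<alpha> * sqrt pi * q)"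
    unfolding xi_def q_def[symmetric] by (simp add: mult_ac)
  then show "xi \<alpha> b * (\<alpha> * sqrt pi * q) * exp (q\<^sup>2) = 1 - b"
    using q assms by (simp add: exp_minus)
qed

text \<open>Passing from \<open>\<alpha>\<^sub>w\<close> to the larger \<alpha> at fixed \<beta>
  lowers the root from p to q and makes \<open>xi \<alpha> \<beta>\<close> exceed 1. If
  \<open>\<beta>\<^sub>w\<close> were at most \<beta>, then \<open>q\<^sub>w\<close> would be at
  most q, and the strict inequality would carry over to \<open>\<beta>\<^sub>w\<close>, where
  \<open>xi\<close> equals 1.\<close>

lemma weak_threshold_less:
  assumes \<beta>: "0 < \<beta>" and \<alpha>\<^sub>w: "\<beta> < \<alpha>\<^sub>w" "\<alpha>\<^sub>w < \<alpha>" and \<alpha>: "\<alpha> < 1"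
    and xi: "xi \<alpha>\<^sub>w \<beta> = 1" and \<beta>\<^sub>w: "\<beta>\<^sub>w < \<alpha>" "xi \<alpha> \<beta>\<^sub>w = 1"
  shows "\<beta> < \<beta>\<^sub>w"
proof (rule ccontr)
  assume "\<not> \<beta> < \<beta>\<^sub>w"
  then have le: "\<beta>\<^sub>w \<le> \<beta>" by simp
  define p where "p = erfinv ((1 - \<alpha>\<^sub>w) / (1 - \<beta>))"
  define q where "q = erfinv ((1 - \<alpha>) / (1 - \<beta>))"
  define q\<^sub>w where "q\<^sub>w = erfinv ((1 - \<alpha>) / (1 - \<beta>\<^sub>w))"
  have "0 < \<alpha>" "0 < \<alpha>\<^sub>w" "\<alpha>\<^sub>w < 1" "\<beta> < \<alpha>" using assms by auto
  note p = erfinv_ratio[OF \<open>0 < \<alpha>\<^sub>w\<close> \<open>\<alpha>\<^sub>w < 1\<close> \<alpha>\<^sub>w(1), folded p_def, unfolded xi]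
    and q = erfinv_ratio[OF \<open>0 < \<alpha>\<close> \<alpha> \<open>\<beta> < \<alpha>\<close>, folded q_def]
    and q\<^sub>w = erfinv_ratio[OF \<open>0 < \<alpha>\<close> \<alpha> \<beta>\<^sub>w(1), folded q\<^sub>w_def, unfolded \<beta>\<^sub>w(2)]
  have \<beta>1: "0 < 1 - \<beta>" "1 - \<beta> \<le> 1" "1 - \<beta> \<le> 1 - \<beta>\<^sub>w" using assms le by auto
  \<comment> \<open>\<open>H x\<close> is
    \<open>\<alpha> * x - (1 - \<beta>) * exp (- x\<^sup>2) / sqrt pi\<close> with \<alpha>
    eliminated by \<open>(1 - \<beta>) * erf x = 1 - \<alpha>\<close>, so \<open>xi = 1\<close>
    becomes \<open>H x = 0\<close>. The bracket is an antiderivative of \<open>erf\<close>, which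
    makes the derivative simple and positive.\<close>
  define H where "H x = x - (1 - \<beta>) * (exp (- x\<^sup>2) / sqrt pi + x * erf x)" for x
  have "(1 - \<beta>) * erf q < (1 - \<beta>) * erf p" using p(2) q(2) \<alpha>\<^sub>w by simp
  then have "q < p" using \<beta>1 strict_mono_less[OF strict_mono_erf] by simp
  then have "H q < H p"
  proof (rule DERIV_pos_imp_increasing)
    fix x
    have "(H has_real_derivative 1 - (1 - \<beta>) * (exp (- x\<^sup>2) * (- (2 * x)) / sqrt pi + (1 * erf x + 2 / sqrt pi * exp (- x\<^sup>2) * x))) (at x)"
    proof -
      have "((\<lambda>x. exp (- x\<^sup>2)) has_real_derivative exp (- x\<^sup>2) * (- (2 * x))) (at x)"
        by (auto intro!: derivative_eq_intros)
      then show ?thesis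
        unfolding H_def by (intro DERIV_diff DERIV_ident DERIV_cmult DERIV_add DERIV_cdivide DERIV_mult DERIV_erf)
    qed
    also have "1 - (1 - \<beta>) * (exp (- x\<^sup>2) * (- (2 * x)) / sqrt pi + (1 * erf x + 2 / sqrt pi * exp (- x\<^sup>2) * x)) = 1 - (1 - \<beta>) * erf x"
    proof -
      have "exp (- x\<^sup>2) * (- (2 * x)) / sqrt pi + (1 * erf x + 2 / sqrt pi * exp (- x\<^sup>2) * x) = erf x"
        by (simp add: mult_ac)
      then show ?thesis by (simp only:)
    qed
    finally have "(H has_real_derivative 1 - (1 - \<beta>) * erf x) (at x)" .
    moreover have "(1 - \<beta>) * erf x < 1 - \<beta>"
      using mult_strict_left_mono[OF erf_less_1 \<beta>1(1), of x] by (simp only: mult_1_right)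
    then have "0 < 1 - (1 - \<beta>) * erf x"
      using less_le_trans[OF _ \<beta>1(2)] by (simp only: diff_gt_0_iff_gt)
    ultimately show "\<exists>y. (H has_real_derivative y) (at x) \<and> 0 < y" by blast
  qed
  moreover have H: "H x = x - ((1 - \<beta>) * (exp (- x\<^sup>2) / sqrt pi) + (1 - \<beta>) * erf x * x)" for x
    unfolding H_def by (simp only: distrib_left mult_ac)
  moreover have "(1 - \<beta>) * (exp (- p\<^sup>2) / sqrt pi) = \<alpha>\<^sub>w * p"
    unfolding p(4)[symmetric] by (simp add: exp_minus field_simps)
  then have "H p = 0"
    unfolding H p(2) by (simp add: left_diff_distrib)
  ultimately have "q - ((1 - \<beta>) * (exp (- q\<^sup>2) / sqrt pi) + (1 - \<alpha>) * q) < 0"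
    unfolding q(2)[symmetric] by simp
  then have "\<alpha> * q < (1 - \<beta>) * (exp (- q\<^sup>2) / sqrt pi)"
    unfolding left_diff_distrib[of 1 \<alpha>] by linarith
  then have 1: "\<alpha> * sqrt pi * q < (1 - \<beta>) * exp (- q\<^sup>2)"
    by (simp add: pos_less_divide_eq mult_ac)
  have "0 < 1 - \<beta>\<^sub>w" using \<beta>1 by simp
  have "erf q\<^sub>w = (1 - \<alpha>) / (1 - \<beta>\<^sub>w)" "erf q = (1 - \<alpha>) / (1 - \<beta>)"
    using q\<^sub>w(2) q(2) \<beta>1 \<open>0 < 1 - \<beta>\<^sub>w\<close> by (simp_all add: field_simps)
  then have "erf q\<^sub>w \<le> erf q"
    using \<beta>1 \<alpha> by (auto intro: divide_left_mono)
  then have "q\<^sub>w \<le> q" using strict_mono_less_eq[OF strict_mono_erf] by simp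
  then have "\<alpha> * sqrt pi * q\<^sub>w \<le> \<alpha> * sqrt pi * q" "q\<^sub>w\<^sup>2 \<le> q\<^sup>2"
    using \<open>0 < \<alpha>\<close> q\<^sub>w(1) by (auto intro: mult_left_mono power_mono)
  moreover from this(2) have "(1 - \<beta>) * exp (- q\<^sup>2) \<le> (1 - \<beta>\<^sub>w) * exp (- q\<^sub>w\<^sup>2)"
    using \<beta>1 by (intro mult_mono) auto
  moreover have "(1 - \<beta>\<^sub>w) * exp (- q\<^sub>w\<^sup>2) = \<alpha> * sqrt pi * q\<^sub>w"
    unfolding q\<^sub>w(4)[symmetric] by (simp add: exp_minus)
  ultimately show False using 1 by linarith
qed

text \<open>Multiplied by \<open>\<alpha> * sqrt pi\<close>, the increasing function
  \<open>q * exp (q\<^sup>2) * erfc q\<close> takes the value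
  \<open>\<alpha> - \<beta>\<^sub>w\<close> at \<open>q\<^sub>w\<close> and the larger value
  \<open>\<alpha> - \<beta>\<close> at \<open>q\<^sub>0\<close>.\<close>

lemma erfinv_ratio_less:
  assumes "0 < \<alpha>" "\<alpha> < 1" "\<beta> < \<beta>\<^sub>w" "\<beta>\<^sub>w < \<alpha>" "\<beta>\<^sub>0 < \<alpha>"
    and xi: "xi \<alpha> \<beta>\<^sub>w = 1" "(\<alpha> - \<beta>) / (\<alpha> - \<beta>\<^sub>0) * xi \<alpha> \<beta>\<^sub>0 = 1"
  shows "erfinv ((1 - \<alpha>) / (1 - \<beta>\<^sub>w)) < erfinv ((1 - \<alpha>) / (1 - \<beta>\<^sub>0))"
proof (rule ccontr)
  define q\<^sub>w where "q\<^sub>w = erfinv ((1 - \<alpha>) / (1 - \<beta>\<^sub>w))"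
  define q\<^sub>0 where "q\<^sub>0 = erfinv ((1 - \<alpha>) / (1 - \<beta>\<^sub>0))"
  note q\<^sub>w = erfinv_ratio[OF assms(1,2,4), folded q\<^sub>w_def, unfolded xi(1)]
    and q\<^sub>0 = erfinv_ratio[OF assms(1,2,5), folded q\<^sub>0_def]
  have xi0: "xi \<alpha> \<beta>\<^sub>0 = (\<alpha> - \<beta>\<^sub>0) / (\<alpha> - \<beta>)"
    using xi(2) assms by (simp add: field_simps)
  assume "\<not> erfinv ((1 - \<alpha>) / (1 - \<beta>\<^sub>w)) < erfinv ((1 - \<alpha>) / (1 - \<beta>\<^sub>0))"
  then have "q\<^sub>0 \<le> q\<^sub>w" by (simp add: q\<^sub>w_def q\<^sub>0_def)
  then have "\<alpha> * sqrt pi * (q\<^sub>0 * exp (q\<^sub>0\<^sup>2) * erfc q\<^sub>0) \<le> \<alpha> * sqrt pi * (q\<^sub>w * exp (q\<^sub>w\<^sup>2) * erfc q\<^sub>w)"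
    using assms q\<^sub>0(1) by (intro mult_left_mono mono_exp_square_erfc) auto
  moreover have "\<alpha> * sqrt pi * (q\<^sub>w * exp (q\<^sub>w\<^sup>2) * erfc q\<^sub>w) = \<alpha> - \<beta>\<^sub>w"
    using q\<^sub>w(3) unfolding q\<^sub>w(4)[symmetric] by (simp add: mult_ac)
  moreover have "\<alpha> * sqrt pi * (q\<^sub>0 * exp (q\<^sub>0\<^sup>2) * erfc q\<^sub>0) = \<alpha> - \<beta>"
  proof -
    have "(\<alpha> - \<beta>\<^sub>0) / (\<alpha> - \<beta>) * (\<alpha> * sqrt pi * (q\<^sub>0 * exp (q\<^sub>0\<^sup>2) * erfc q\<^sub>0)) = \<alpha> - \<beta>\<^sub>0"
      using q\<^sub>0(3) unfolding q\<^sub>0(4)[symmetric] xi0 by (simp add: mult_ac)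
    moreover have "T = b'" if "a / b' * T = a" "a \<noteq> 0" "b' \<noteq> 0" for a b' T :: real
      using that by (simp add: field_simps)
    ultimately show ?thesis using assms by (metis less_irrefl less_trans right_minus_eq)
  qed
  ultimately show False using assms by linarith
qed

text \<open>Parametrizing c by A turns \<open>c\<^sup>2 + 4 * \<alpha>\<close> into the square of
  \<open>sqrt \<alpha> * (1 / A + A)\<close>. The root in \<open>gamma_hat\<close> disappears, the
  argument of the logarithm is \<open>1 / A\<^sup>2\<close>, and the algebraic terms cancel.\<close>

lemma spherical_part_at_optimum:
  fixes \<alpha> A :: real
  assumes "0 < \<alpha>" "0 < A"
  defines "c \<equiv> (1 - A\<^sup>2) * sqrt \<alpha> / A"
  shows "- (c\<^sup>2 / 2) + I_sph \<alpha> c + c * (sqrt \<alpha> / (2 * A)) = \<alpha> * ln A"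
proof -
  define s where "s = sqrt \<alpha>"
  have s: "0 < s" "\<alpha> = s\<^sup>2" using assms by (simp_all add: s_def)
  have "c\<^sup>2 + 4 * \<alpha> = (s * (1 / A + A))\<^sup>2"
    using assms(2) unfolding c_def s_def[symmetric] s(2) by (simp add: field_simps power2_eq_square)
  moreover have "0 \<le> s * (1 / A + A)" using s assms by simp
  ultimately have "sqrt (c\<^sup>2 + 4 * \<alpha>) = s * (1 / A + A)" by simp
  then have gh: "gamma_hat \<alpha> c = - (s * A) / 2"
    using assms(2) unfolding gamma_hat_def by (simp add: c_def s_def[symmetric] field_simps power2_eq_square)
  have "1 - c / (2 * gamma_hat \<alpha> c) = 1 / A\<^sup>2"
    using assms(2) s unfolding gh by (simp add: c_def s_def[symmetric] field_simps power2_eq_square)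
  then have "I_sph \<alpha> c = - (s * A) / 2 * c + \<alpha> * ln A"
    using assms(2) unfolding I_sph_def gh by (simp add: ln_div ln_realpow)
  moreover have "- (c\<^sup>2 / 2) + - (s * A) / 2 * c + c * (s / (2 * A)) = 0"
    using assms(2) unfolding c_def s_def[symmetric] by (simp add: field_simps power2_eq_square)
  ultimately show ?thesis unfolding s_def[symmetric] by simp
qed

lemma objective_at_optimum:
  fixes \<alpha> \<beta> \<beta>\<^sub>w \<beta>\<^sub>0 :: real
  defines "q\<^sub>w \<equiv> erfinv ((1 - \<alpha>) / (1 - \<beta>\<^sub>w))" and "q\<^sub>0 \<equiv> erfinv ((1 - \<alpha>) / (1 - \<beta>\<^sub>0))"
  defines "A \<equiv> q\<^sub>w / q\<^sub>0"
  assumes \<alpha>: "0 < \<alpha>" "\<alpha> < 1" and \<beta>: "\<beta> < \<alpha>" "\<beta>\<^sub>w < \<alpha>" "\<beta>\<^sub>0 < \<alpha>"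
    and xi: "xi \<alpha> \<beta>\<^sub>w = 1" "(\<alpha> - \<beta>) / (\<alpha> - \<beta>\<^sub>0) * xi \<alpha> \<beta>\<^sub>0 = 1"
  shows "objective \<alpha> \<beta> ((1 - A\<^sup>2) * sqrt \<alpha> / A) (sqrt 2 * q\<^sub>w) (sqrt \<alpha> / (2 * A)) = I_ldp \<alpha> \<beta> \<beta>\<^sub>w \<beta>\<^sub>0"
proof -
  let ?c = "(1 - A\<^sup>2) * sqrt \<alpha> / A" and ?\<nu> = "sqrt 2 * q\<^sub>w" and ?\<gamma> = "sqrt \<alpha> / (2 * A)"
  note qw = erfinv_ratio[OF \<alpha> \<beta>(2), folded q\<^sub>w_def, unfolded xi(1)]
    and q0 = erfinv_ratio[OF \<alpha> \<beta>(3), folded q\<^sub>0_def]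
  have xi0: "xi \<alpha> \<beta>\<^sub>0 = (\<alpha> - \<beta>\<^sub>0) / (\<alpha> - \<beta>)"
    using xi(2) \<beta> by (simp add: field_simps)
  have A0: "0 < A" using qw(1) q0(1) by (simp add: A_def)
  \<comment> \<open>This identity explains the choice of A: the \<open>erfc\<close> in
    \<open>w1\<close> is then evaluated at \<open>q\<^sub>w / A = q\<^sub>0\<close>, where its value
    is known.\<close>
  have one: "1 - ?c / (2 * ?\<gamma>) = A\<^sup>2"
    using A0 \<alpha> by (simp add: field_simps)
  have arg: "(?c * ?\<nu>\<^sup>2 / (4 * ?\<gamma>)) / A\<^sup>2 = q\<^sub>0\<^sup>2 - q\<^sub>w\<^sup>2"
  proof -
    have "?c / (4 * ?\<gamma>) = (1 - A\<^sup>2) / 2"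
      using A0 \<alpha> by (simp add: field_simps)
    moreover have "?c * ?\<nu>\<^sup>2 / (4 * ?\<gamma>) = ?c / (4 * ?\<gamma>) * ?\<nu>\<^sup>2" by simp
    ultimately have "?c * ?\<nu>\<^sup>2 / (4 * ?\<gamma>) = (1 - A\<^sup>2) * q\<^sub>w\<^sup>2"
      by (simp only: power_mult_distrib) simp
    then show ?thesis
      using A0 qw(1) q0(1) by (simp only:) (simp add: A_def field_simps)
  qed
  \<comment> \<open>The quotient of the two defining equations, for \<open>\<beta>\<^sub>0\<close>
    and for \<open>\<beta>\<^sub>w\<close>, in the form without \<open>erfinv\<close>.\<close>
  have ratio: "exp (q\<^sub>0\<^sup>2 - q\<^sub>w\<^sup>2) / A = ((\<alpha> - \<beta>) * (1 - \<beta>\<^sub>0)) / ((\<alpha> - \<beta>\<^sub>0) * (1 - \<beta>\<^sub>w))"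
  proof -
    have "\<alpha> * sqrt pi * (q\<^sub>0 * exp (q\<^sub>0\<^sup>2)) = (\<alpha> - \<beta>) * (1 - \<beta>\<^sub>0) / (\<alpha> - \<beta>\<^sub>0)"
      using \<beta> unfolding q0(4)[symmetric] xi0 by (simp add: mult_ac)
    moreover have "\<alpha> * sqrt pi * (q\<^sub>w * exp (q\<^sub>w\<^sup>2)) = 1 - \<beta>\<^sub>w"
      using qw(4) by (simp add: mult_ac)
    moreover have "exp (q\<^sub>0\<^sup>2 - q\<^sub>w\<^sup>2) / A = (\<alpha> * sqrt pi * (q\<^sub>0 * exp (q\<^sub>0\<^sup>2))) / (\<alpha> * sqrt pi * (q\<^sub>w * exp (q\<^sub>w\<^sup>2)))"
      using \<alpha> by (simp add: A_def exp_diff mult.commute)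
    ultimately show ?thesis by simp
  qed
  have w2: "w2 ?c ?\<nu> ?\<gamma> = ((\<alpha> - \<beta>) * (1 - \<beta>\<^sub>0)) / ((\<alpha> - \<beta>\<^sub>0) * (1 - \<beta>\<^sub>w))"
    unfolding w2_def one arg using A0 ratio by simp
  have w1: "w1 ?c ?\<nu> ?\<gamma> = (1 - \<beta>) / (1 - \<beta>\<^sub>w)"
  proof -
    have "?\<nu> / (sqrt 2 * sqrt (A\<^sup>2)) = q\<^sub>0"
      using A0 qw(1) q0(1) by (simp add: A_def)
    then have "w1 ?c ?\<nu> ?\<gamma> = exp (q\<^sub>0\<^sup>2 - q\<^sub>w\<^sup>2) / A * erfc q\<^sub>0 + erf q\<^sub>w"
      unfolding w1_def one arg using A0 by simp
    \<comment> \<open>Multiplying the ratio by \<open>erfc q\<^sub>0\<close> cancels both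
      \<open>1 - \<beta>\<^sub>0\<close> and \<open>\<alpha> - \<beta>\<^sub>0\<close>, so the two
      terms share a denominator and their numerators add up to \<open>1 - \<beta>\<close>.\<close>
    also have "\<dots> = (\<alpha> - \<beta>) / (1 - \<beta>\<^sub>w) + (1 - \<alpha>) / (1 - \<beta>\<^sub>w)"
    proof -
      have "erf q\<^sub>w = (1 - \<alpha>) / (1 - \<beta>\<^sub>w)"
        using qw(2) \<alpha> \<beta> by (simp add: field_simps)
      moreover have "exp (q\<^sub>0\<^sup>2 - q\<^sub>w\<^sup>2) / A * erfc q\<^sub>0 = (\<alpha> - \<beta>) * ((1 - \<beta>\<^sub>0) * erfc q\<^sub>0) / ((\<alpha> - \<beta>\<^sub>0) * (1 - \<beta>\<^sub>w))"
        unfolding ratio by simp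
      ultimately show ?thesis
        unfolding q0(3) using \<beta> by simp
    qed
    finally show ?thesis by (simp flip: add_divide_distrib)
  qed
  have "objective \<alpha> \<beta> ?c ?\<nu> ?\<gamma> = (- (?c\<^sup>2 / 2) + I_sph \<alpha> ?c + ?c * ?\<gamma>) + (1 - \<beta>) * ln (w1 ?c ?\<nu> ?\<gamma>) + \<beta> * ln (w2 ?c ?\<nu> ?\<gamma>)"
    unfolding objective_def by simp
  also have "\<dots> = \<alpha> * ln A + (1 - \<beta>) * ln ((1 - \<beta>) / (1 - \<beta>\<^sub>w)) + \<beta> * ln (((\<alpha> - \<beta>) * (1 - \<beta>\<^sub>0)) / ((\<alpha> - \<beta>\<^sub>0) * (1 - \<beta>\<^sub>w)))"
    by (simp only: spherical_part_at_optimum[OF \<alpha>(1) A0] w1 w2)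
  also have "\<dots> = I_ldp \<alpha> \<beta> \<beta>\<^sub>w \<beta>\<^sub>0"
    by (simp only: I_ldp_def A_def q\<^sub>w_def q\<^sub>0_def)
  finally show ?thesis .
qed

theorem theorem5:
  fixes \<alpha> \<beta> \<alpha>\<^sub>w \<beta>\<^sub>w \<beta>\<^sub>0 :: real
    and M :: "nat \<Rightarrow> 'w measure"
    and A :: "nat \<Rightarrow> 'w \<Rightarrow> real mat"
    and x :: "nat \<Rightarrow> real vec"
  assumes "0 < \<beta>" "\<beta> < \<alpha>" "\<alpha> < 1"
    and "\<And>n k m. 0 < n \<Longrightarrow> real k = \<beta> * real n \<Longrightarrow> real m = \<alpha> * real n \<Longrightarrow>
           std_normal_matrix (M n) m n (A n) \<and> x n \<in> carrier_vec n \<and> k_sparse k (x n)"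
    and "\<beta> < \<alpha>\<^sub>w" "\<alpha>\<^sub>w < 1" "xi \<alpha>\<^sub>w \<beta> = 1"
    and "\<alpha>\<^sub>w < \<alpha>"
    and "0 \<le> \<beta>\<^sub>w" "\<beta>\<^sub>w < \<alpha>" "xi \<alpha> \<beta>\<^sub>w = 1"
    and "\<beta>\<^sub>0 < \<alpha>" "(\<alpha> - \<beta>) / (\<alpha> - \<beta>\<^sub>0) * xi \<alpha> \<beta>\<^sub>0 = 1"
  shows "I_err \<alpha> \<beta> (\<lambda>n. P_err (M n) (A n) (x n)) \<le> ereal (I_ldp \<alpha> \<beta> \<beta>\<^sub>w \<beta>\<^sub>0) \<and>
        (let \<nu> = sqrt 2 * erfinv ((1 - \<alpha>) / (1 - \<beta>\<^sub>w));
             A\<^sub>0 = erfinv ((1 - \<alpha>) / (1 - \<beta>\<^sub>w)) / erfinv ((1 - \<alpha>) / (1 - \<beta>\<^sub>0));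
             c\<^sub>3 = (1 - A\<^sub>0\<^sup>2) * sqrt \<alpha> / A\<^sub>0;
             \<gamma> = c\<^sub>3 / (2 * (1 - A\<^sub>0\<^sup>2))
         in \<gamma> = sqrt \<alpha> / (2 * A\<^sub>0) \<and>
            0 \<le> c\<^sub>3 \<and> 0 \<le> \<nu> \<and> c\<^sub>3 / 2 < \<gamma> \<and>
            objective \<alpha> \<beta> c\<^sub>3 \<nu> \<gamma> = I_ldp \<alpha> \<beta> \<beta>\<^sub>w \<beta>\<^sub>0)"
proof -
  define q\<^sub>w where "q\<^sub>w = erfinv ((1 - \<alpha>) / (1 - \<beta>\<^sub>w))"
  define q\<^sub>0 where "q\<^sub>0 = erfinv ((1 - \<alpha>) / (1 - \<beta>\<^sub>0))"
  define A\<^sub>0 where "A\<^sub>0 = q\<^sub>w / q\<^sub>0"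
  define c where "c = (1 - A\<^sub>0\<^sup>2) * sqrt \<alpha> / A\<^sub>0"
  have \<alpha>: "0 < \<alpha>" "\<alpha> < 1" and \<beta>: "0 < \<beta>" "\<beta> < \<alpha>" using assms(1-3) by auto
  have "\<beta> < \<beta>\<^sub>w"
    by (rule weak_threshold_less[OF \<beta>(1) assms(5,8) \<alpha>(2) assms(7,10,11)])
  then have "q\<^sub>w < q\<^sub>0"
    unfolding q\<^sub>w_def q\<^sub>0_def by (rule erfinv_ratio_less[OF \<alpha> _ assms(10,12,11,13)])
  moreover have q: "0 < q\<^sub>w" "0 < q\<^sub>0"
    unfolding q\<^sub>w_def q\<^sub>0_def using erfinv_ratio(1)[OF \<alpha>] assms(10,12) by auto
  \<comment> \<open>This makes the parameters admissible: \<open>A\<^sub>0 < 1\<close> gives c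
    positive, and dividing \<open>c / 2\<close> by the number \<open>1 - A\<^sub>0\<^sup>2\<close>
    in (0, 1) enlarges it to \<gamma>.\<close>
  ultimately have A\<^sub>0: "0 < A\<^sub>0" "A\<^sub>0 < 1" by (simp_all add: A\<^sub>0_def)
  then have A\<^sub>0_sq: "0 < A\<^sub>0\<^sup>2" "A\<^sub>0\<^sup>2 < 1"
    by (simp_all add: power_less_one_iff)
  have c: "0 < c" using A\<^sub>0 A\<^sub>0_sq \<alpha> by (simp add: c_def)
  have \<gamma>: "c / (2 * (1 - A\<^sub>0\<^sup>2)) = sqrt \<alpha> / (2 * A\<^sub>0)"
    using A\<^sub>0_sq A\<^sub>0 unfolding c_def by (simp add: field_simps)
  have "c / 2 < c / (2 * (1 - A\<^sub>0\<^sup>2))"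
    using c A\<^sub>0_sq by (intro divide_strict_left_mono) auto
  then have \<gamma>_gt: "c / 2 < sqrt \<alpha> / (2 * A\<^sub>0)" by (simp only: \<gamma>)
  have obj: "objective \<alpha> \<beta> c (sqrt 2 * q\<^sub>w) (sqrt \<alpha> / (2 * A\<^sub>0)) = I_ldp \<alpha> \<beta> \<beta>\<^sub>w \<beta>\<^sub>0"
    unfolding c_def A\<^sub>0_def q\<^sub>w_def q\<^sub>0_def
    by (rule objective_at_optimum[OF \<alpha> \<beta>(2) assms(10,12,11,13)])
  have "I_err \<alpha> \<beta> (\<lambda>n. P_err (M n) (A n) (x n)) \<le> ereal (objective \<alpha> \<beta> c (sqrt 2 * q\<^sub>w) (sqrt \<alpha> / (2 * A\<^sub>0)))"
    by (rule I_err_le_objective[OF \<alpha>(1) c _ \<gamma>_gt assms(4)]) (use q in auto)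
  then have "I_err \<alpha> \<beta> (\<lambda>n. P_err (M n) (A n) (x n)) \<le> ereal (I_ldp \<alpha> \<beta> \<beta>\<^sub>w \<beta>\<^sub>0)"
    by (simp only: obj)
  then show ?thesis
    using c q \<gamma>_gt obj
    unfolding Let_def q\<^sub>w_def[symmetric] q\<^sub>0_def[symmetric] A\<^sub>0_def[symmetric] c_def[symmetric] \<gamma> by simp
qed

end
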